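(* Let $\mathcal{Y}$ be a nonempty measurable space and $\mathcal{H}$ a nonempty set of measurable functions $\mathbb{R}\to\mathcal{Y}$ satisfying the zero-measure crossings property with graph dimension $d\in(0,\infty)$. Fix $\varepsilon\in(0,1/2)$ and $k\in\mathbb{N}$ with $k\ge 80/\varepsilon$. For appropriate choices of the numerical constants $c,c',c''\ge1$, the procedure that runs the sampling procedure below, queries $f$ at the $m(\ell+1)$ points $x_i$ and $x'_{ij}$ ($i\le m$, $j\le \ell$), and outputs accept if $\widehat{\mathrm{NS}}_\delta(f;\mathcal{H})\le (k-1)\frac{\delta}{2}(1+\frac{\varepsilon}{8})$ and reject otherwise, is an $s$-sample $q$-query $\varepsilon$-tester for $\mathcal{F}_k(\mathcal{H})$ under $\mathrm{Uniform}(0,1)$, with $s$ as defined below and $q=m(\ell+1)$.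
   Context: Zero-measure crossings: distinct $h,h'\in\mathcal{H}$ agree only on a Lebesgue-null set. Graph dimension $d$: VC dimension of $\{\{(x,h(x)):x\in\mathbb{R}\}:h\in\mathcal{H}\}$. $\mathcal{F}_k(\mathcal{H})$: with $t_0=-\infty$, $t_k=\infty$, all functions $x\mapsto h_i(x)$ for the $i$ with $t_{i-1}<x\le t_i$, over all $t_1\le\cdots\le t_{k-1}$ and $h_1,\dots,h_k\in\mathcal{H}$. $\mathrm{dist}(f,g)=P(x:f(x)\ne g(x))$ with $P=\mathrm{Uniform}(0,1)$, $\mathrm{dist}(f,\mathcal{F})=\inf_{g\in\mathcal{F}}\mathrm{dist}(f,g)$. An $s$-sample $q$-query $\varepsilon$-tester for $\mathcal{F}$ under $P$: a randomized algorithm drawing at most $s$ i.i.d. points from $P$, sequentially querying the target $f$ on at most $q$ of them, and outputting accept/reject so that for every measurable $f$: if $f\in\mathcal{F}$ it accepts w.p. $\ge2/3$, and if $\mathrm{dist}(f,\mathcal{F})\ge\varepsilon$ it rejects w.p. $\ge2/3$. Sampling procedure: $m=\lceil c/\varepsilon^4\rceil$, $\ell=\lceil \frac{c' d}{\varepsilon^4}\ln(\frac{c''}{\varepsilon})\rceil$, $\delta=\frac{\varepsilon^2}{32k}$, $s=m+\lceil\max\{\frac{2\ell}{\delta},\frac{8}{\delta}\ln(12m)\}\rceil$. Draw $x''_1,\dots,x''_s$ i.i.d. $\mathrm{Uniform}(0,1)$, set $x_i=x''_i$ for $i\le m$; for each $i\le m$, $t_{i0}=m$ and $t_{ij}=\min\{t\in\{t_{i(j-1)}+1,\dots,s\}:x''_t\in(x_i-\delta,x_i+\delta)\}$,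 $x'_{ij}=x''_{t_{ij}}$ ($j\le\ell$); if some $t_{ij}$ does not exist the procedure may output anything. With $\mathcal{H}_{(x,y)}=\{h\in\mathcal{H}:h(x)=y\}$, $\widehat{\mathrm{NS}}_\delta(f,x_i;\mathcal{H})=\min_{h\in\mathcal{H}_{(x_i,f(x_i))}}\frac1\ell\sum_{j=1}^\ell\mathbb{1}[h(x'_{ij})\ne f(x'_{ij})]$ (or $1$ if that set is empty), and $\widehat{\mathrm{NS}}_\delta(f;\mathcal{H})=\frac1m\sum_{i=1}^m\widehat{\mathrm{NS}}_\delta(f,x_i;\mathcal{H})$.
   Formalization: Adds the usual VC measurability proviso, without which the claim can fail: for measurable f, each set {h=f} with h in H is Borel, and the event that some h in H has a given agreement pattern with f on an i.i.d. sample is measurable in the completed product space. *)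

theory Defs
  imports "HOL-Probability.Probability" "HOL-Library.Extended_Nat"
begin

section \<open>Function classes\<close>

definition zero_measure_crossings :: "(real \<Rightarrow> 'y) set \<Rightarrow> bool" where
  "zero_measure_crossings H \<longleftrightarrow>
     (\<forall>h\<in>H. \<forall>h'\<in>H. h \<noteq> h' \<longrightarrow> {x. h x = h' x} \<in> null_sets lebesgue)"

definition shatters :: "'a set set \<Rightarrow> 'a set \<Rightarrow> bool" where
  "shatters C A \<longleftrightarrow> (\<forall>B\<subseteq>A. \<exists>S\<in>C. S \<inter> A = B)"

definition vc_dim :: "'a set set \<Rightarrow> enat" where
  "vc_dim C = (SUP A\<in>{A. finite A \<and> shatters C A}. enat (card A))"

definition graph_dim :: "(real \<Rightarrow> 'y) set \<Rightarrow> enat" where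
  "graph_dim H = vc_dim ((\<lambda>h. {(x, h x) |x. True}) ` H)"

definition piecewise :: "nat \<Rightarrow> (real \<Rightarrow> 'y) set \<Rightarrow> (real \<Rightarrow> 'y) set" where
  "piecewise k H = {g. \<exists>(t :: nat \<Rightarrow> ereal) h.
     t 0 = -\<infinity> \<and> t k = \<infinity> \<and> (\<forall>i\<in>{1..<k}. t i \<in> range ereal) \<and> mono_on {0..k} t \<and>
     (\<forall>i\<in>{1..k}. h i \<in> H) \<and>
     (\<forall>x. \<forall>i\<in>{1..k}. t (i - 1) < ereal x \<and> ereal x \<le> t i \<longrightarrow> g x = h i x)}"

definition consistent :: "(real \<Rightarrow> 'y) set \<Rightarrow> real \<Rightarrow> 'y \<Rightarrow> (real \<Rightarrow> 'y) set" where
  "consistent H x y = {h \<in> H. h x = y}"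

abbreviation uniform01 :: "real measure" where
  "uniform01 \<equiv> uniform_measure lborel {0<..<1}"

text \<open>The usual measurability proviso of VC theory.  The first part says that
  \<open>P (x : f x \<noteq> h x)\<close> is the probability of an event.  The second part says that, for a
  measurable target \<open>f\<close>, realisability of an agreement pattern \<open>S\<close> by some \<open>h \<in> H\<close> on an i.i.d.
  sample is an event of the completed sample space.  The first part holds if the diagonal of \<open>Y\<close>
  is measurable; given that, the second holds for countable \<open>H\<close> and, more generally, for
  image-admissible Suslin classes.

  Uniform convergence over \<open>H\<close> fails without such a proviso.  Under the continuum hypothesis,
  well-order the interval \<open>(0,1)\<close> in type \<open>\<omega>\<^sub>1\<close> and, for \<open>a \<in> (0,1)\<close>, let \<open>h\<^sub>a\<close> be \<open>0\<close> on the
  countable set of predecessors of \<open>a\<close> and constantly \<open>a\<close> elsewhere.  This class has zero-measure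
  crossings and graph dimension \<open>1\<close>; the target \<open>0\<close> is at distance \<open>1\<close> from all its piecewise
  combinations, but on every finite sample it agrees with some \<open>h\<^sub>a\<close>.\<close>

definition measurably_well_behaved :: "'y measure \<Rightarrow> (real \<Rightarrow> 'y) set \<Rightarrow> bool" where
  "measurably_well_behaved Y H \<longleftrightarrow> (\<forall>f \<in> borel \<rightarrow>\<^sub>M Y.
     (\<forall>h\<in>H. {x. h x = f x} \<in> sets borel) \<and>
     (\<forall>n::nat. \<forall>S\<subseteq>{..<n}.
        {x \<in> space (PiM {..<n} (\<lambda>_. uniform01)). \<exists>h\<in>H. \<forall>i<n. h (x i) = f (x i) \<longleftrightarrow> i \<in> S}
          \<in> sets (completion (PiM {..<n} (\<lambda>_. uniform01)))))"


section \<open>Testers\<close>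

definition fdist :: "real measure \<Rightarrow> (real \<Rightarrow> 'y) \<Rightarrow> (real \<Rightarrow> 'y) \<Rightarrow> real" where
  "fdist P f g = measure P {x \<in> space P. f x \<noteq> g x}"

definition dist_class :: "real measure \<Rightarrow> (real \<Rightarrow> 'y) \<Rightarrow> (real \<Rightarrow> 'y) set \<Rightarrow> real" where
  "dist_class P f F = (INF g\<in>F. fdist P f g)"

text \<open>Adaptive query strategies: \<open>Query i c\<close> asks for the label of the \<open>i\<close>-th sample point and
  continues with \<open>c y\<close> on answer \<open>y\<close>.\<close>

datatype 'y strategy = Output bool | Query nat "'y \<Rightarrow> 'y strategy"

primrec run :: "'y strategy \<Rightarrow> (nat \<Rightarrow> 'y) \<Rightarrow> bool" where
  "run (Output b) lab = b"
| "run (Query i c) lab = run (c (lab i)) lab"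

primrec query_bounded :: "'y strategy \<Rightarrow> nat set \<Rightarrow> nat \<Rightarrow> bool" where
  "query_bounded (Output b) I q = True"
| "query_bounded (Query i c) I q = (i \<in> I \<and> q > 0 \<and> (\<forall>y. query_bounded (c y) I (q - 1)))"

text \<open>For an event \<open>E\<close> this is \<open>measure M E \<ge> p\<close>; in general it bounds the inner probability of
  \<open>E\<close>.  The general case matters because the behaviour of an algorithm on a set of small
  probability may be arbitrary, hence non-measurable.\<close>

definition prob_at_least :: "'a measure \<Rightarrow> real \<Rightarrow> 'a set \<Rightarrow> bool" where
  "prob_at_least M p E \<longleftrightarrow> (\<exists>A\<in>sets M. A \<subseteq> E \<and> measure M A \<ge> p)"

text \<open>\<open>R\<close> is the distribution of the internal randomness.  The algorithm \<open>A\<close> sees the seed and the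
  sample \<open>x 1, \<dots>, x s\<close>, but accesses the target only through the labels it queries.  An algorithm
  that draws fewer than \<open>s\<close> points is one that ignores some of them.\<close>

definition is_tester ::
  "real measure \<Rightarrow> 'y measure \<Rightarrow> (real \<Rightarrow> 'y) set \<Rightarrow> nat \<Rightarrow> nat \<Rightarrow> real \<Rightarrow>
   'w measure \<Rightarrow> ('w \<Rightarrow> (nat \<Rightarrow> real) \<Rightarrow> 'y strategy) \<Rightarrow> bool" where
  "is_tester P Y F s q \<epsilon> R A \<longleftrightarrow>
     prob_space R \<and>
     (\<forall>\<omega>\<in>space R. \<forall>x\<in>space (PiM {1..s} (\<lambda>_. P)). query_bounded (A \<omega> x) {1..s} q) \<and>
     (\<forall>f \<in> P \<rightarrow>\<^sub>M Y.
        let M = R \<Otimes>\<^sub>M PiM {1..s} (\<lambda>_. P);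
            accepts = (\<lambda>(\<omega>, x). run (A \<omega> x) (\<lambda>i. f (x i)))
        in (f \<in> F \<longrightarrow> prob_at_least M (2/3) {z \<in> space M. accepts z}) \<and>
           (dist_class P f F \<ge> \<epsilon> \<longrightarrow> prob_at_least M (2/3) {z \<in> space M. \<not> accepts z}))"


section \<open>The noise-sensitivity procedure\<close>

definition num_centres :: "real \<Rightarrow> real \<Rightarrow> nat" where
  "num_centres c \<epsilon> = nat \<lceil>c / \<epsilon> ^ 4\<rceil>"

definition num_neighbours :: "real \<Rightarrow> real \<Rightarrow> nat \<Rightarrow> real \<Rightarrow> nat" where
  "num_neighbours c' c'' d \<epsilon> = nat \<lceil>c' * real d / \<epsilon> ^ 4 * ln (c'' / \<epsilon>)\<rceil>"

definition radius :: "real \<Rightarrow> nat \<Rightarrow> real" where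
  "radius \<epsilon> k = \<epsilon>\<^sup>2 / (32 * real k)"

definition sample_size :: "nat \<Rightarrow> nat \<Rightarrow> real \<Rightarrow> nat" where
  "sample_size m l \<delta> = m + nat \<lceil>max (2 * real l / \<delta>) (8 / \<delta> * ln (12 * real m))\<rceil>"

text \<open>The sample is \<open>x 1, \<dots>, x s\<close>, with centres \<open>x 1, \<dots>, x m\<close>;
  \<open>neighbour m s \<delta> x i j\<close> is the index \<open>t\<^sub>i\<^sub>j\<close>, if it exists.\<close>

primrec neighbour :: "nat \<Rightarrow> nat \<Rightarrow> real \<Rightarrow> (nat \<Rightarrow> real) \<Rightarrow> nat \<Rightarrow> nat \<Rightarrow> nat option" where
  "neighbour m s \<delta> x i 0 = Some m"
| "neighbour m s \<delta> x i (Suc j) =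
     (case neighbour m s \<delta> x i j of
        None \<Rightarrow> None
      | Some t' \<Rightarrow>
          let T = {t \<in> {t' + 1..s}. x t \<in> {x i - \<delta><..<x i + \<delta>}}
          in if T = {} then None else Some (Min T))"

text \<open>In the estimators, \<open>t i j\<close> is the index of the \<open>j\<close>-th neighbour of \<open>x i\<close>, and \<open>lab n\<close> is the
  label \<open>f (x n)\<close>.  The minimum ranges over a set of multiples of \<open>1/l\<close> in \<open>[0,1]\<close>, which is
  finite even for infinite \<open>H\<close>.\<close>

definition NS_hat_at ::
  "(real \<Rightarrow> 'y) set \<Rightarrow> nat \<Rightarrow> (nat \<Rightarrow> nat \<Rightarrow> nat) \<Rightarrow> (nat \<Rightarrow> real) \<Rightarrow> (nat \<Rightarrow> 'y) \<Rightarrow> nat \<Rightarrow> real" where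
  "NS_hat_at H l t x lab i =
     (if consistent H (x i) (lab i) = {} then 1
      else Min ((\<lambda>h. 1 / real l * (\<Sum>j=1..l. of_bool (h (x (t i j)) \<noteq> lab (t i j))))
                  ` consistent H (x i) (lab i)))"

definition NS_hat ::
  "(real \<Rightarrow> 'y) set \<Rightarrow> nat \<Rightarrow> nat \<Rightarrow> (nat \<Rightarrow> nat \<Rightarrow> nat) \<Rightarrow> (nat \<Rightarrow> real) \<Rightarrow> (nat \<Rightarrow> 'y) \<Rightarrow> real" where
  "NS_hat H m l t x lab = 1 / real m * (\<Sum>i=1..m. NS_hat_at H l t x lab i)"

primrec query_all :: "nat list \<Rightarrow> (nat \<Rightarrow> 'y) \<Rightarrow> ((nat \<Rightarrow> 'y) \<Rightarrow> bool) \<Rightarrow> 'y strategy" where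
  "query_all [] lab D = Output (D lab)"
| "query_all (n # ns) lab D = Query n (\<lambda>y. query_all ns (lab(n := y)) D)"

text \<open>The parameter \<open>fallback\<close> is the arbitrary behaviour in case some \<open>t\<^sub>i\<^sub>j\<close> does not exist.\<close>

definition NS_procedure ::
  "(real \<Rightarrow> 'y) set \<Rightarrow> nat \<Rightarrow> real \<Rightarrow> nat \<Rightarrow> nat \<Rightarrow> real \<Rightarrow> nat \<Rightarrow>
   ('w \<Rightarrow> (nat \<Rightarrow> real) \<Rightarrow> 'y strategy) \<Rightarrow> 'w \<Rightarrow> (nat \<Rightarrow> real) \<Rightarrow> 'y strategy" where
  "NS_procedure H k \<epsilon> m l \<delta> s fallback \<omega> x =
     (if \<forall>i\<in>{1..m}. \<forall>j\<in>{1..l}. neighbour m s \<delta> x i j \<noteq> None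
      then let t = (\<lambda>i j. the (neighbour m s \<delta> x i j))
           in query_all (concat (map (\<lambda>i. i # map (t i) [1..<l + 1]) [1..<m + 1])) (\<lambda>_. undefined)
                (\<lambda>lab. NS_hat H m l t x lab \<le> (real k - 1) * (\<delta> / 2) * (1 + \<epsilon> / 8))
      else fallback \<omega> x)"

end

theory Submission
  imports Defs
begin

text \<open>
  For a centre \<open>x\<close> let \<open>p\<^sub>h(x)\<close> be the fraction of the window \<open>(x - \<delta>, x + \<delta>)\<close> on which \<open>h\<close> agrees with
  the target \<open>f\<close>.  Zero-measure crossings make the agreement sets almost disjoint, so the \<open>p\<^sub>h(x)\<close> add up
  to at most \<open>1\<close>, and each \<open>p\<^sub>h\<close> is Lipschitz with constant \<open>1/(2\<delta>)\<close>.

  If \<open>f\<close> is piecewise in \<open>H\<close>, the hypothesis of the piece containing \<open>x\<close> errs only near a breakpoint, and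
  each breakpoint contributes \<open>\<delta>/2\<close> to the average.  Conversely, call \<open>x\<close> determined by \<open>h\<close> if
  \<open>p\<^sub>h(x) > 1 - \<tau>\<close>.  Between points determined by different hypotheses some \<open>p\<^sub>h\<close> takes the value \<open>1/2\<close>,
  so by the Lipschitz bound each change costs almost \<open>\<delta>/2\<close>.  Low sensitivity therefore allows only
  slightly more than \<open>k - 1\<close> changes, and dropping the shortest pieces gives an element of
  \<open>piecewise k H\<close> close to \<open>f\<close>.  All this tolerates an additive error \<open>\<epsilon>/128\<close> in every local
  sensitivity that exceeds it.

  Such an additive error is what uniform convergence for the agreement sets gives: they form a class of VC
  dimension at most \<open>d\<close>, and the sample in a window, being the first \<open>l\<close> hits, is conditionally i.i.d. given
  their positions.  The remaining randomness, in the centres, is handled by Chebyshev's inequality.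
\<close>

section \<open>Sauer--Shelah and signed sums\<close>

text \<open>By \<open>real k * radius \<epsilon> k = \<epsilon>\<^sup>2 / 32\<close> the threshold
  is about \<open>\<epsilon>\<^sup>2 / 64\<close>, but uniform convergence is used with accuracy
  \<open>\<epsilon> / 128\<close>. An error of that size at every centre would swamp the signal. It
  is charged only where something happens: for a target in the class a window without a breakpoint
  has estimate exactly 0, and the lower bound for far targets is truncated at 0. Both directions go
  through explicit measurable functions of the centre, \<open>U\<close> above and \<open>V\<close>
  below the estimate, and only these are averaged. This also avoids averaging an optimum over a
  possibly uncountable \<open>H\<close>: \<open>V\<close> involves just the finitely many hypotheses
  that agree with \<open>f\<close> on mass at least \<open>\<delta>\<close>. Chebyshev's inequality
  is used with the variance bounded by the mean, of order \<open>\<epsilon>\<^sup>2\<close> at the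
  threshold; a relative gap of order \<open>\<epsilon>\<close> then takes about
  \<open>1 / \<epsilon> ^ 4\<close> centres. Windows are random, so the exceptional set of uniform
  convergence has to be measurable jointly in centre and sample.\<close>

lemma card_le_card_shattered:
  assumes "finite N" "C \<subseteq> Pow N"
  shows "card C \<le> card {A. A \<subseteq> N \<and> shatters C A}"
  using assms
proof (induction N arbitrary: C rule: finite_induct)
  case empty
  then consider "C = {}" | "C = {{}}" by (auto simp: subset_singleton_iff)
  then show ?case
  proof cases
    case 2
    then have "{A. A \<subseteq> {} \<and> shatters C A} = {{}}" by (auto simp: shatters_def)
    then show ?thesis using 2 by simp
  qed simp
next
  case (insert x N)
  \<comment> \<open>Pajor's induction. \<open>C0\<close> is the trace of \<open>C\<close> on
    \<open>N\<close>; \<open>C1\<close> counts the traces that arise twice. A set shattered by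
    \<open>C1\<close> can be enlarged by \<open>x\<close> and is still shattered by
    \<open>C\<close>, so both parts of the count survive as different shattered sets.\<close>
  define C0 where "C0 = (\<lambda>S. S - {x}) ` C"
  define C1 where "C1 = {S \<in> C. x \<notin> S \<and> insert x S \<in> C}"
  have finC: "finite C" using insert.prems insert.hyps finite_subset by fastforce
  have sub: "C0 \<subseteq> Pow N" "C1 \<subseteq> Pow N" using insert.prems by (auto simp: C0_def C1_def)
  define sh where "sh D M = {A. A \<subseteq> M \<and> shatters D A}" for D :: "'a set set" and M
  have sh_iff: "A \<in> sh D M \<longleftrightarrow> A \<subseteq> M \<and> shatters D A" for A D M by (simp add: sh_def)
  have fin_sh: "finite (sh D M)" if "finite M" for D M
    using that by (intro finite_subset[of "sh D M" "Pow M"]) (auto simp: sh_iff)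
  have "card C = card C0 + card C1"
  proof -
    let ?X = "{S \<in> C. x \<in> S}" and ?Y = "{S \<in> C. x \<notin> S}"
    have "card C = card ?X + card ?Y"
      using finC by (subst card_Un_disjoint[symmetric]) (auto intro!: arg_cong[where f=card])
    moreover have "card ?X = card ((\<lambda>S. S - {x}) ` ?X)"
      by (subst card_image) (auto simp: inj_on_def)
    moreover have "C0 = (\<lambda>S. S - {x}) ` ?X \<union> ?Y"
      by (auto simp: C0_def image_iff)
    moreover have "C1 = (\<lambda>S. S - {x}) ` ?X \<inter> ?Y"
      by (auto simp: C1_def image_iff insert_absorb)
    ultimately show ?thesis
      using card_Un_Int[of "(\<lambda>S. S - {x}) ` ?X" ?Y] finC by simp
  qed
  also have "\<dots> \<le> card (sh C0 N) + card (sh C1 N)"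
    using insert.IH[OF sub(1)] insert.IH[OF sub(2)] by (simp add: sh_def)
  also have "card (sh C1 N) = card (insert x ` sh C1 N)"
  proof (rule card_image[symmetric], rule inj_onI)
    fix A B assume AB: "A \<in> sh C1 N" "B \<in> sh C1 N" "insert x A = insert x B"
    then have "x \<notin> A" "x \<notin> B" using insert.hyps(2) by (auto simp: sh_iff)
    then show "A = B" using AB(3) by (simp add: insert_ident)
  qed
  also have "card (sh C0 N) + card (insert x ` sh C1 N) = card (sh C0 N \<union> insert x ` sh C1 N)"
    using insert.hyps by (intro card_Un_disjoint[symmetric]) (auto simp: fin_sh sh_iff)
  also have "\<dots> \<le> card (sh C (insert x N))"
  proof (rule card_mono)
    show "finite (sh C (insert x N))" using insert.hyps(1) by (simp add: fin_sh)
    have "shatters C A" if A: "A \<subseteq> N" "shatters C0 A" for A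
      unfolding shatters_def
    proof (intro allI impI)
      fix B assume "B \<subseteq> A"
      with A(2) obtain S0 where "S0 \<in> C0" "S0 \<inter> A = B" unfolding shatters_def by metis
      then obtain S where "S \<in> C" "(S - {x}) \<inter> A = B" unfolding C0_def by auto
      moreover have "(S - {x}) \<inter> A = S \<inter> A" using A insert.hyps by auto
      ultimately show "\<exists>S\<in>C. S \<inter> A = B" by auto
    qed
    moreover have "shatters C (insert x A)" if A: "A \<subseteq> N" "shatters C1 A" for A
      unfolding shatters_def
    proof (intro allI impI)
      fix B assume B: "B \<subseteq> insert x A"
      then have "B - {x} \<subseteq> A" by auto
      with A(2) obtain S where S: "S \<in> C1" "S \<inter> A = B - {x}" unfolding shatters_def by metis
      then have "S \<in> C" "insert x S \<in> C" "x \<notin> S" by (auto simp: C1_def)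
      moreover have "insert x S \<inter> insert x A = B" if "x \<in> B" using S(2) that B by auto
      moreover have "S \<inter> insert x A = B" if "x \<notin> B" using S(2) that \<open>x \<notin> S\<close> by auto
      ultimately show "\<exists>S\<in>C. S \<inter> insert x A = B" by metis
    qed
    ultimately show "sh C0 N \<union> insert x ` sh C1 N \<subseteq> sh C (insert x N)"
      by (auto simp: sh_iff)
  qed
  finally show ?case by (simp add: sh_def)
qed

text \<open>Each \<open>A\<close> with \<open>card A \<le> d\<close> gets weight
  \<open>x ^ card A / x ^ d \<ge> 1\<close>, and the binomial theorem sums the weights over all
  subsets. The free \<open>x\<close> avoids a case distinction on \<open>card N \<ge> d\<close>;
  chosen as a small multiple of the squared accuracy, it makes the linear term cost only half of the
  later exponential gain.\<close>

lemma sauer_shelah_exp: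
  fixes x :: real
  assumes "finite N" "C \<subseteq> Pow N" and sh: "\<And>A. A \<subseteq> N \<Longrightarrow> shatters C A \<Longrightarrow> card A \<le> d"
    and x: "0 < x" "x \<le> 1"
  shows "real (card C) \<le> exp (x * real (card N) + real d * ln (1 / x))"
proof -
  have "real (card C) \<le> real (card {A. A \<subseteq> N \<and> shatters C A})"
    using card_le_card_shattered[OF assms(1,2)] by simp
  also have "\<dots> \<le> real (card {A. A \<subseteq> N \<and> card A \<le> d})"
    using assms(1) sh by (auto intro!: card_mono)
  also have "\<dots> = (\<Sum>A\<in>{A. A \<subseteq> N \<and> card A \<le> d}. 1)" by simp
  also have "\<dots> \<le> (\<Sum>A\<in>{A. A \<subseteq> N \<and> card A \<le> d}. x ^ card A / x ^ d)"
    using x by (intro sum_mono) (auto simp: field_simps intro!: power_decreasing)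
  also have "\<dots> \<le> (\<Sum>A\<in>Pow N. x ^ card A / x ^ d)"
    using assms(1) x by (intro sum_mono2) auto
  also have "\<dots> = (\<Sum>A\<in>Pow N. x ^ card A) / x ^ d" by (simp add: sum_divide_distrib)
  also have "(\<Sum>A\<in>Pow N. x ^ card A) = (1 + x) ^ card N"
  proof -
    have "(\<Sum>A\<in>Pow N. x ^ card A) = (\<Prod>j\<in>N. x + 1)"
      using prod_add[OF assms(1), of "\<lambda>_. x" "\<lambda>_. 1"] by simp
    then show ?thesis by (simp add: add.commute)
  qed
  also have "(1 + x) ^ card N \<le> exp x ^ card N"
    using x by (intro power_mono) (auto simp: exp_ge_add_one_self)
  also have "exp x ^ card N / x ^ d = exp (x * real (card N) + real d * ln (1 / x))"
  proof -
    have "x ^ d = exp (real d * ln x)" using x by (simp add: exp_of_nat_mult)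
    moreover have "exp x ^ card N = exp (x * real (card N))" by (simp add: exp_of_nat2_mult)
    ultimately show ?thesis using x by (simp add: exp_diff[symmetric] ln_div)
  qed
  finally show ?thesis using x by (simp add: divide_right_mono)
qed

section \<open>Sub-Gaussian tails of random signs\<close>

lemma cosh_le_exp_half_square: "cosh (x :: real) \<le> exp (x\<^sup>2 / 2)"
proof -
  have *: "cosh x \<le> exp (x\<^sup>2 / 2)" if "x \<ge> 0" for x :: real
  proof -
    \<comment> \<open>The derivative is \<open>y - tanh y\<close>; its sign reduces to that of
      \<open>z * sinh z\<close>, the derivative of \<open>z * cosh z - sinh z\<close>.\<close>
    have "x\<^sup>2 / 2 - ln (cosh x) \<ge> (0::real)\<^sup>2 / 2 - ln (cosh 0)"
    proof (rule DERIV_nonneg_imp_nondecreasing[OF that])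
      fix y :: real assume y: "0 \<le> y" "y \<le> x"
      have c: "cosh y > 0" by simp
      have "((\<lambda>y. y\<^sup>2 / 2 - ln (cosh y)) has_real_derivative y - sinh y / cosh y) (at y)"
        using c by (auto intro!: derivative_eq_intros simp: field_simps)
      moreover have "sinh y \<le> y * cosh y"
      proof -
        have "y * cosh y - sinh y \<ge> 0 * cosh 0 - sinh (0::real)"
        proof (rule DERIV_nonneg_imp_nondecreasing[OF y(1)])
          fix z :: real assume "0 \<le> z" "z \<le> y"
          then show "\<exists>D. ((\<lambda>z. z * cosh z - sinh z) has_real_derivative D) (at z) \<and> 0 \<le> D"
            by (intro exI[of _ "z * sinh z"]) (auto intro!: derivative_eq_intros)
        qed
        then show ?thesis by simp
      qed
      ultimately show "\<exists>D. ((\<lambda>y. y\<^sup>2 / 2 - ln (cosh y)) has_real_derivative D) (at y) \<and> 0 \<le> D"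
        using c by (intro exI[of _ "y - sinh y / cosh y"]) (auto simp: field_simps)
    qed
    then have "ln (cosh x) \<le> x\<^sup>2 / 2" by simp
    moreover have "cosh x = exp (ln (cosh x))" by simp
    ultimately show ?thesis by (metis exp_le_cancel_iff)
  qed
  show ?thesis using *[of x] *[of "-x"] by (cases "x \<ge> 0") auto
qed

text \<open>Hoeffding's inequality for Rademacher signs, with \<open>B\<close> the set of negated
  terms. Counting subsets instead of introducing random signs suits the symmetrization, where the
  signs come from a finite set of coordinate swaps.\<close>

lemma signed_sum_tail:
  fixes a :: "'a \<Rightarrow> real"
  assumes fin: "finite J" and a: "\<And>j. j \<in> J \<Longrightarrow> \<bar>a j\<bar> \<le> 1" and u: "u > 0"
  shows "real (card {B \<in> Pow J. (\<Sum>j\<in>J. if j \<in> B then - a j else a j) > u})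
           \<le> 2 ^ card J * exp (- u\<^sup>2 / (2 * real (card J)))"
proof (cases "J = {}")
  case True
  then show ?thesis using u by simp
next
  case False
  define n where "n = real (card J)"
  have n: "n > 0" using False fin by (simp add: n_def card_gt_0_iff)
  define r where "r = u / n"
  let ?S = "\<lambda>B. \<Sum>j\<in>J. if j \<in> B then - a j else a j"
  let ?E = "{B \<in> Pow J. ?S B > u}"
  have finE: "finite ?E" using fin by simp
  have "real (card ?E) * exp (r * u) = (\<Sum>B\<in>?E. exp (r * u))" by simp
  also have "\<dots> \<le> (\<Sum>B\<in>?E. exp (r * ?S B))"
    using n u by (intro sum_mono) (auto simp: r_def intro!: divide_right_mono mult_left_mono)
  also have "\<dots> \<le> (\<Sum>B\<in>Pow J. exp (r * ?S B))"
    using fin by (intro sum_mono2) auto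
  also have "\<dots> = (\<Sum>B\<in>Pow J. (\<Prod>j\<in>B. exp (- r * a j)) * (\<Prod>j\<in>J - B. exp (r * a j)))"
  proof (intro sum.cong refl)
    fix B assume B: "B \<in> Pow J"
    have "?S B = (\<Sum>j\<in>B. - a j) + (\<Sum>j\<in>J - B. a j)"
      using fin B by (subst sum.If_cases) (auto simp: Int_absorb1 Diff_eq)
    then have "exp (r * ?S B) = exp (\<Sum>j\<in>B. - r * a j) * exp (\<Sum>j\<in>J - B. r * a j)"
      by (simp add: exp_add[symmetric] right_diff_distrib sum_distrib_left sum_negf)
    then show "exp (r * ?S B) = (\<Prod>j\<in>B. exp (- r * a j)) * (\<Prod>j\<in>J - B. exp (r * a j))"
      using fin B by (simp add: exp_sum finite_subset)
  qed
  also have "\<dots> = (\<Prod>j\<in>J. exp (- r * a j) + exp (r * a j))"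
    using fin by (simp add: prod_add)
  also have "\<dots> = (\<Prod>j\<in>J. 2 * cosh (r * a j))" by (intro prod.cong) (auto simp: cosh_def)
  also have "\<dots> \<le> (\<Prod>j\<in>J. 2 * exp (r\<^sup>2 / 2))"
  proof (intro prod_mono conjI)
    fix j assume j: "j \<in> J"
    have "cosh (r * a j) \<le> exp ((r * a j)\<^sup>2 / 2)" by (rule cosh_le_exp_half_square)
    also have "(r * a j)\<^sup>2 \<le> r\<^sup>2 * 1"
      using a[OF j] unfolding power_mult_distrib by (intro mult_left_mono) (auto simp: abs_square_le_1)
    finally show "2 * cosh (r * a j) \<le> 2 * exp (r\<^sup>2 / 2)" by simp
  qed (simp add: order.trans[OF _ cosh_real_ge_1])
  also have "\<dots> = 2 ^ card J * exp (n * (r\<^sup>2 / 2))"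
    unfolding prod_constant power_mult_distrib n_def exp_of_nat_mult ..
  finally have "real (card ?E) \<le> 2 ^ card J * exp (n * (r\<^sup>2 / 2) - r * u)"
    by (simp add: exp_diff pos_le_divide_eq)
  also have "n * (r\<^sup>2 / 2) - r * u = - u\<^sup>2 / (2 * n)"
    using n by (simp add: r_def field_simps power2_eq_square)
  finally show ?thesis by (simp add: n_def)
qed

lemma signed_sum_abs_tail:
  fixes a :: "'a \<Rightarrow> real"
  assumes fin: "finite J" and a: "\<And>j. j \<in> J \<Longrightarrow> \<bar>a j\<bar> \<le> 1" and u: "u > 0"
  shows "real (card {B \<in> Pow J. \<bar>\<Sum>j\<in>J. if j \<in> B then - a j else a j\<bar> > u})
           \<le> 2 * 2 ^ card J * exp (- u\<^sup>2 / (2 * real (card J)))"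
proof -
  let ?S = "\<lambda>a B. \<Sum>j\<in>J. if j \<in> B then - a j else a j"
  have neg: "?S (\<lambda>j. - a j) B = - ?S a B" for B
    unfolding sum_negf[symmetric] by (intro sum.cong) auto
  have "{B \<in> Pow J. \<bar>?S a B\<bar> > u} = {B \<in> Pow J. ?S a B > u} \<union> {B \<in> Pow J. ?S (\<lambda>j. - a j) B > u}"
    unfolding neg by auto
  then have "real (card {B \<in> Pow J. \<bar>?S a B\<bar> > u})
      \<le> real (card {B \<in> Pow J. ?S a B > u}) + real (card {B \<in> Pow J. ?S (\<lambda>j. - a j) B > u})"
    by (metis (no_types, lifting) card_Un_le of_nat_add of_nat_mono)
  then show ?thesis
    using signed_sum_tail[OF fin a u] signed_sum_tail[OF fin, of "\<lambda>j. - a j" u] a u by fastforce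
qed

text \<open>Discarding the lightest element never lowers the average weight. Applied to the masses
  of the pieces when more than \<open>k\<close> of them have to be reduced to
  \<open>k\<close>.\<close>

lemma exists_heavy_subset:
  fixes w :: "'a \<Rightarrow> real"
  assumes "finite A" "k \<le> card A" "0 < k"
  shows "\<exists>S\<subseteq>A. card S = k \<and> real k * sum w A \<le> real (card A) * sum w S"
  using assms(1,2)
proof (induction "card A - k" arbitrary: A)
  case 0
  then show ?case by (intro exI[of _ A]) auto
next
  case (Suc n)
  then have fin: "finite A" and c: "card A > k" "A \<noteq> {}" by auto
  obtain a where a: "a \<in> A" "\<And>b. b \<in> A \<Longrightarrow> w a \<le> w b"
    using arg_min_if_finite[OF fin c(2), of w] by (metis not_le_imp_less)
  have cA: "card (A - {a}) = card A - 1" using a fin by simp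
  have "\<exists>S\<subseteq>A - {a}. card S = k \<and> real k * sum w (A - {a}) \<le> real (card (A - {a})) * sum w S"
    using Suc c fin by (intro Suc.hyps(1)) (auto simp: cA)
  then obtain S where S: "S \<subseteq> A - {a}" "card S = k"
     "real k * sum w (A - {a}) \<le> (real (card A) - 1) * sum w S"
    using c by (auto simp: cA of_nat_diff)
  have fS: "finite S" using S fin finite_subset by blast
  have "real k * w a = (\<Sum>b\<in>S. w a)" using S by simp
  also have "\<dots> \<le> sum w S" using S a by (intro sum_mono) auto
  finally have "real k * w a \<le> sum w S" .
  moreover have "sum w A = w a + sum w (A - {a})" using fin a by (simp add: sum.remove)
  ultimately have "real k * sum w A \<le> real (card A) * sum w S"
    using S(3) by (simp add: algebra_simps)
  then show ?case using S by (intro exI[of _ S]) auto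
qed

section \<open>Product measures and stopped samples\<close>

abbreviation iid :: "'i set \<Rightarrow> 'a measure \<Rightarrow> ('i \<Rightarrow> 'a) measure" where
  "iid I P \<equiv> PiM I (\<lambda>_. P)"

abbreviation cube :: "'i set \<Rightarrow> 'a set \<Rightarrow> ('i \<Rightarrow> 'a) set" where
  "cube I W \<equiv> PiE I (\<lambda>_. W)"

section \<open>Moments and conditioning in product measures\<close>

lemma PiM_second_moment:
  fixes g :: "'a \<Rightarrow> real" and I :: "'i set"
  assumes N: "prob_space N" and fin: "finite I" and g[measurable]: "g \<in> borel_measurable N"
    and bd: "\<And>x. x \<in> space N \<Longrightarrow> \<bar>g x\<bar> \<le> B" and z: "(\<integral>x. g x \<partial>N) = 0"
  shows "integrable (iid I N) (\<lambda>x. (\<Sum>i\<in>I. g (x i))\<^sup>2)"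
    and "(\<integral>x. (\<Sum>i\<in>I. g (x i))\<^sup>2 \<partial>iid I N) = real (card I) * (\<integral>x. (g x)\<^sup>2 \<partial>N)"
proof -
  interpret N: prob_space N by fact
  interpret PP: prob_space "iid I N" by (intro prob_space_PiM N)
  interpret P: product_prob_space "\<lambda>_. N" I by unfold_locales
  have B: "0 \<le> B" using N.not_empty bd by fastforce
  have gi: "integrable N g" using bd by (intro N.integrable_const_bound[where B=B]) auto
  have int: "integrable (iid I N) (\<lambda>x. g (x i) * g (x j))" if ij: "i \<in> I" "j \<in> I" for i j
  proof (rule PP.integrable_const_bound[where B="B * B"])
    show "AE x in iid I N. norm (g (x i) * g (x j)) \<le> B * B"
      using ij bd B by (intro AE_I2) (auto simp: space_PiM PiE_iff abs_mult intro!: mult_mono)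
  qed (use ij in measurable)
  have val: "(\<integral>x. g (x i) * g (x j) \<partial>iid I N) = (if i = j then (\<integral>x. (g x)\<^sup>2 \<partial>N) else 0)"
    if ij: "i \<in> I" "j \<in> I" for i j
  proof -
    \<comment> \<open>A product over all coordinates with trivial factors 1, so that the product
      formula for integrals applies; for \<open>i = j\<close> both factors fall on the same
      coordinate.\<close>
    let ?f = "\<lambda>k y. (if k = i then g y else 1) * (if k = j then g y else 1)"
    have "(\<integral>x. g (x i) * g (x j) \<partial>iid I N) = (\<integral>x. (\<Prod>k\<in>I. ?f k (x k)) \<partial>iid I N)"
      using fin ij by (intro Bochner_Integration.integral_cong) (auto simp: prod.distrib prod.delta)
    also have "\<dots> = (\<Prod>k\<in>I. (\<integral>y. ?f k y \<partial>N))"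
    proof (rule P.product_integral_prod[OF fin])
      have "integrable N (\<lambda>y. g y * g y)"
      proof (rule N.integrable_const_bound[where B="B * B"], rule AE_I2)
        show "norm (g y * g y) \<le> B * B" if "y \<in> space N" for y
          using mult_mono[OF bd[OF that] bd[OF that] B] by (simp add: abs_mult)
      qed measurable
      then show "integrable N (?f k)" for k using gi by (cases "k = i"; cases "k = j") simp_all
    qed
    also have "\<dots> = (if i = j then (\<integral>x. (g x)\<^sup>2 \<partial>N) else 0)"
    proof (cases "i = j")
      case True
      have "(\<Prod>k\<in>I. (\<integral>y. ?f k y \<partial>N)) = (\<Prod>k\<in>I. if k = i then (\<integral>x. (g x)\<^sup>2 \<partial>N) else 1)"
        using True by (intro prod.cong) (auto simp: power2_eq_square N.prob_space)
      then show ?thesis using True fin ij by (simp add: prod.delta)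
    next
      case False
      then have "(\<integral>y. ?f i y \<partial>N) = 0" using z by simp
      then show ?thesis using False fin ij by (auto intro!: prod_zero bexI[of _ i])
    qed
    finally show ?thesis .
  qed
  have sq: "(\<Sum>i\<in>I. g (x i))\<^sup>2 = (\<Sum>i\<in>I. \<Sum>j\<in>I. g (x i) * g (x j))" for x
    by (simp add: power2_eq_square sum_product)
  show "integrable (iid I N) (\<lambda>x. (\<Sum>i\<in>I. g (x i))\<^sup>2)"
    unfolding sq by (intro Bochner_Integration.integrable_sum int)
  show "(\<integral>x. (\<Sum>i\<in>I. g (x i))\<^sup>2 \<partial>iid I N) = real (card I) * (\<integral>x. (g x)\<^sup>2 \<partial>N)"
    unfolding sq using fin
    by (simp add: Bochner_Integration.integral_sum int val sum.delta Bochner_Integration.integrable_sum)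
qed

text \<open>Chebyshev with the variance bounded by the mean, which is possible because
  \<open>g\<close> takes values between 0 and 1. The bound thus improves for small means, and the
  sensitivities to be told apart are small.\<close>

lemma PiM_deviation_bound:
  fixes g :: "'a \<Rightarrow> real"
  assumes N: "prob_space N" and fin: "finite I" and g[measurable]: "g \<in> borel_measurable N"
    and bd: "\<And>x. x \<in> space N \<Longrightarrow> 0 \<le> g x \<and> g x \<le> 1" and a: "a > 0"
    and v: "(\<integral>x. g x \<partial>N) \<le> v"
  shows "measure (iid I N)
           {x \<in> space (iid I N). \<bar>(\<Sum>i\<in>I. g (x i)) - real (card I) * (\<integral>x. g x \<partial>N)\<bar> \<ge> a}
         \<le> real (card I) * v / a\<^sup>2"
proof -
  interpret N: prob_space N by fact
  interpret PP: prob_space "iid I N" by (intro prob_space_PiM N)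
  define \<mu> where "\<mu> = (\<integral>x. g x \<partial>N)"
  have gi: "integrable N g" using bd by (intro N.integrable_const_bound[where B=1]) auto
  have g2i: "integrable N (\<lambda>x. (g x)\<^sup>2)"
    using bd by (intro N.integrable_const_bound[where B=1]) (auto simp: power_le_one)
  have \<mu>: "0 \<le> \<mu>" "\<mu> \<le> 1"
    using bd gi by (auto simp: \<mu>_def intro!: N.integral_le_const integral_nonneg_AE)
  have dev: "\<bar>g x - \<mu>\<bar> \<le> 1" if "x \<in> space N" for x using bd[OF that] \<mu> by auto
  have z: "(\<integral>x. g x - \<mu> \<partial>N) = 0" using gi by (simp add: \<mu>_def N.prob_space)
  have "(\<integral>x. (g x - \<mu>)\<^sup>2 \<partial>N) = (\<integral>x. (g x)\<^sup>2 \<partial>N) - \<mu>\<^sup>2"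
    using N.variance_eq[OF gi g2i] by (simp add: \<mu>_def)
  also have "\<dots> \<le> (\<integral>x. (g x)\<^sup>2 \<partial>N)" by simp
  also have "\<dots> \<le> (\<integral>x. g x \<partial>N)"
    using bd gi g2i by (intro integral_mono) (auto simp: power2_eq_square mult_left_le)
  finally have var: "(\<integral>x. (g x - \<mu>)\<^sup>2 \<partial>N) \<le> v" using v by simp
  have meas: "(\<lambda>x. g x - \<mu>) \<in> borel_measurable N" by measurable
  note m2 = PiM_second_moment[OF N fin meas dev z]
  have "measure (iid I N) {x \<in> space (iid I N). \<bar>\<Sum>i\<in>I. g (x i) - \<mu>\<bar> \<ge> a}
      \<le> (\<integral>x. (\<Sum>i\<in>I. g (x i) - \<mu>)\<^sup>2 \<partial>iid I N) / a\<^sup>2"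
    using m2(1) a by (intro PP.second_moment_method) auto
  also have "\<dots> = real (card I) * (\<integral>x. (g x - \<mu>)\<^sup>2 \<partial>N) / a\<^sup>2" using m2(2) by simp
  also have "\<dots> \<le> real (card I) * v / a\<^sup>2"
    using var by (intro divide_right_mono mult_left_mono) auto
  finally show ?thesis by (simp add: sum_subtractf \<mu>_def)
qed

text \<open>Conditioning every coordinate on \<open>W\<close> amounts to conditioning the product on
  the cube over \<open>W\<close>. Probabilities about points known to lie in a window thereby become
  probabilities about an i.i.d. sample from the conditional law.\<close>

lemma measure_PiM_uniform_measure:
  assumes P: "prob_space P" and W[measurable]: "W \<in> sets P" and w: "measure P W > 0" and fin: "finite I"
    and A: "A \<in> sets (iid I P)"
  shows "measure (iid I P) (A \<inter> cube I W)
          = measure P W ^ card I * measure (PiM I (\<lambda>_. uniform_measure P W)) A"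
proof -
  interpret P: prob_space P by fact
  interpret M: prob_space "iid I P" by (intro prob_space_PiM P)
  interpret PP: product_prob_space "\<lambda>_. P" I by unfold_locales
  have Q: "prob_space (uniform_measure P W)"
    using w by (intro prob_space_uniform_measure) (auto simp: P.emeasure_eq_measure)
  interpret Q: prob_space "uniform_measure P W" by fact
  interpret QQ: product_prob_space "\<lambda>_. uniform_measure P W" I by unfold_locales
  let ?E = "cube I W" and ?N = "iid I P"
  have E: "?E \<in> sets ?N" using fin by (intro sets_PiM_I_finite) auto
  have prodP: "measure ?N (PiE I B) = (\<Prod>i\<in>I. measure P (B i))" if "\<And>i. i \<in> I \<Longrightarrow> B i \<in> sets P" for B
    using PP.emeasure_PiM[OF fin, of B] that
    by (simp add: M.emeasure_eq_measure P.emeasure_eq_measure prod_ennreal prod_nonneg)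
  have mE: "measure ?N ?E = measure P W ^ card I" using prodP[of "\<lambda>_. W"] by simp
  have pos: "measure ?N ?E > 0" using w by (simp add: mE)
  have "uniform_measure ?N ?E = PiM I (\<lambda>_. uniform_measure P W)"
  proof (rule QQ.PiM_eqI[OF fin])
    show "sets (uniform_measure ?N ?E) = sets (PiM I (\<lambda>_. uniform_measure P W))"
      by (simp cong: sets_PiM_cong)
    fix B assume B: "\<And>i. i \<in> I \<Longrightarrow> B i \<in> sets (uniform_measure P W)"
    then have B': "\<And>i. i \<in> I \<Longrightarrow> B i \<in> sets P" by simp
    have PB: "PiE I B \<in> sets ?N" using fin B' by (intro sets_PiM_I_finite) auto
    have "emeasure (uniform_measure ?N ?E) (PiE I B) = ennreal (measure ?N (?E \<inter> PiE I B) / measure ?N ?E)"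
      using pos E PB by (simp add: M.emeasure_eq_measure divide_ennreal)
    also have "?E \<inter> PiE I B = PiE I (\<lambda>i. W \<inter> B i)" by (auto simp: PiE_iff)
    also have "measure ?N (PiE I (\<lambda>i. W \<inter> B i)) / measure ?N ?E
        = (\<Prod>i\<in>I. measure P (W \<inter> B i) / measure P W)"
      using B' by (subst prodP) (auto simp: mE prod_dividef)
    also have "ennreal \<dots> = (\<Prod>i\<in>I. emeasure (uniform_measure P W) (B i))"
      using w B' by (subst prod_ennreal[symmetric])
        (auto intro!: prod.cong simp: P.emeasure_eq_measure divide_ennreal)
    finally show "emeasure (uniform_measure ?N ?E) (PiE I B)
        = (\<Prod>i\<in>I. emeasure (uniform_measure P W) (B i))" .
  qed
  then have "measure (PiM I (\<lambda>_. uniform_measure P W)) A = measure (uniform_measure ?N ?E) A" by simp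
  also have "\<dots> = measure ?N (?E \<inter> A) / measure ?N ?E"
    using pos A by (intro measure_uniform_measure) (auto simp: M.emeasure_eq_measure)
  finally show ?thesis using w by (simp add: mE Int_commute)
qed

section \<open>Independent blocks and stopped samples\<close>

lemma measure_PiM_Times:
  assumes P: "prob_space P" and TU: "T \<inter> U = {}" "finite T" "finite U"
    and A: "A \<in> sets (iid T P)" and D: "D \<in> sets (iid U P)"
  shows "measure (iid (T \<union> U) P)
           {x \<in> space (iid (T \<union> U) P). restrict x T \<in> A \<and> restrict x U \<in> D}
         = measure (iid T P) A * measure (iid U P) D"
proof -
  interpret P: prob_space P by fact
  interpret T: prob_space "iid T P" by (intro prob_space_PiM P)
  interpret PP: product_prob_space "\<lambda>_. P" T by unfold_locales
  interpret U: prob_space "iid U P" by (intro prob_space_PiM P)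
  interpret TU: pair_prob_space "iid T P" "iid U P" by unfold_locales
  let ?M = "iid (T \<union> U) P"
  let ?X = "{x \<in> space ?M. restrict x T \<in> A \<and> restrict x U \<in> D}"
  note [measurable] = A D
  have X: "?X \<in> sets ?M"
  proof -
    have [measurable]: "(\<lambda>x. restrict x T) \<in> ?M \<rightarrow>\<^sub>M iid T P" "(\<lambda>x. restrict x U) \<in> ?M \<rightarrow>\<^sub>M iid U P"
      by (rule measurable_restrict_subset; auto)+
    show ?thesis by measurable
  qed
  have "measure ?M ?X = measure (distr (iid T P \<Otimes>\<^sub>M iid U P) ?M (merge T U)) ?X"
    using PP.distr_merge[OF TU] by simp
  also have "\<dots> = measure (iid T P \<Otimes>\<^sub>M iid U P)
      (merge T U -` ?X \<inter> space (iid T P \<Otimes>\<^sub>M iid U P))"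
    using X by (intro measure_distr) auto
  also have "merge T U -` ?X \<inter> space (iid T P \<Otimes>\<^sub>M iid U P) = A \<times> D"
  proof -
    have "a \<in> space (iid T P)" if "a \<in> A" for a using sets.sets_into_space[OF A] that by auto
    moreover have "b \<in> space (iid U P)" if "b \<in> D" for b using sets.sets_into_space[OF D] that by auto
    moreover have "merge T U (a, b) \<in> space ?M" "restrict (merge T U (a, b)) T = a" "restrict (merge T U (a, b)) U = b"
      if "a \<in> space (iid T P)" "b \<in> space (iid U P)" for a b
      using that TU(1) by (auto simp: space_PiM PiE_iff extensional_restrict)
    ultimately show ?thesis by (auto simp: space_pair_measure)
  qed
  also have "measure (iid T P \<Otimes>\<^sub>M iid U P) (A \<times> D) = measure (iid T P) A * measure (iid U P) D"
    using A D by (simp add: measure_def U.emeasure_pair_measure_Times enn2real_mult)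
  finally show ?thesis .
qed

text \<open>For nonempty finite \<open>T \<subseteq> J\<close> this makes \<open>T\<close> the set
  of the first \<open>card T\<close> visits to \<open>W\<close>. Naming the index set instead of the
  stopping times separates the coordinates: one condition concerns only those in \<open>T\<close>,
  the other only those in \<open>J - T\<close>.\<close>

definition first_hits :: "real set \<Rightarrow> nat set \<Rightarrow> nat set \<Rightarrow> (nat \<Rightarrow> real) \<Rightarrow> bool" where
  "first_hits W J T x \<longleftrightarrow> (\<forall>t\<in>T. x t \<in> W) \<and> (\<forall>t\<in>J - T. t < Max T \<longrightarrow> x t \<notin> W)"

text \<open>The set with the smaller maximum lies in the other, which omits no visit below its own
  maximum; equal cardinalities then force equality. Hence the events for different \<open>T\<close>
  of the same size are disjoint.\<close>

lemma first_hits_unique: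
  assumes "first_hits W J T x" "first_hits W J T' x" "T \<subseteq> J" "T' \<subseteq> J" "finite J" "card T = card T'"
  shows "T = T'"
proof -
  have *: "T = T'" if h: "first_hits W J T x" "first_hits W J T' x" "T \<subseteq> J" "T' \<subseteq> J" "card T = card T'"
    "Max T \<le> Max T'" for T T'
  proof (rule card_subset_eq)
    have fin: "finite T" "finite T'" using h assms(5) finite_subset by auto
    show "finite T'" "card T = card T'" using fin h by auto
    show "T \<subseteq> T'"
    proof
      fix t assume t: "t \<in> T"
      then have ne: "T' \<noteq> {}" using h(5) fin by auto
      have "t \<le> Max T'" using Max_ge[OF fin(1) t] h(6) by linarith
      then have "t = Max T' \<or> t < Max T'" by auto
      then show "t \<in> T'"
        using h t Max_in[OF fin(2) ne] unfolding first_hits_def by auto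
    qed
  qed
  show ?thesis using *[of T T'] *[of T' T] assms by (metis nle_le)
qed

text \<open>This is how the first \<open>l\<close> hits act as a conditionally i.i.d. sample. For a
  fixed \<open>T\<close> the event splits into the independent blocks \<open>T\<close> and
  \<open>J - T\<close>, so a bound relative to the cube over \<open>T\<close> carries over to the
  event that \<open>T\<close> is the set of first hits. These events are disjoint, so their
  probabilities sum to at most 1.\<close>

lemma measure_first_hits_le:
  assumes P: "prob_space P" and W[measurable]: "W \<in> sets P" and J: "finite J"
    and C: "\<And>T. T \<subseteq> J \<Longrightarrow> card T = l \<Longrightarrow> C T \<in> sets (iid T P)"
    and bound: "\<And>T. T \<subseteq> J \<Longrightarrow> card T = l \<Longrightarrow>
       measure (iid T P) (C T \<inter> cube T W) \<le> \<beta> * measure (iid T P) (cube T W)"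
    and \<beta>: "0 \<le> \<beta>"
  shows "measure (iid J P)
     (\<Union>T\<in>{T. T \<subseteq> J \<and> card T = l}. {x \<in> space (iid J P). first_hits W J T x \<and> restrict x T \<in> C T}) \<le> \<beta>"
proof -
  interpret M: prob_space "iid J P" by (intro prob_space_PiM P)
  let ?N = "iid J P"
  define \<T> where "\<T> = {T. T \<subseteq> J \<and> card T = l}"
  define D where "D T = {y \<in> space (iid (J - T) P). \<forall>t\<in>J - T. t < Max T \<longrightarrow> y t \<notin> W}" for T
  define F where "F B T = {x \<in> space ?N. first_hits W J T x \<and> restrict x T \<in> B}" for B T
  have fin\<T>: "finite \<T>" using J by (simp add: \<T>_def)
  have fT: "finite T" if "T \<in> \<T>" for T using that J finite_subset by (auto simp: \<T>_def)
  have Dm: "D T \<in> sets (iid (J - T) P)" for T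
    unfolding D_def using J by measurable
  have F_eq: "F B T = {x \<in> space (PiM (T \<union> (J - T)) (\<lambda>_. P)).
      restrict x T \<in> B \<inter> cube T W \<and> restrict x (J - T) \<in> D T}" if T: "T \<in> \<T>" for B T
  proof -
    have "T \<union> (J - T) = J" using T by (auto simp: \<T>_def)
    then show ?thesis
      by (auto simp: F_def D_def first_hits_def space_PiM PiE_iff)
  qed
  have WT: "cube T W \<in> sets (iid T P)" if "T \<in> \<T>" for T
    using fT[OF that] by (intro sets_PiM_I_finite) auto
  have F_measure: "measure ?N (F B T) =
      measure (iid T P) (B \<inter> cube T W) * measure (iid (J - T) P) (D T)"
    and F_sets: "F B T \<in> sets ?N"
    if T: "T \<in> \<T>" and B: "B \<in> sets (iid T P)" for B T
  proof -
    have e: "T \<union> (J - T) = J" "T \<union> J = J" using T by (auto simp: \<T>_def)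
    have BW: "B \<inter> cube T W \<in> sets (iid T P)" using B WT[OF T] by auto
    show "measure ?N (F B T) =
      measure (iid T P) (B \<inter> cube T W) * measure (iid (J - T) P) (D T)"
      unfolding F_eq[OF T]
      using measure_PiM_Times[OF P _ fT[OF T] _ BW Dm[of T]] J by (simp add: e)
    note [measurable] = BW Dm[of T]
    have [measurable]: "(\<lambda>x. restrict x T) \<in> ?N \<rightarrow>\<^sub>M iid T P"
      "(\<lambda>x. restrict x (J - T)) \<in> ?N \<rightarrow>\<^sub>M iid (J - T) P"
      using T by (auto intro!: measurable_restrict_subset simp: \<T>_def)
    show "F B T \<in> sets ?N" unfolding F_eq[OF T] e(1) by measurable
  qed
  have sp: "F (space (iid T P)) T = {x \<in> space ?N. first_hits W J T x}" if "T \<in> \<T>" for T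
    using that by (auto simp: F_def space_PiM PiE_iff \<T>_def)
  have "measure ?N (\<Union>T\<in>\<T>. F (C T) T) \<le> (\<Sum>T\<in>\<T>. measure ?N (F (C T) T))"
    using fin\<T> F_sets C by (intro M.finite_measure_subadditive_finite) (auto simp: \<T>_def)
  also have "\<dots> \<le> (\<Sum>T\<in>\<T>. \<beta> * measure ?N (F (space (iid T P)) T))"
  proof (intro sum_mono)
    fix T assume T: "T \<in> \<T>"
    have "measure ?N (F (C T) T) \<le> (\<beta> * measure (iid T P) (cube T W)) * measure (iid (J - T) P) (D T)"
      using T C bound by (subst F_measure) (auto simp: \<T>_def intro!: mult_right_mono)
    also have "cube T W = space (iid T P) \<inter> cube T W"
      using sets.sets_into_space[OF WT[OF T]] by auto
    finally show "measure ?N (F (C T) T) \<le> \<beta> * measure ?N (F (space (iid T P)) T)"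
      using T by (subst F_measure) auto
  qed
  also have "\<dots> = \<beta> * (\<Sum>T\<in>\<T>. measure ?N (F (space (iid T P)) T))" by (simp add: sum_distrib_left)
  also have "(\<Sum>T\<in>\<T>. measure ?N (F (space (iid T P)) T)) = measure ?N (\<Union>T\<in>\<T>. F (space (iid T P)) T)"
  proof (rule M.finite_measure_finite_Union[symmetric, OF fin\<T>])
    show "(\<lambda>T. F (space (iid T P)) T) ` \<T> \<subseteq> sets ?N" using F_sets by auto
    show "disjoint_family_on (\<lambda>T. F (space (iid T P)) T) \<T>"
      unfolding disjoint_family_on_def using first_hits_unique[of W J] J
      by (auto simp: sp) (auto simp: \<T>_def)
  qed
  also have "\<beta> * \<dots> \<le> \<beta> * 1" using \<beta> by (intro mult_left_mono) auto
  finally show ?thesis by (simp add: F_def \<T>_def)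
qed

text \<open>Fubini over the centre: coordinate \<open>i\<close> is independent of the block
  \<open>J\<close>, so a bound for fixed \<open>y\<close> integrates to the same bound. A null set
  of centres is exempt because the uniform law lives on the open interval only.\<close>

lemma measure_PiM_centre_le:
  assumes P: "prob_space P" and K: "finite K" "i \<in> K" "J \<subseteq> K" "i \<notin> J"
    and \<Phi>[measurable]: "\<Phi> \<in> sets (P \<Otimes>\<^sub>M iid J P)"
    and bound: "AE y in P. measure (iid J P) {x \<in> space (iid J P). (y, x) \<in> \<Phi>} \<le> \<beta>"
    and \<beta>: "0 \<le> \<beta>"
  shows "measure (iid K P) {x \<in> space (iid K P). (x i, restrict x J) \<in> \<Phi>} \<le> \<beta>"
proof -
  interpret P: prob_space P by fact
  interpret J: prob_space "iid J P" by (intro prob_space_PiM P)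
  interpret KK: prob_space "iid K P" by (intro prob_space_PiM P)
  interpret PP: product_prob_space "\<lambda>_. P" K by unfold_locales
  interpret PJ: pair_prob_space P "iid J P" by unfold_locales
  let ?L = "iid (insert i J) P"
  let ?X = "{x \<in> space ?L. (x i, restrict x J) \<in> \<Phi>}"
  have [measurable]: "(\<lambda>x. restrict x J) \<in> ?L \<rightarrow>\<^sub>M iid J P"
    by (rule measurable_restrict_subset) auto
  have X: "?X \<in> sets ?L" by measurable
  have iJ: "insert i J \<subseteq> K" using K by auto
  have r: "(\<lambda>x. restrict x (insert i J)) \<in> iid K P \<rightarrow>\<^sub>M ?L"
    using iJ by (rule measurable_restrict_subset)
  have u: "(\<lambda>(x, X). X(i := x)) \<in> P \<Otimes>\<^sub>M iid J P \<rightarrow>\<^sub>M ?L"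
    by measurable
  have "{x \<in> space (iid K P). (x i, restrict x J) \<in> \<Phi>}
      = (\<lambda>x. restrict x (insert i J)) -` ?X \<inter> space (iid K P)"
    using measurable_space[OF r] by (auto simp: Int_absorb1 subset_insertI)
  also have "emeasure (iid K P) \<dots> = emeasure ?L ?X"
    using emeasure_distr[OF r X] PP.distr_restrict[OF iJ K(1)] by simp
  also have "\<dots> = emeasure (distr (P \<Otimes>\<^sub>M iid J P) ?L (\<lambda>(x, X). X(i := x))) ?X"
    using distr_pair_PiM_eq_PiM[of J "\<lambda>_. P" i] P by simp
  also have "\<dots> = emeasure (P \<Otimes>\<^sub>M iid J P) ((\<lambda>(x, X). X(i := x)) -` ?X \<inter> space (P \<Otimes>\<^sub>M iid J P))"
    by (rule emeasure_distr[OF u X])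
  also have "(\<lambda>(x, X). X(i := x)) -` ?X \<inter> space (P \<Otimes>\<^sub>M iid J P) = \<Phi>"
  proof -
    have "restrict (X(i := y)) J = X" if "X \<in> space (iid J P)" for X y
      using that K(4) by (auto simp: space_PiM PiE_iff extensional_def restrict_def fun_eq_iff)
    moreover have "X(i := y) \<in> space ?L" if "X \<in> space (iid J P)" "y \<in> space P" for X y
      using that by (auto simp: space_PiM PiE_iff extensional_def split: if_splits)
    ultimately show ?thesis
      using sets.sets_into_space[OF \<Phi>] by (auto simp: space_pair_measure subset_eq)
  qed
  also have "emeasure (P \<Otimes>\<^sub>M iid J P) \<Phi> = (\<integral>\<^sup>+y. emeasure (iid J P) (Pair y -` \<Phi>) \<partial>P)"
    by (rule J.emeasure_pair_measure_alt) measurable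
  also have "\<dots> \<le> (\<integral>\<^sup>+y. ennreal \<beta> \<partial>P)"
  proof (rule nn_integral_mono_AE, use bound in eventually_elim)
    fix y
    have "Pair y -` \<Phi> = {x \<in> space (iid J P). (y, x) \<in> \<Phi>}"
      using sets.sets_into_space[OF \<Phi>] by (auto simp: space_pair_measure)
    moreover assume "measure (iid J P) {x \<in> space (iid J P). (y, x) \<in> \<Phi>} \<le> \<beta>"
    ultimately show "emeasure (iid J P) (Pair y -` \<Phi>) \<le> ennreal \<beta>"
      by (simp add: J.emeasure_eq_measure ennreal_leI)
  qed
  also have "\<dots> = ennreal \<beta>" by (simp add: P.emeasure_space_1)
  finally show ?thesis using \<beta> by (simp add: KK.emeasure_eq_measure restrict_def)
qed

text \<open>Chernoff's bound with base 2: the indicator of fewer than \<open>l\<close> hits is at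
  most \<open>2 ^ l\<close> times a product of factors \<open>1/2\<close>, one for each hit, whose
  mean factorizes. The exponent becomes \<open>(ln 2 - 1) * (n * \<delta> / 2)\<close>, and
  \<open>ln 2 \<le> 25/36\<close> gives the constant 8 that reappears in the sample size.\<close>

lemma few_hits_bound:
  assumes P: "prob_space P" and W[measurable]: "W \<in> sets P" and w: "\<delta> \<le> measure P W" "0 \<le> \<delta>" and J: "finite J"
    and l: "real l \<le> real (card J) * \<delta> / 2"
  shows "measure (iid J P) {x \<in> space (iid J P). card {t \<in> J. x t \<in> W} < l}
          \<le> exp (- (real (card J) * \<delta> / 8))"
proof -
  interpret P: prob_space P by fact
  interpret M: prob_space "iid J P" by (intro prob_space_PiM P)
  interpret PP: product_prob_space "\<lambda>_. P" J by unfold_locales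
  define n where "n = real (card J)"
  let ?N = "iid J P" and ?w = "measure P W"
  let ?f = "\<lambda>t. 1 - indicator W t / 2 :: real"
  let ?X = "{x \<in> space ?N. card {t \<in> J. x t \<in> W} < l}"
  have Xm: "?X \<in> sets ?N"
  proof -
    have "card {t \<in> J. x t \<in> W} = (\<Sum>t\<in>J. if x t \<in> W then 1 else 0)" for x
      using J by (simp add: sum.If_cases Int_def)
    then show ?thesis using J by simp
  qed
  have Z: "(\<Prod>t\<in>J. ?f (x t)) = (1/2) ^ card {t \<in> J. x t \<in> W}" for x
  proof -
    have "(\<Prod>t\<in>J. ?f (x t)) = (\<Prod>t\<in>J. if x t \<in> W then 1/2 else 1)"
      by (intro prod.cong) (auto simp: indicator_def)
    then show ?thesis using J by (simp add: prod.If_cases Int_def)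
  qed
  have int: "integrable ?N (\<lambda>x. 2 ^ l * (\<Prod>t\<in>J. ?f (x t)))"
  proof (rule M.integrable_const_bound[where B="2 ^ l"])
    show "AE x in ?N. norm (2 ^ l * (\<Prod>t\<in>J. ?f (x t))) \<le> 2 ^ l" by (auto simp: Z power_le_one)
  qed measurable
  have "measure ?N ?X = (\<integral>x. indicator ?X x \<partial>?N)" using Xm by simp
  also have "\<dots> \<le> (\<integral>x. 2 ^ l * (\<Prod>t\<in>J. ?f (x t)) \<partial>?N)"
  proof (rule integral_mono[OF _ int])
    show "integrable ?N (indicator ?X :: _ \<Rightarrow> real)" using Xm by (simp add: M.emeasure_eq_measure)
    show "indicator ?X x \<le> 2 ^ l * (\<Prod>t\<in>J. ?f (x t))" for x
      unfolding Z by (auto simp: indicator_def power_one_over field_simps intro!: power_increasing)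
  qed
  also have "\<dots> = 2 ^ l * (1 - ?w / 2) ^ card J"
  proof -
    have "(\<integral>y. ?f y \<partial>P) = 1 - ?w / 2"
      by (subst Bochner_Integration.integral_diff) (auto simp: P.prob_space P.emeasure_eq_measure)
    then show ?thesis
      using PP.product_integral_prod[OF J, of "\<lambda>_. ?f"] by (simp add: P.emeasure_eq_measure)
  qed
  also have "\<dots> \<le> exp (ln 2 * (n * \<delta> / 2)) * exp (- \<delta> / 2) ^ card J"
  proof (intro mult_mono power_mono)
    have "(2::real) ^ l = exp (ln 2 * real l)" by (simp add: exp_of_nat2_mult)
    also have "\<dots> \<le> exp (ln 2 * (n * \<delta> / 2))" using l by (simp add: n_def)
    finally show "(2::real) ^ l \<le> exp (ln 2 * (n * \<delta> / 2))" .
    have "1 - ?w / 2 \<le> 1 + (- \<delta> / 2)" using w by simp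
    also have "\<dots> \<le> exp (- \<delta> / 2)" by (rule exp_ge_add_one_self)
    finally show "1 - ?w / 2 \<le> exp (- \<delta> / 2)" .
    show "0 \<le> 1 - ?w / 2" using P.prob_le_1[of W] by linarith
    then show "0 \<le> (1 - ?w / 2) ^ card J" by (rule zero_le_power)
  qed auto
  also have "\<dots> = exp ((ln 2 - 1) * (n * \<delta> / 2))"
    by (simp add: n_def exp_of_nat_mult[symmetric] exp_add[symmetric] algebra_simps)
  also have "\<dots> \<le> exp ((- 1/4) * (n * \<delta> / 2))"
  proof -
    have "(ln 2 - 1) * (n * \<delta> / 2) \<le> (- 1/4) * (n * \<delta> / 2)"
      using w ln2_le_25_over_36 by (intro mult_right_mono) (auto simp: n_def)
    then show ?thesis by simp
  qed
  finally show ?thesis by (simp add: n_def)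
qed

section \<open>Symmetrization\<close>

text \<open>Indices rather than points are traced, since the sample may repeat values. A shattered
  index set cannot contain two indices of one point, so it maps injectively onto a shattered set of
  points.\<close>

lemma card_trace_le:
  fixes G :: "'a set set" and z :: "'i \<Rightarrow> 'a"
  assumes N: "finite N" and vc: "\<And>A. finite A \<Longrightarrow> shatters G A \<Longrightarrow> card A \<le> d" and x: "0 < x" "x \<le> 1"
  shows "real (card ((\<lambda>g. {j \<in> N. z j \<in> g}) ` G)) \<le> exp (x * real (card N) + real d * ln (1 / x))"
proof (rule sauer_shelah_exp[OF N _ _ x])
  let ?C = "(\<lambda>g. {j \<in> N. z j \<in> g}) ` G"
  show "?C \<subseteq> Pow N" by auto
  fix J assume J: "J \<subseteq> N" "shatters ?C J"
  have tr: "\<exists>g\<in>G. \<forall>j\<in>J. z j \<in> g \<longleftrightarrow> j \<in> B" if "B \<subseteq> J" for B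
  proof -
    obtain S where S: "S \<in> ?C" "S \<inter> J = B" using J(2) \<open>B \<subseteq> J\<close> unfolding shatters_def by metis
    obtain g where g: "g \<in> G" "S = {j \<in> N. z j \<in> g}" using S(1) by (elim imageE)
    have "z j \<in> g \<longleftrightarrow> j \<in> B" if "j \<in> J" for j
      using that subsetD[OF J(1) that] unfolding S(2)[symmetric] g(2) by simp
    then show ?thesis using g(1) by (intro bexI[of _ g] ballI)
  qed
  have inj: "inj_on z J"
  proof (rule inj_onI, rule ccontr)
    fix i j assume ij: "i \<in> J" "j \<in> J" "z i = z j" "i \<noteq> j"
    then have "{i} \<subseteq> J" by simp
    from tr[OF this] obtain g where g: "\<forall>k\<in>J. z k \<in> g \<longleftrightarrow> k \<in> {i}" by (elim bexE)
    have "z i \<in> g" "z j \<notin> g" using bspec[OF g ij(1)] bspec[OF g ij(2)] ij(4) by simp_all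
    then show False using ij(3) by simp
  qed
  have "shatters G (z ` J)" unfolding shatters_def
  proof (intro allI impI)
    fix B assume B: "B \<subseteq> z ` J"
    have "{j \<in> J. z j \<in> B} \<subseteq> J" by simp
    from tr[OF this] obtain g where g: "g \<in> G" "\<forall>j\<in>J. z j \<in> g \<longleftrightarrow> j \<in> {j \<in> J. z j \<in> B}" by (elim bexE)
    have "g \<inter> z ` J = B"
    proof (intro set_eqI iffI)
      fix a assume "a \<in> g \<inter> z ` J"
      then obtain j where "j \<in> J" "a = z j" "z j \<in> g" by auto
      then show "a \<in> B" using g(2) by simp
    next
      fix a assume a: "a \<in> B"
      then obtain j where "j \<in> J" "a = z j" using B by auto
      then show "a \<in> g \<inter> z ` J" using g(2) a by simp
    qed
    then show "\<exists>S\<in>G. S \<inter> z ` J = B" using g(1) by (rule bexI)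
  qed
  then have "card (z ` J) \<le> d"
    using finite_subset[OF J(1) N] by (intro vc finite_imageI)
  then show "card J \<le> d" using inj by (simp add: card_image)
qed

definition disc :: "nat \<Rightarrow> real set \<Rightarrow> (nat \<Rightarrow> real) \<Rightarrow> real" where
  "disc l g z = (\<Sum>j<l. of_bool (z j \<in> g) - of_bool (z (j + l) \<in> g))"

text \<open>Transposes \<open>j\<close> and \<open>j + l\<close> for every \<open>j \<in> B\<close>.
  On the i.i.d. double sample this is a symmetry; on \<open>disc\<close> it flips the sign of
  exactly the summands in \<open>B\<close>.\<close>

definition swap_index :: "nat \<Rightarrow> nat set \<Rightarrow> nat \<Rightarrow> nat" where
  "swap_index l B j = (if j < l \<and> j \<in> B then j + l else if l \<le> j \<and> j - l \<in> B then j - l else j)"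

definition swap_halves :: "nat \<Rightarrow> nat set \<Rightarrow> (nat \<Rightarrow> real) \<Rightarrow> nat \<Rightarrow> real" where
  "swap_halves l B z = (\<lambda>j\<in>{..<2 * l}. z (swap_index l B j))"

lemma swap_index_bound: "B \<subseteq> {..<l} \<Longrightarrow> swap_index l B j < 2 * l \<longleftrightarrow> j < 2 * l"
  by (auto simp: swap_index_def)

lemma swap_index_involution: "B \<subseteq> {..<l} \<Longrightarrow> swap_index l B (swap_index l B j) = j"
  by (auto simp: swap_index_def)

lemma disc_swap_halves:
  assumes "B \<subseteq> {..<l}"
  shows "disc l g (swap_halves l B z) = (\<Sum>j<l. if j \<in> B then - (of_bool (z j \<in> g) - of_bool (z (j + l) \<in> g))
           else of_bool (z j \<in> g) - of_bool (z (j + l) \<in> g))"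
  unfolding disc_def
proof (rule sum.cong[OF refl])
  fix j assume "j \<in> {..<l}"
  then show "of_bool (swap_halves l B z j \<in> g) - of_bool (swap_halves l B z (j + l) \<in> g) =
     (if j \<in> B then - (of_bool (z j \<in> g) - of_bool (z (j + l) \<in> g))
      else of_bool (z j \<in> g) - of_bool (z (j + l) \<in> g) :: real)"
    by (auto simp: swap_halves_def swap_index_def)
qed

text \<open>Tail of a signed sum of \<open>l\<close> terms times the growth bound for
  \<open>2 * l\<close> points; \<open>x\<close> remains free until the constants are fixed.\<close>

definition sym_bound :: "nat \<Rightarrow> nat \<Rightarrow> real \<Rightarrow> real \<Rightarrow> real" where
  "sym_bound d l u x = 2 * exp (- u\<^sup>2 / (2 * real l)) * exp (x * real (2 * l) + real d * ln (1 / x))"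

text \<open>With the points held fixed, a set in \<open>G\<close> matters only through its trace on
  the \<open>2 * l\<close> indices, so a union bound over finitely many traces replaces the supremum
  over \<open>G\<close>.\<close>

lemma card_bad_swaps_le:
  assumes vc: "\<And>A. finite A \<Longrightarrow> shatters G A \<Longrightarrow> card A \<le> d" and x: "0 < x" "x \<le> 1" and u: "u > 0"
  shows "real (card {B \<in> Pow {..<l}. \<exists>g\<in>G. \<bar>disc l g (swap_halves l B z)\<bar> > u}) \<le> 2 ^ l * sym_bound d l u x"
proof -
  define a where "a S j = (of_bool (j \<in> S) - of_bool (j + l \<in> S) :: real)" for S :: "nat set" and j
  let ?T = "(\<lambda>g. {j \<in> {..<2 * l}. z j \<in> g}) ` G"
  let ?E = "\<lambda>S. {B \<in> Pow {..<l}. \<bar>\<Sum>j<l. if j \<in> B then - a S j else a S j\<bar> > u}"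
  have finT: "finite ?T" by (rule finite_subset[of _ "Pow {..<2 * l}"]) auto
  have "{B \<in> Pow {..<l}. \<exists>g\<in>G. \<bar>disc l g (swap_halves l B z)\<bar> > u} \<subseteq> (\<Union>S\<in>?T. ?E S)"
  proof (intro subsetI)
    fix B assume "B \<in> {B \<in> Pow {..<l}. \<exists>g\<in>G. \<bar>disc l g (swap_halves l B z)\<bar> > u}"
    then obtain g where B: "B \<subseteq> {..<l}" and g: "g \<in> G" "\<bar>disc l g (swap_halves l B z)\<bar> > u" by auto
    let ?S = "{j \<in> {..<2 * l}. z j \<in> g}"
    have "disc l g (swap_halves l B z) = (\<Sum>j<l. if j \<in> B then - a ?S j else a ?S j)"
      unfolding disc_swap_halves[OF B] by (intro sum.cong) (auto simp: a_def)
    then have "B \<in> ?E ?S" using B g by simp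
    then show "B \<in> (\<Union>S\<in>?T. ?E S)" using g by blast
  qed
  then have "card {B \<in> Pow {..<l}. \<exists>g\<in>G. \<bar>disc l g (swap_halves l B z)\<bar> > u} \<le> card (\<Union>S\<in>?T. ?E S)"
    using finT by (intro card_mono finite_UN_I[OF finT]) simp_all
  also have "\<dots> \<le> (\<Sum>S\<in>?T. card (?E S))" by (rule card_UN_le[OF finT])
  finally have "real (card {B \<in> Pow {..<l}. \<exists>g\<in>G. \<bar>disc l g (swap_halves l B z)\<bar> > u}) \<le> (\<Sum>S\<in>?T. real (card (?E S)))"
    by (simp only: of_nat_sum[symmetric] of_nat_le_iff)
  also have "\<dots> \<le> (\<Sum>S\<in>?T. 2 * 2 ^ l * exp (- u\<^sup>2 / (2 * real l)))"
  proof (rule sum_mono)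
    fix S
    show "real (card (?E S)) \<le> 2 * 2 ^ l * exp (- u\<^sup>2 / (2 * real l))"
      using signed_sum_abs_tail[of "{..<l}" "a S" u] u by (simp add: a_def)
  qed
  also have "\<dots> = real (card ?T) * (2 * 2 ^ l * exp (- u\<^sup>2 / (2 * real l)))" by simp
  also have "\<dots> \<le> exp (x * real (2 * l) + real d * ln (1 / x)) * (2 * 2 ^ l * exp (- u\<^sup>2 / (2 * real l)))"
  proof (rule mult_right_mono)
    show "real (card ?T) \<le> exp (x * real (2 * l) + real d * ln (1 / x))"
      using card_trace_le[of "{..<2*l}" G d x z, OF _ vc x] by simp
  qed simp
  finally show ?thesis by (simp add: sym_bound_def mult_ac)
qed

text \<open>Every swap preserves both the product measure and the cube over \<open>W\<close>, so the
  measure can be averaged over all \<open>2 ^ l\<close> swaps before integrating; at a fixed point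
  the average is controlled by \<open>card_bad_swaps_le\<close>. The null set \<open>N\<close> makes
  room for a measurable superset of an event that is measurable only in the completion.\<close>

lemma measure_ghost_le:
  assumes P: "prob_space P" and W: "W \<in> sets P"
    and vc: "\<And>A. finite A \<Longrightarrow> shatters G A \<Longrightarrow> card A \<le> d" and x: "0 < x" "x \<le> 1" and u: "u > 0"
    and A[measurable]: "A \<in> sets (iid {..<2 * l} P)"
    and N: "N \<in> null_sets (iid {..<2 * l} P)"
    and AN: "\<And>z. z \<in> A \<Longrightarrow> z \<in> N \<or> (\<exists>g\<in>G. \<bar>disc l g z\<bar> > u)"
  shows "measure (iid {..<2 * l} P) (A \<inter> cube {..<2 * l} W) \<le> sym_bound d l u x * measure P W ^ (2 * l)"
proof -
  interpret P: prob_space P by fact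
  interpret M: prob_space "iid {..<2 * l} P" by (intro prob_space_PiM P)
  interpret PP: product_prob_space "\<lambda>_. P" "{..<2 * l}" by unfold_locales
  let ?M = "iid {..<2 * l} P" and ?E = "cube {..<2 * l} W" and ?\<B> = "Pow {..<l}"
  have E[measurable]: "?E \<in> sets ?M" using W by (intro sets_PiM_I_finite) auto
  have N'[measurable]: "N \<in> sets ?M" using N by auto
  have sw: "swap_halves l B \<in> ?M \<rightarrow>\<^sub>M ?M" and inv: "distr ?M ?M (swap_halves l B) = ?M" if "B \<in> ?\<B>" for B
  proof -
    have B: "B \<subseteq> {..<l}" using that by auto
    have m: "swap_index l B \<in> {..<2 * l} \<rightarrow> {..<2 * l}" using swap_index_bound[OF B] by auto
    have "inj_on (swap_index l B) {..<2 * l}" using swap_index_involution[OF B] by (metis inj_onI)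
    from distr_PiM_reindex[of "{..<2 * l}" "\<lambda>_. P", OF _ this m] P
    show "distr ?M ?M (swap_halves l B) = ?M" by (simp add: swap_halves_def[abs_def])
    show "swap_halves l B \<in> ?M \<rightarrow>\<^sub>M ?M" unfolding swap_halves_def[abs_def] using m
      by (intro measurable_restrict measurable_component_singleton) auto
  qed
  have Einv: "swap_halves l B z \<in> ?E \<longleftrightarrow> z \<in> ?E" if B: "B \<in> ?\<B>" and z: "z \<in> space ?M" for B z
  proof -
    have b: "B \<subseteq> {..<l}" using B by auto
    have "(\<forall>j<2*l. z (swap_index l B j) \<in> W) \<longleftrightarrow> (\<forall>j<2*l. z j \<in> W)"
      using swap_index_bound[OF b] swap_index_involution[OF b] by metis
    then show ?thesis using z by (auto simp: swap_halves_def PiE_iff space_PiM)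
  qed
  have pre: "measure ?M X = measure ?M (swap_halves l B -` X \<inter> space ?M)" if "B \<in> ?\<B>" "X \<in> sets ?M" for B X
    using measure_distr[OF sw[OF that(1)] that(2)] inv[OF that(1)] by simp
  \<comment> \<open>There are finitely many swaps and each preserves the measure, so almost every
    point has all its swapped versions outside \<open>N\<close>.\<close>
  have "AE z in ?M. \<forall>B\<in>?\<B>. swap_halves l B z \<notin> N"
  proof (rule AE_finite_allI)
    fix B assume B: "B \<in> ?\<B>"
    have "emeasure (distr ?M ?M (swap_halves l B)) N = 0" using N by (simp add: inv[OF B] null_setsD1)
    then have "emeasure ?M (swap_halves l B -` N \<inter> space ?M) = 0"
      using emeasure_distr[OF sw[OF B] N'] by simp
    then have "swap_halves l B -` N \<inter> space ?M \<in> null_sets ?M"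
      using measurable_sets[OF sw[OF B] N'] by auto
    then show "AE z in ?M. swap_halves l B z \<notin> N"
      by (rule AE_I') auto
  qed simp
  then have ae: "AE z in ?M. (\<Sum>B\<in>?\<B>. indicator (swap_halves l B -` (A \<inter> ?E) \<inter> space ?M) z)
      \<le> 2 ^ l * sym_bound d l u x * indicator ?E z"
  proof (rule AE_mp, intro AE_I2 impI)
    fix z assume z: "z \<in> space ?M" and zN: "\<forall>B\<in>?\<B>. swap_halves l B z \<notin> N"
    have "(\<Sum>B\<in>?\<B>. indicator (swap_halves l B -` (A \<inter> ?E) \<inter> space ?M) z)
        \<le> (\<Sum>B\<in>?\<B>. indicator ?E z * (if \<exists>g\<in>G. \<bar>disc l g (swap_halves l B z)\<bar> > u then 1 else 0 :: real))"
    proof (rule sum_mono)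
      fix B assume B: "B \<in> ?\<B>"
      show "indicator (swap_halves l B -` (A \<inter> ?E) \<inter> space ?M) z
         \<le> indicator ?E z * (if \<exists>g\<in>G. \<bar>disc l g (swap_halves l B z)\<bar> > u then 1 else 0 :: real)"
        using Einv[OF B z] AN[of "swap_halves l B z"] zN B by (auto simp: indicator_def)
    qed
    also have "\<dots> = indicator ?E z * real (card {B \<in> ?\<B>. \<exists>g\<in>G. \<bar>disc l g (swap_halves l B z)\<bar> > u})"
      by (simp add: sum_distrib_left[symmetric] sum.If_cases Int_def)
    also have "\<dots> \<le> indicator ?E z * (2 ^ l * sym_bound d l u x)"
      using card_bad_swaps_le[of G d x u l z, OF vc x u] by (intro mult_left_mono) auto
    finally show "(\<Sum>B\<in>?\<B>. indicator (swap_halves l B -` (A \<inter> ?E) \<inter> space ?M) z)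
        \<le> 2 ^ l * sym_bound d l u x * indicator ?E z" by (simp add: mult_ac)
  qed
  have AE': "A \<inter> ?E \<in> sets ?M" by simp
  have "2 ^ l * measure ?M (A \<inter> ?E) = (\<Sum>B\<in>?\<B>. measure ?M (swap_halves l B -` (A \<inter> ?E) \<inter> space ?M))"
  proof -
    have "(\<Sum>B\<in>?\<B>. measure ?M (swap_halves l B -` (A \<inter> ?E) \<inter> space ?M)) = (\<Sum>B\<in>?\<B>. measure ?M (A \<inter> ?E))"
      using pre[OF _ AE', symmetric] by (rule sum.cong[OF refl])
    then show ?thesis by (simp add: card_Pow)
  qed
  also have "\<dots> = (\<Sum>B\<in>?\<B>. (\<integral>z. indicator (swap_halves l B -` (A \<inter> ?E) \<inter> space ?M) z \<partial>?M))"
    using measurable_sets[OF sw AE'] by (intro sum.cong) auto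
  also have "\<dots> = (\<integral>z. (\<Sum>B\<in>?\<B>. indicator (swap_halves l B -` (A \<inter> ?E) \<inter> space ?M) z) \<partial>?M)"
    using measurable_sets[OF sw AE']
    by (intro Bochner_Integration.integral_sum[symmetric] integrable_real_indicator) (simp_all add: M.emeasure_eq_measure)
  also have "\<dots> \<le> (\<integral>z. 2 ^ l * sym_bound d l u x * indicator ?E z \<partial>?M)"
  proof (rule integral_mono_AE[OF _ _ ae])
    show "integrable ?M (\<lambda>z. \<Sum>B\<in>?\<B>. indicator (swap_halves l B -` (A \<inter> ?E) \<inter> space ?M) z :: real)"
      using measurable_sets[OF sw AE']
      by (intro Bochner_Integration.integrable_sum integrable_real_indicator) (simp_all add: M.emeasure_eq_measure)
    show "integrable ?M (\<lambda>z. 2 ^ l * sym_bound d l u x * indicator ?E z)"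
      by (intro integrable_mult_right integrable_real_indicator E) (simp add: M.emeasure_eq_measure)
  qed
  also have "\<dots> = 2 ^ l * sym_bound d l u x * measure ?M ?E" by simp
  also have "measure ?M ?E = measure P W ^ (2 * l)"
  proof -
    have "emeasure ?M ?E = (\<Prod>i<2*l. emeasure P W)" using W by (subst PP.emeasure_PiM) auto
    then show ?thesis by (simp add: M.emeasure_eq_measure P.emeasure_eq_measure ennreal_power)
  qed
  finally show ?thesis by simp
qed

section \<open>Uniform convergence on windows\<close>

definition emp_freq :: "nat set \<Rightarrow> real set \<Rightarrow> (nat \<Rightarrow> real) \<Rightarrow> real" where
  "emp_freq T g x = real (card {t \<in> T. x t \<in> g}) / real (card T)"

lemma disc_eq_emp_freq:
  assumes "l > 0"
  shows "disc l g z = real l * (emp_freq {..<l} g z - emp_freq {l..<2 * l} g z)"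
proof -
  have "(\<Sum>j<l. of_bool (z (j + l) \<in> g)) = (\<Sum>j\<in>{l..<2*l}. of_bool (z j \<in> g) :: real)"
    by (rule sum.reindex_bij_witness[where i="\<lambda>j. j - l" and j="\<lambda>j. j + l"]) auto
  then show ?thesis
    using assms by (simp add: disc_def sum_subtractf emp_freq_def right_diff_distrib of_bool_def sum.If_cases Int_def)
qed

lemma ghost_sample_likely:
  assumes P: "prob_space P" and W[measurable]: "W \<in> sets P" and w: "measure P W > 0"
    and g[measurable]: "g \<in> sets P" and L: "finite L" "L \<noteq> {}" and \<eta>: "\<eta> > 0" "8 \<le> real (card L) * \<eta>\<^sup>2"
  shows "measure (iid L P) {x \<in> cube L W. \<bar>emp_freq L g x - measure P (W \<inter> g) / measure P W\<bar> < \<eta> / 2}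
      \<ge> measure P W ^ card L / 2"
    and "{x \<in> cube L W. \<bar>emp_freq L g x - measure P (W \<inter> g) / measure P W\<bar> < \<eta> / 2} \<in> sets (iid L P)"
proof -
  interpret P: prob_space P by fact
  let ?Q = "uniform_measure P W" and ?p = "measure P (W \<inter> g) / measure P W"
  have Q: "prob_space ?Q"
    using w by (intro prob_space_uniform_measure) (auto simp: P.emeasure_eq_measure)
  interpret Q: prob_space ?Q by fact
  interpret QL: prob_space "iid L ?Q" by (intro prob_space_PiM Q)
  have sets_eq: "sets (iid L ?Q) = sets (iid L P)" by (intro sets_PiM_cong) auto
  have space_eq: "space (iid L ?Q) = space (iid L P)" using sets_eq by (rule sets_eq_imp_space_eq)
  define n where "n = real (card L)"
  have n: "n > 0" using L by (simp add: n_def card_gt_0_iff)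
  have freq: "(\<Sum>i\<in>L. indicator g (x i)) = n * emp_freq L g x" for x
    using n L(1) by (simp add: emp_freq_def n_def indicator_def sum.If_cases Int_def)
  have p: "(\<integral>x. indicator g x \<partial>?Q) = ?p"
    using w by (simp add: P.emeasure_eq_measure)
  let ?B = "{x \<in> space (iid L P). \<bar>emp_freq L g x - ?p\<bar> \<ge> \<eta> / 2}"
  have *: "n * (\<eta> / 2) \<le> \<bar>n * a - n * b\<bar> \<longleftrightarrow> \<eta> / 2 \<le> \<bar>a - b\<bar>" for a b
    using n by (simp add: right_diff_distrib[symmetric] abs_mult)
  have "measure (iid L ?Q) {x \<in> space (iid L ?Q).
      \<bar>(\<Sum>i\<in>L. indicator g (x i)) - real (card L) * (\<integral>x. indicator g x \<partial>?Q)\<bar> \<ge> n * (\<eta> / 2)}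
     \<le> real (card L) * 1 / (n * (\<eta> / 2))\<^sup>2"
    using n \<eta> by (intro PiM_deviation_bound[OF Q L(1)]) (auto simp: Q.emeasure_eq_measure)
  \<comment> \<open>The bound equals \<open>4 / (n * \<eta>\<^sup>2)\<close>, which is where the
    requirement \<open>8 \<le> real (card L) * \<eta>\<^sup>2\<close> enters.\<close>
  also have "\<dots> \<le> 1/2"
    using n \<eta> by (simp add: n_def[symmetric] power2_eq_square field_simps)
  finally have bad: "measure (iid L ?Q) ?B \<le> 1/2"
    unfolding freq p n_def[symmetric] * space_eq .
  have fm: "(\<lambda>x. emp_freq L g x) \<in> borel_measurable (iid L P)"
  proof -
    have "emp_freq L g = (\<lambda>x. (\<Sum>i\<in>L. indicator g (x i)) / n)" using n by (auto simp: freq)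
    then show ?thesis by simp
  qed
  have Bm: "?B \<in> sets (iid L P)" using fm by measurable
  let ?Gd = "space (iid L P) - ?B"
  have eq: "{x \<in> cube L W. \<bar>emp_freq L g x - ?p\<bar> < \<eta> / 2} = ?Gd \<inter> cube L W"
    using sets.sets_into_space[OF W] by (auto simp: space_PiM PiE_iff not_less extensional_def)
  have E: "cube L W \<in> sets (iid L P)" using L W by (intro sets_PiM_I_finite) auto
  show "{x \<in> cube L W. \<bar>emp_freq L g x - ?p\<bar> < \<eta> / 2} \<in> sets (iid L P)"
    unfolding eq using Bm E by blast
  have "measure (iid L P) (?Gd \<inter> cube L W) = measure P W ^ card L * measure (iid L ?Q) ?Gd"
    using Bm by (intro measure_PiM_uniform_measure[OF P W w L(1)]) auto
  moreover have "measure (iid L ?Q) ?Gd = 1 - measure (iid L ?Q) ?B"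
    unfolding space_eq[symmetric] using Bm by (intro QL.prob_compl) (simp add: sets_eq space_eq)
  ultimately have "measure (iid L P) (?Gd \<inter> cube L W) \<ge> measure P W ^ card L * (1/2)"
    using bad w by (auto intro!: mult_left_mono)
  then show "measure (iid L P) {x \<in> cube L W. \<bar>emp_freq L g x - ?p\<bar> < \<eta> / 2} \<ge> measure P W ^ card L / 2"
    unfolding eq by simp
qed

text \<open>The window is centred at a random point, so the exceptional samples for all
  \<open>y\<close> must form one jointly measurable set before Fubini can be applied.
  \<open>C\<close> collects the pairs for which a ghost sample from the same window shows a large
  discrepancy with conditional probability at least one half. It contains every bad pair because the
  ghost frequency is close to the true one with that probability, and it is small by Markov's
  inequality on the double sample. The discrepancy event does not mention \<open>y\<close>, so one
  null set serves all windows.\<close>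

lemma uniform_convergence_cover:
  fixes P :: "real measure" and W :: "real \<Rightarrow> real set"
  assumes P: "prob_space P" and sP[measurable_cong]: "sets P = sets borel"
    and \<Omega>[measurable]: "{(y, t). t \<in> W y} \<in> sets (borel \<Otimes>\<^sub>M borel)"
    and G: "G \<subseteq> sets borel"
    and vc: "\<And>A. finite A \<Longrightarrow> shatters G A \<Longrightarrow> card A \<le> d"
    and meas: "\<And>(n::nat) S. S \<subseteq> {..<n} \<Longrightarrow>
        {x \<in> space (iid {..<n} P). \<exists>g\<in>G. \<forall>i<n. x i \<in> g \<longleftrightarrow> i \<in> S} \<in> sets (completion (iid {..<n} P))"
    and l: "l > 0" and \<eta>: "\<eta> > 0" "8 \<le> real l * \<eta>\<^sup>2" and x: "0 < x" "x \<le> 1"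
  shows "\<exists>C\<in>sets (borel \<Otimes>\<^sub>M iid {..<l} P). \<forall>y. measure P (W y) > 0 \<longrightarrow>
     (\<forall>z\<in>cube {..<l} (W y). \<forall>g\<in>G. \<bar>emp_freq {..<l} g z - measure P (W y \<inter> g) / measure P (W y)\<bar> > \<eta> \<longrightarrow> (y, z) \<in> C) \<and>
     measure (iid {..<l} P) ({z \<in> space (iid {..<l} P). (y, z) \<in> C} \<inter> cube {..<l} (W y))
        \<le> 2 * sym_bound d l (\<eta> / 2 * real l) x * measure P (W y) ^ l"
proof -
  interpret P: prob_space P by fact
  let ?N = "{..<2 * l}" and ?L1 = "{..<l}" and ?L2 = "{l..<2 * l}" and ?u = "\<eta> / 2 * real l"
  let ?M = "iid ?N P" and ?M1 = "iid ?L1 P" and ?M2 = "iid ?L2 P"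
  interpret M: prob_space ?M by (intro prob_space_PiM P)
  interpret M1: prob_space ?M1 by (intro prob_space_PiM P)
  interpret M2: prob_space ?M2 by (intro prob_space_PiM P)
  interpret PP: product_prob_space "\<lambda>_. P" ?N by unfold_locales
  have NU: "?N = ?L1 \<union> ?L2" by auto
  have spP: "space P = UNIV" using sets_eq_imp_space_eq[OF sP] by simp
  define A where "A = {z \<in> space ?M. \<exists>g\<in>G. \<bar>disc l g z\<bar> > ?u}"
  have "A \<in> sets (completion ?M)"
  proof -
    define e where "e S = (\<Sum>j<l. of_bool (j \<in> S) - of_bool (j + l \<in> S) :: real)" for S :: "nat set"
    have "A = (\<Union>S\<in>{S \<in> Pow ?N. \<bar>e S\<bar> > ?u}. {z \<in> space ?M. \<exists>g\<in>G. \<forall>i<2*l. z i \<in> g \<longleftrightarrow> i \<in> S})" (is "_ = ?R")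
    proof (intro set_eqI iffI)
      fix z assume "z \<in> A"
      then obtain g where g: "z \<in> space ?M" "g \<in> G" "\<bar>disc l g z\<bar> > ?u" by (auto simp: A_def)
      have "e {j. j < 2 * l \<and> z j \<in> g} = disc l g z" by (auto simp: e_def disc_def intro!: sum.cong)
      then show "z \<in> ?R" using g by (intro UN_I[of "{j. j < 2 * l \<and> z j \<in> g}"]) auto
    next
      fix z assume "z \<in> ?R"
      then obtain S g where g: "z \<in> space ?M" "g \<in> G" "\<bar>e S\<bar> > ?u" "\<forall>i<2*l. z i \<in> g \<longleftrightarrow> i \<in> S" by auto
      have "e S = disc l g z" using g(4) by (auto simp: e_def disc_def intro!: sum.cong)
      then show "z \<in> A" using g by (auto simp: A_def)
    qed
    moreover have "?R \<in> sets (completion ?M)"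
    proof (rule sets.finite_UN)
      fix S assume "S \<in> {S \<in> Pow ?N. \<bar>e S\<bar> > ?u}"
      then have "S \<subseteq> ?N" by simp
      then show "{z \<in> space ?M. \<exists>g\<in>G. \<forall>i<2*l. z i \<in> g \<longleftrightarrow> i \<in> S} \<in> sets (completion ?M)" by (rule meas)
    qed simp
    ultimately show ?thesis by (rule ssubst)
  qed
  \<comment> \<open>\<open>A'\<close> below enlarges \<open>A\<close> to a measurable set for the
    uncompleted product; every additional point lies in the null set \<open>N\<close>.\<close>
  then obtain S N0 N where SN: "A = S \<union> N0" "N0 \<subseteq> N" "N \<in> null_sets ?M" "S \<in> sets ?M"
    by (rule sets_completionE)
  define A' where "A' = S \<union> N"
  have A'm[measurable]: "A' \<in> sets ?M" using SN by (auto simp: A'_def)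
  have AA': "A \<subseteq> A'" using SN by (auto simp: A'_def)
  have A'N: "z \<in> N \<or> (\<exists>g\<in>G. \<bar>disc l g z\<bar> > ?u)" if "z \<in> A'" for z
    using that SN(1) by (auto simp: A'_def A_def)
  have Wm: "W y \<in> sets P" for y
  proof -
    have "Pair y -` {(y, t). t \<in> W y} \<in> sets borel" using \<Omega> by (rule sets_Pair1)
    then show ?thesis by (simp add: sP vimage_def)
  qed
  have u: "?u > 0" using l \<eta> by simp
  \<comment> \<open>The mass of ghost samples in the window of \<open>y\<close> that exhibit a
    discrepancy with \<open>z\<close>. The cube is spelled as a product of indicators of one planar
    set, which makes measurability in \<open>y\<close> visible.\<close>
  define F where "F y z = (\<integral>\<^sup>+z'. indicator A' (merge ?L1 ?L2 (z, z')) * (\<Prod>j\<in>?L2. indicator {(y, t). t \<in> W y} (y, z' j)) \<partial>?M2)" for y z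
  define wt where "wt y = (\<integral>\<^sup>+t. indicator {(y, t). t \<in> W y} (y, t) \<partial>P)" for y
  have wt: "wt y = ennreal (measure P (W y))" for y
  proof -
    have "wt y = (\<integral>\<^sup>+t. indicator (W y) t \<partial>P)" unfolding wt_def by (intro nn_integral_cong) (auto simp: indicator_def)
    then show ?thesis using Wm by (simp add: P.emeasure_eq_measure)
  qed
  have wtm[measurable]: "wt \<in> borel_measurable borel" unfolding wt_def by measurable
  have mg[measurable]: "merge ?L1 ?L2 \<in> ?M1 \<Otimes>\<^sub>M ?M2 \<rightarrow>\<^sub>M ?M"
    unfolding NU by (rule measurable_merge)
  have Fm[measurable]: "(\<lambda>(y, z). F y z) \<in> borel_measurable (borel \<Otimes>\<^sub>M ?M1)"
    unfolding F_def by measurable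
  \<comment> \<open>The condition that \<open>F y z\<close> is at least half of
    \<open>wt y ^ l\<close>, multiplied out to avoid a division of extended reals.\<close>
  define C where "C = {q \<in> space (borel \<Otimes>\<^sub>M ?M1). wt (fst q) ^ l \<le> 2 * (case q of (y, z) \<Rightarrow> F y z)}"
  have Cm: "C \<in> sets (borel \<Otimes>\<^sub>M ?M1)" unfolding C_def by measurable
  have F_eq: "F y z = emeasure ?M2 {z' \<in> cube ?L2 (W y). merge ?L1 ?L2 (z, z') \<in> A'}" if z: "z \<in> space ?M1" for y z
  proof -
    have "F y z = (\<integral>\<^sup>+z'. indicator {z' \<in> cube ?L2 (W y). merge ?L1 ?L2 (z, z') \<in> A'} z' \<partial>?M2)"
      unfolding F_def
    proof (intro nn_integral_cong)
      fix z' assume "z' \<in> space ?M2"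
      then have "z' \<in> cube ?L2 (W y) \<longleftrightarrow> (\<forall>j\<in>?L2. z' j \<in> W y)" by (auto simp: space_PiM PiE_iff)
      moreover have "(\<Prod>j\<in>?L2. indicator {(y, t). t \<in> W y} (y, z' j)) = (of_bool (\<forall>j\<in>?L2. z' j \<in> W y) :: ennreal)"
      proof (cases "\<forall>j\<in>?L2. z' j \<in> W y")
        case False
        then obtain j where j: "j \<in> ?L2" "z' j \<notin> W y" by auto
        then have "(\<Prod>j\<in>?L2. indicator {(y, t). t \<in> W y} (y, z' j)) = (0 :: ennreal)"
          by (intro prod_zero bexI[of _ j]) auto
        then show ?thesis using False by simp
      qed simp
      ultimately show "indicator A' (merge ?L1 ?L2 (z, z')) * (\<Prod>j\<in>?L2. indicator {(y, t). t \<in> W y} (y, z' j))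
        = (indicator {z' \<in> cube ?L2 (W y). merge ?L1 ?L2 (z, z') \<in> A'} z' :: ennreal)"
        by (auto simp: indicator_def)
    qed
    also have "\<dots> = emeasure ?M2 {z' \<in> cube ?L2 (W y). merge ?L1 ?L2 (z, z') \<in> A'}"
    proof (rule nn_integral_indicator)
      have "cube ?L2 (W y) \<in> sets ?M2" using Wm by (intro sets_PiM_I_finite) auto
      moreover have "{z' \<in> space ?M2. merge ?L1 ?L2 (z, z') \<in> A'} \<in> sets ?M2" using z by measurable
      moreover have "{z' \<in> cube ?L2 (W y). merge ?L1 ?L2 (z, z') \<in> A'}
         = cube ?L2 (W y) \<inter> {z' \<in> space ?M2. merge ?L1 ?L2 (z, z') \<in> A'}"
        by (auto simp: space_PiM PiE_iff spP extensional_def)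
      ultimately show "{z' \<in> cube ?L2 (W y). merge ?L1 ?L2 (z, z') \<in> A'} \<in> sets ?M2" by auto
    qed
    finally show ?thesis .
  qed
  show ?thesis
  proof (intro bexI[OF _ Cm] allI impI conjI ballI)
    fix y z g assume w: "measure P (W y) > 0" and z: "z \<in> cube ?L1 (W y)" and g: "g \<in> G"
      and dev: "\<bar>emp_freq ?L1 g z - measure P (W y \<inter> g) / measure P (W y)\<bar> > \<eta>"
    have zs: "z \<in> space ?M1" using z by (auto simp: space_PiM PiE_iff spP extensional_def)
    let ?Gd = "{x \<in> cube ?L2 (W y). \<bar>emp_freq ?L2 g x - measure P (W y \<inter> g) / measure P (W y)\<bar> < \<eta> / 2}"
    have gm: "g \<in> sets P" using g G sP by auto
    have Gd: "measure ?M2 ?Gd \<ge> measure P (W y) ^ l / 2" and Gdm: "?Gd \<in> sets ?M2"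
      using ghost_sample_likely[OF P Wm w gm, of ?L2 \<eta>] l \<eta> by auto
    have "?Gd \<subseteq> {z' \<in> cube ?L2 (W y). merge ?L1 ?L2 (z, z') \<in> A'}"
    proof safe
      fix z' assume z': "z' \<in> cube ?L2 (W y)" and cl: "\<bar>emp_freq ?L2 g z' - measure P (W y \<inter> g) / measure P (W y)\<bar> < \<eta> / 2"
      let ?m = "merge ?L1 ?L2 (z, z')"
      have "emp_freq ?L1 g ?m = emp_freq ?L1 g z" "emp_freq ?L2 g ?m = emp_freq ?L2 g z'"
        by (auto simp: emp_freq_def merge_def intro!: arg_cong[where f=card])
      then have "disc l g ?m = real l * (emp_freq ?L1 g z - emp_freq ?L2 g z')"
        using disc_eq_emp_freq[OF l] by simp
      moreover have "\<bar>emp_freq ?L1 g z - emp_freq ?L2 g z'\<bar> > \<eta> / 2" using cl dev by linarith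
      ultimately have "\<bar>disc l g ?m\<bar> > ?u" using l by (simp add: abs_mult mult.commute)
      moreover have "?m \<in> space ?M" using z z' by (auto simp: space_PiM PiE_iff spP extensional_def merge_def)
      ultimately show "?m \<in> A'" using g AA' by (auto simp: A_def)
    qed
    moreover have "{z' \<in> cube ?L2 (W y). merge ?L1 ?L2 (z, z') \<in> A'} \<in> sets ?M2"
    proof -
      have "cube ?L2 (W y) \<in> sets ?M2" using Wm by (intro sets_PiM_I_finite) auto
      moreover have "{z' \<in> space ?M2. merge ?L1 ?L2 (z, z') \<in> A'} \<in> sets ?M2" using zs by measurable
      moreover have "{z' \<in> cube ?L2 (W y). merge ?L1 ?L2 (z, z') \<in> A'}
         = cube ?L2 (W y) \<inter> {z' \<in> space ?M2. merge ?L1 ?L2 (z, z') \<in> A'}"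
        by (auto simp: space_PiM PiE_iff spP extensional_def)
      ultimately show ?thesis by auto
    qed
    ultimately have "emeasure ?M2 ?Gd \<le> F y z" unfolding F_eq[OF zs] by (rule emeasure_mono)
    moreover have "ennreal (measure P (W y) ^ l / 2) \<le> emeasure ?M2 ?Gd"
      using Gd by (simp add: M2.emeasure_eq_measure ennreal_leI)
    ultimately have "ennreal (measure P (W y) ^ l / 2) \<le> F y z" by (rule order_trans[rotated])
    then have "2 * ennreal (measure P (W y) ^ l / 2) \<le> 2 * F y z" by (rule mult_left_mono) simp
    moreover have "2 * ennreal (measure P (W y) ^ l / 2) = wt y ^ l"
    proof -
      have "2 * ennreal (measure P (W y) ^ l / 2) = ennreal (2 * (measure P (W y) ^ l / 2))"
        by (subst ennreal_mult) auto
      then show ?thesis by (simp add: wt ennreal_power)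
    qed
    ultimately show "(y, z) \<in> C" using zs by (simp add: C_def space_pair_measure)
  next
    fix y assume w: "measure P (W y) > 0"
    let ?E1 = "cube ?L1 (W y)" and ?E = "cube ?N (W y)"
    let ?CE = "{z \<in> space ?M1. (y, z) \<in> C} \<inter> ?E1"
    have E1m: "?E1 \<in> sets ?M1" using Wm by (intro sets_PiM_I_finite) auto
    have Em: "?E \<in> sets ?M" using Wm by (intro sets_PiM_I_finite) auto
    have Cym: "{z \<in> space ?M1. (y, z) \<in> C} \<in> sets ?M1" using Cm by measurable
    have "emeasure ?M (A' \<inter> ?E) = (\<integral>\<^sup>+z. emeasure ?M2 ((\<lambda>z'. merge ?L1 ?L2 (z, z')) -` (A' \<inter> ?E) \<inter> space ?M2) \<partial>?M1)"
    proof -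
      have "?L1 \<inter> ?L2 = {}" by auto
      then show ?thesis
        using PP.emeasure_fold_integral[of ?L1 ?L2 "A' \<inter> ?E"] A'm Em unfolding NU[symmetric] by simp
    qed
    \<comment> \<open>Markov's inequality: over each \<open>z\<close> in \<open>?CE\<close> the
      inner measure is at least half the mass of the cube.\<close>
    also have "\<dots> \<ge> (\<integral>\<^sup>+z. ennreal (measure P (W y) ^ l / 2) * indicator ?CE z \<partial>?M1)"
    proof (rule nn_integral_mono)
      fix z assume z: "z \<in> space ?M1"
      show "ennreal (measure P (W y) ^ l / 2) * indicator ?CE z
         \<le> emeasure ?M2 ((\<lambda>z'. merge ?L1 ?L2 (z, z')) -` (A' \<inter> ?E) \<inter> space ?M2)"
      proof (cases "z \<in> ?CE")
        case True
        then have zE: "z \<in> ?E1" by auto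
        have "wt y ^ l \<le> 2 * F y z" using True by (auto simp: C_def)
        then have "ennreal (2 * (measure P (W y) ^ l / 2)) \<le> 2 * F y z" by (simp add: wt ennreal_power)
        then have "2 * ennreal (measure P (W y) ^ l / 2) \<le> 2 * F y z" by (subst (asm) ennreal_mult) auto
        then have "ennreal (measure P (W y) ^ l / 2) \<le> F y z"
          by (subst (asm) ennreal_mult_le_mult_iff) auto
        also have "F y z = emeasure ?M2 ((\<lambda>z'. merge ?L1 ?L2 (z, z')) -` (A' \<inter> ?E) \<inter> space ?M2)"
          unfolding F_eq[OF z]
        proof (intro arg_cong[where f="emeasure ?M2"] set_eqI)
          fix z'
          have "merge ?L1 ?L2 (z, z') \<in> ?E \<longleftrightarrow> z' \<in> cube ?L2 (W y)" if "z' \<in> space ?M2"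
            using zE that by (auto simp: PiE_iff merge_def space_PiM extensional_def)
          then show "z' \<in> {z' \<in> cube ?L2 (W y). merge ?L1 ?L2 (z, z') \<in> A'} \<longleftrightarrow>
              z' \<in> (\<lambda>z'. merge ?L1 ?L2 (z, z')) -` (A' \<inter> ?E) \<inter> space ?M2"
            by (auto simp: space_PiM PiE_iff spP extensional_def)
        qed
        finally show ?thesis using True by simp
      qed simp
    qed
    finally have "ennreal (measure P (W y) ^ l / 2) * ennreal (measure ?M1 ?CE) \<le> ennreal (measure ?M (A' \<inter> ?E))"
      using Cym E1m by (simp add: nn_integral_cmult M1.emeasure_eq_measure M.emeasure_eq_measure)
    then have "measure P (W y) ^ l / 2 * measure ?M1 ?CE \<le> measure ?M (A' \<inter> ?E)"
      by (subst (asm) ennreal_mult[symmetric]) auto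
    also have "\<dots> \<le> sym_bound d l ?u x * measure P (W y) ^ (2 * l)"
      by (rule measure_ghost_le[OF P Wm vc x u A'm SN(3) A'N])
    finally have "measure P (W y) ^ l / 2 * measure ?M1 ?CE \<le> sym_bound d l ?u x * (measure P (W y) ^ l * measure P (W y) ^ l)"
      by (simp only: mult_2 power_add)
    moreover have "m \<le> 2 * b * a" if "a / 2 * m \<le> b * (a * a)" "a > 0" for a b m :: real
    proof -
      have "a * m \<le> a * (2 * b * a)" using that(1) by (simp add: algebra_simps)
      then show ?thesis using that(2) by (simp only: mult_le_cancel_left_pos)
    qed
    ultimately show "measure ?M1 ?CE \<le> 2 * sym_bound d l ?u x * measure P (W y) ^ l"
      using w zero_less_power by blast
  qed
qed

section \<open>Window averages and piecewise functions\<close>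

text \<open>A monotone \<open>r\<close> has intervals as level sets; \<open>pos\<close> renumbers
  the levels in \<open>S\<close> and lets a discarded level fall to the piece of the next retained
  one, if there is one. Breakpoints are suprema, and whether a level contains its right end is
  unknown, so the finitely many breakpoints are excepted.\<close>

lemma piecewise_of_levels:
  fixes r :: "real \<Rightarrow> nat"
  assumes r: "mono r" and S: "finite S" "card S \<le> k" and k: "k \<ge> 1" and lab: "\<And>j. lab j \<in> H"
  shows "\<exists>g\<in>piecewise k H. \<exists>F. finite F \<and> (\<forall>x. 0 < x \<longrightarrow> x < 1 \<longrightarrow> x \<notin> F \<longrightarrow> r x \<in> S \<longrightarrow> g x = lab (r x) x)"
proof -
  define pos where "pos s = card {s' \<in> S. s' < s}" for s
  define q where "q x = pos (r x)" for x
  have pos_mono: "pos a \<le> pos b" if "a \<le> b" for a b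
    unfolding pos_def using S that by (intro card_mono) auto
  have pos_strict: "pos a < pos b" if "a < b" "a \<in> S" for a b
    unfolding pos_def using S that by (intro psubset_card_mono) auto
  have pos_less: "pos a < card S" if "a \<in> S" for a
    unfolding pos_def using S that by (intro psubset_card_mono) auto
  have q_mono: "q x \<le> q y" if "x \<le> y" for x y using monoD[OF r that] pos_mono by (simp add: q_def)
  \<comment> \<open>\<open>0\<close> is inserted so that the supremum is taken over a nonempty set
    and stays in the unit interval.\<close>
  define Sp where "Sp i = Sup (insert 0 {x \<in> {0..1}. q x < i})" for i
  define t where "t i = (if i = 0 then -\<infinity> else if i \<ge> k then \<infinity> else ereal (Sp i))" for i
  \<comment> \<open>Piece \<open>i\<close> takes the retained level with \<open>i - 1\<close>
    retained levels below it. If there is none the choice is arbitrary, but \<open>lab\<close> still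
    yields a member of \<open>H\<close>.\<close>
  define h where "h i = lab (SOME s. s \<in> S \<and> pos s = i - 1)" for i
  define g where "g x = h (LEAST i. 1 \<le> i \<and> ereal x \<le> t i) x" for x
  have bdd: "bdd_above (insert 0 {x \<in> {0..1::real}. q x < i})" for i
    by (rule bdd_aboveI[of _ 1]) auto
  have Sp_mono: "Sp i \<le> Sp j" if "i \<le> j" for i j
    unfolding Sp_def using that bdd by (intro cSup_subset_mono) auto
  have t_mono: "mono_on {0..k} t"
    by (rule mono_onI) (auto simp: t_def Sp_mono)
  have g_eq: "g x = h i x" if i: "i \<in> {1..k}" "t (i - 1) < ereal x" "ereal x \<le> t i" for x i
  proof -
    have "(LEAST i. 1 \<le> i \<and> ereal x \<le> t i) = i"
    proof (rule Least_equality)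
      show "1 \<le> i \<and> ereal x \<le> t i" using i by simp
      fix j assume j: "1 \<le> j \<and> ereal x \<le> t j"
      show "i \<le> j"
      proof (rule ccontr)
        assume "\<not> i \<le> j"
        then have "t j \<le> t (i - 1)" using i by (intro mono_onD[OF t_mono]) auto
        then show False using j i(2) by (meson order.trans not_le)
      qed
    qed
    then show ?thesis by (simp add: g_def)
  qed
  have "g \<in> piecewise k H" unfolding piecewise_def
  proof (intro CollectI exI[of _ t] exI[of _ h] conjI)
    show "t 0 = -\<infinity>" by (simp add: t_def)
    show "t k = \<infinity>" using k by (simp add: t_def)
    show "\<forall>i\<in>{1..<k}. t i \<in> range ereal" by (auto simp: t_def)
    show "mono_on {0..k} t" by (rule t_mono)
    show "\<forall>i\<in>{1..k}. h i \<in> H" by (simp add: h_def lab)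
    show "\<forall>x. \<forall>i\<in>{1..k}. t (i - 1) < ereal x \<and> ereal x \<le> t i \<longrightarrow> g x = h i x" using g_eq by simp
  qed
  moreover have "g x = lab (r x) x" if x: "0 < x" "x < 1" "x \<notin> Sp ` {..k}" "r x \<in> S" for x
  proof -
    define i where "i = q x + 1"
    have i: "i \<in> {1..k}" using pos_less[OF x(4)] S by (auto simp: i_def q_def)
    have "ereal x \<le> t i"
    proof (cases "i = k")
      case False
      have "x \<le> Sp i" unfolding Sp_def using x bdd by (intro cSup_upper) (auto simp: i_def)
      then show ?thesis using False i by (simp add: t_def)
    qed (use k in \<open>simp add: t_def\<close>)
    moreover have "t (i - 1) < ereal x"
    proof (cases "i - 1 = 0")
      case False
      have "Sp (i - 1) \<le> x" unfolding Sp_def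
      proof (rule cSup_least)
        fix y assume "y \<in> insert 0 {x \<in> {0..1}. q x < i - 1}"
        then show "y \<le> x" using x q_mono[of x y] by (auto simp: i_def not_less[symmetric])
      qed simp
      moreover have "Sp (i - 1) \<noteq> x" using x(3) i by (auto simp: image_iff)
      ultimately show ?thesis using False i by (auto simp: t_def)
    qed (simp add: t_def)
    ultimately have "g x = h i x" using g_eq[OF i] by simp
    moreover have "(SOME s. s \<in> S \<and> pos s = i - 1) = r x"
    proof (rule some_equality)
      show "r x \<in> S \<and> pos (r x) = i - 1" using x by (simp add: i_def q_def)
      fix s assume "s \<in> S \<and> pos s = i - 1"
      then show "s = r x" using pos_strict[of s "r x"] pos_strict[of "r x" s] x(4)
        by (cases s "r x" rule: linorder_cases) (auto simp: i_def q_def)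
    qed
    ultimately show ?thesis by (simp add: h_def)
  qed
  ultimately show ?thesis
    by (intro bexI[of _ g] exI[of _ "Sp ` {..k}"] conjI allI impI finite_imageI finite_atMost) simp_all
qed

section \<open>Tent functions and window averages\<close>

lemma integral_tent:
  fixes \<alpha> \<beta> c \<rho> :: real
  assumes "\<rho> \<ge> 0"
  shows "(\<integral>x. (\<alpha> - \<beta> * \<bar>x - c\<bar>) * indicator {c - \<rho>..c + \<rho>} x \<partial>lborel) = 2 * \<alpha> * \<rho> - \<beta> * \<rho>\<^sup>2"
    and "integrable lborel (\<lambda>x. (\<alpha> - \<beta> * \<bar>x - c\<bar>) * indicator {c - \<rho>..c + \<rho>} x)"
proof -
  let ?f = "\<lambda>x. \<alpha> - \<beta> * \<bar>x - c\<bar>"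
  have cont: "continuous_on A ?f" for A by (intro continuous_intros)
  have int: "integrable lborel (\<lambda>x. ?f x * indicator {a..b} x)" for a b
    using borel_integrable_atLeastAtMost'[OF cont, of a b] by (simp add: set_integrable_def mult.commute)
  have L: "(\<integral>x. ?f x * indicator {c - \<rho>..c} x \<partial>lborel) = \<alpha> * \<rho> - \<beta> * \<rho>\<^sup>2 / 2"
  proof -
    have "(\<integral>x. ?f x * indicator {c - \<rho>..c} x \<partial>lborel) = (\<integral>x. (\<alpha> + \<beta> * (x - c)) * indicator {c - \<rho>..c} x \<partial>lborel)"
      by (intro Bochner_Integration.integral_cong) (auto simp: indicator_def algebra_simps)
    also have "\<dots> = (\<alpha> * c + \<beta> * (c - c)\<^sup>2 / 2) - (\<alpha> * (c - \<rho>) + \<beta> * (c - \<rho> - c)\<^sup>2 / 2)"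
      using assms by (intro integral_FTC_Icc_real) (auto intro!: derivative_eq_intros continuous_intros)
    finally show ?thesis by (simp add: algebra_simps)
  qed
  have R: "(\<integral>x. ?f x * indicator {c..c + \<rho>} x \<partial>lborel) = \<alpha> * \<rho> - \<beta> * \<rho>\<^sup>2 / 2"
  proof -
    have "(\<integral>x. ?f x * indicator {c..c + \<rho>} x \<partial>lborel) = (\<integral>x. (\<alpha> - \<beta> * (x - c)) * indicator {c..c + \<rho>} x \<partial>lborel)"
      by (intro Bochner_Integration.integral_cong) (auto simp: indicator_def)
    also have "\<dots> = (\<alpha> * (c + \<rho>) - \<beta> * (c + \<rho> - c)\<^sup>2 / 2) - (\<alpha> * c - \<beta> * (c - c)\<^sup>2 / 2)"
      using assms by (intro integral_FTC_Icc_real) (auto intro!: derivative_eq_intros continuous_intros)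
    finally show ?thesis by (simp add: algebra_simps)
  qed
  have "(\<integral>x. ?f x * indicator {c - \<rho>..c + \<rho>} x \<partial>lborel)
      = (\<integral>x. ?f x * indicator {c - \<rho>..c} x + ?f x * indicator {c..c + \<rho>} x \<partial>lborel)"
  proof (rule integral_cong_AE)
    show "AE x in lborel. ?f x * indicator {c - \<rho>..c + \<rho>} x = ?f x * indicator {c - \<rho>..c} x + ?f x * indicator {c..c + \<rho>} x"
      using AE_lborel_singleton[of c] by eventually_elim (use assms in \<open>auto simp: indicator_def\<close>)
  qed measurable
  also have "\<dots> = 2 * \<alpha> * \<rho> - \<beta> * \<rho>\<^sup>2"
    by (subst Bochner_Integration.integral_add[OF int int]) (simp add: L R)
  finally show "(\<integral>x. ?f x * indicator {c - \<rho>..c + \<rho>} x \<partial>lborel) = 2 * \<alpha> * \<rho> - \<beta> * \<rho>\<^sup>2" .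
  show "integrable lborel (\<lambda>x. ?f x * indicator {c - \<rho>..c + \<rho>} x)" by (rule int)
qed

definition window_frac :: "real \<Rightarrow> real set \<Rightarrow> real \<Rightarrow> real" where
  "window_frac \<delta> g x = measure lborel (g \<inter> {x - \<delta><..<x + \<delta>}) / (2 * \<delta>)"

text \<open>What the window at \<open>x\<close> has and the window at \<open>y\<close> lacks is
  covered by one interval of length \<open>\<bar>x - y\<bar>\<close>. Counting one side instead of
  both gives \<open>1 / (2 * \<delta>)\<close>, and this constant fixes the leading term
  \<open>\<delta> / 2\<close> in the cost of a change.\<close>

lemma window_frac_Lipschitz:
  assumes "\<delta> > 0" and g: "g \<in> sets borel"
  shows "\<bar>window_frac \<delta> g x - window_frac \<delta> g y\<bar> \<le> \<bar>x - y\<bar> / (2 * \<delta>)"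
proof -
  let ?m = "\<lambda>x. measure lborel (g \<inter> {x - \<delta><..<x + \<delta>})"
  have fm: "g \<inter> {x - \<delta><..<x + \<delta>} \<in> fmeasurable lborel" for x
    by (rule fmeasurableI2[of "{x - \<delta><..<x + \<delta>}"]) (use g assms(1) in \<open>auto simp: fmeasurable_def\<close>)
  have step: "?m x \<le> ?m y + \<bar>x - y\<bar>" for x y
  proof -
    let ?C = "if x \<le> y then {x - \<delta>..y - \<delta>} else {y + \<delta>..x + \<delta>}"
    have C: "?C \<in> fmeasurable lborel" by (auto simp: fmeasurable_def)
    have "?m x \<le> measure lborel ((g \<inter> {y - \<delta><..<y + \<delta>}) \<union> ?C)"
      using fm C g by (intro measure_mono_fmeasurable fmeasurable.Un) auto
    also have "\<dots> \<le> ?m y + measure lborel ?C"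
      using fm C by (intro measure_Un_le) (auto simp: fmeasurable_def)
    also have "measure lborel ?C = \<bar>x - y\<bar>" by auto
    finally show ?thesis .
  qed
  have "\<bar>?m x - ?m y\<bar> \<le> \<bar>x - y\<bar>" using step[of x y] step[of y x] by linarith
  then show ?thesis using assms(1)
    by (simp add: window_frac_def diff_divide_distrib[symmetric] divide_right_mono)
qed

lemma continuous_window_frac:
  assumes "\<delta> > 0" and g: "g \<in> sets borel"
  shows "continuous_on A (window_frac \<delta> g)"
proof (rule continuous_on_subset[OF _ subset_UNIV], rule lipschitz_on_continuous_on)
  show "(1 / (2 * \<delta>))-lipschitz_on UNIV (window_frac \<delta> g)"
    using assms window_frac_Lipschitz[OF assms] by (intro lipschitz_onI) (auto simp: dist_real_def)
qed

lemma window_frac_disjoint: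
  assumes "\<delta> > 0" and g: "g \<in> sets borel" "g' \<in> sets borel" and n: "g \<inter> g' \<in> null_sets lborel"
  shows "window_frac \<delta> g x + window_frac \<delta> g' x \<le> 1"
proof -
  let ?w = "{x - \<delta><..<x + \<delta>}"
  have fm: "g \<inter> ?w \<in> fmeasurable lborel" if "g \<in> sets borel" for g
    by (rule fmeasurableI2[of ?w]) (use that assms(1) in \<open>auto simp: fmeasurable_def\<close>)
  have "(g \<inter> ?w) \<inter> (g' \<inter> ?w) \<in> null_sets lborel"
    by (rule null_sets_subset[OF n]) (use g in auto)
  then have "measure lborel (g \<inter> ?w) + measure lborel (g' \<inter> ?w) = measure lborel ((g \<inter> ?w) \<union> (g' \<inter> ?w))"
    using fm g by (subst measure_Un3) (auto simp: measure_eq_0_null_sets)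
  also have "\<dots> \<le> measure lborel ?w"
    using g assms(1) by (intro measure_mono_fmeasurable) (auto simp: fmeasurable_def)
  finally show ?thesis using assms(1) by (simp add: window_frac_def add_divide_distrib[symmetric])
qed

text \<open>Almost every point lies in at most one of the sets, so their indicators sum to at most 1
  there; integrate over the unit interval.\<close>

lemma card_heavy_ae_disjoint_le:
  fixes S :: "'h \<Rightarrow> real set"
  assumes A: "finite A" and S: "\<And>h. h \<in> A \<Longrightarrow> S h \<in> sets borel"
    and dj: "\<And>h h'. h \<in> A \<Longrightarrow> h' \<in> A \<Longrightarrow> h \<noteq> h' \<Longrightarrow> S h \<inter> S h' \<in> null_sets lborel"
    and heavy: "\<And>h. h \<in> A \<Longrightarrow> \<delta> \<le> measure lborel (S h \<inter> {0<..<1})"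
  shows "real (card A) * \<delta> \<le> 1"
proof -
  have fin: "emeasure lborel (S h \<inter> {0<..<1}) < \<infinity>" for h
    using emeasure_mono[of "S h \<inter> {0<..<1}" "{0<..<1}" lborel] by (simp add: le_less_trans)
  have int: "integrable lborel (\<lambda>x. indicator (S h \<inter> {0<..<1}) x :: real)" if "h \<in> A" for h
    using S[OF that] fin[of h] by (intro integrable_real_indicator) auto
  have "AE x in lborel. \<forall>p\<in>{p\<in>A \<times> A. fst p \<noteq> snd p}. x \<notin> S (fst p) \<inter> S (snd p)"
  proof (rule AE_finite_allI)
    show "finite {p\<in>A \<times> A. fst p \<noteq> snd p}" using A by simp
    fix p assume "p \<in> {p\<in>A \<times> A. fst p \<noteq> snd p}"
    then show "AE x in lborel. x \<notin> S (fst p) \<inter> S (snd p)" by (intro AE_not_in dj) auto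
  qed
  then have ae: "AE x in lborel. (\<Sum>h\<in>A. indicator (S h \<inter> {0<..<1}) x) \<le> (indicator {0<..<1} x :: real)"
  proof eventually_elim
    fix x assume x: "\<forall>p\<in>{p\<in>A \<times> A. fst p \<noteq> snd p}. x \<notin> S (fst p) \<inter> S (snd p)"
    show "(\<Sum>h\<in>A. indicator (S h \<inter> {0<..<1}) x) \<le> (indicator {0<..<1} x :: real)"
    proof (cases "\<exists>h\<in>A. x \<in> S h")
      case True
      then obtain h where h: "h \<in> A" "x \<in> S h" by auto
      have "(\<Sum>h'\<in>A. indicator (S h' \<inter> {0<..<1}) x) = (\<Sum>h'\<in>A. if h' = h then indicator {0<..<1} x else 0 :: real)"
        using x h by (intro sum.cong) (auto simp: indicator_def)
      then show ?thesis using A h by simp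
    next
      case False
      then have "(\<Sum>h\<in>A. indicator (S h \<inter> {0<..<1}) x) = (0 :: real)" by (intro sum.neutral) auto
      then show ?thesis by simp
    qed
  qed
  have "real (card A) * \<delta> = (\<Sum>h\<in>A. \<delta>)" by simp
  also have "\<dots> \<le> (\<Sum>h\<in>A. measure lborel (S h \<inter> {0<..<1}))" by (intro sum_mono heavy)
  also have "\<dots> = (\<integral>x. (\<Sum>h\<in>A. indicator (S h \<inter> {0<..<1}) x) \<partial>lborel)"
    using int by (subst Bochner_Integration.integral_sum) auto
  also have "\<dots> \<le> (\<integral>x. indicator {0<..<1::real} x \<partial>lborel)"
  proof (rule integral_mono_AE[OF _ _ ae])
    show "integrable lborel (\<lambda>x. \<Sum>h\<in>A. indicator (S h \<inter> {0<..<1}) x :: real)"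
      by (intro Bochner_Integration.integrable_sum int)
    show "integrable lborel (\<lambda>x. indicator {0<..<1::real} x :: real)" by (intro integrable_real_indicator) auto
  qed
  also have "\<dots> = 1" by simp
  finally show ?thesis .
qed

section \<open>Rounding a target of low noise sensitivity\<close>

lemma prob_space_uniform01: "prob_space uniform01"
  by (rule prob_space_uniform_measure) auto

lemma measure_uniform01:
  assumes "A \<in> sets borel"
  shows "measure uniform01 A = measure lborel (A \<inter> {0<..<1})"
  using assms by (subst measure_uniform_measure) (auto simp: Int_commute)

lemma integral_uniform01:
  fixes g :: "real \<Rightarrow> real"
  assumes [measurable]: "g \<in> borel_measurable borel"
  shows "(\<integral>x. g x \<partial>uniform01) = (\<integral>x. indicator {0<..<1} x * g x \<partial>lborel)"
proof -
  have "uniform01 = density lborel (\<lambda>x. ennreal (indicator {0<..<1} x))"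
    unfolding uniform_measure_def by (intro density_cong) (auto simp: indicator_def)
  then show ?thesis by (simp add: integral_density)
qed

locale rounding =
  fixes H :: "(real \<Rightarrow> 'y) set" and f :: "real \<Rightarrow> 'y" and \<delta> \<tau> \<eta> :: real
  assumes agree_sets: "\<And>h. h \<in> H \<Longrightarrow> {x. h x = f x} \<in> sets borel"
    and agree_null: "\<And>h h'. h \<in> H \<Longrightarrow> h' \<in> H \<Longrightarrow> h \<noteq> h' \<Longrightarrow> {x. h x = f x} \<inter> {x. h' x = f x} \<in> null_sets lborel"
    and \<delta>: "0 < \<delta>" "\<delta> < 1/2" and \<eta>: "0 < \<eta>" "\<eta> < \<tau>" and \<tau>: "\<tau> \<le> 1/16"
begin

definition agree :: "(real \<Rightarrow> 'y) \<Rightarrow> real \<Rightarrow> real" where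
  "agree h x = window_frac \<delta> {x. h x = f x} x"

text \<open>Agreement with \<open>f\<close> on half of a window inside the unit interval already
  means mass \<open>\<delta>\<close>, so every hypothesis that can matter is here. Almost
  disjointness leaves only finitely many, and maxima over them are measurable even for uncountable
  \<open>H\<close>.\<close>

definition heavy :: "(real \<Rightarrow> 'y) set" where
  "heavy = {h \<in> H. \<delta> \<le> measure lborel ({x. h x = f x} \<inter> {0<..<1})}"

text \<open>Hypotheses outside \<open>heavy\<close> agree on less than half of an interior window;
  the floor \<open>1/2\<close> covers them all and keeps the maximum defined when
  \<open>heavy\<close> is empty.\<close>

definition best :: "real \<Rightarrow> real" where
  "best x = Max (insert (1/2) ((\<lambda>h. agree h x) ` heavy))"

text \<open>A lower bound for the estimate. Subtracting \<open>\<eta>\<close> and truncating at 0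
  pays for the accuracy only where there is something to pay from. The estimate minimizes over
  hypotheses with the correct value at \<open>x\<close>; if the one determining \<open>x\<close> is
  wrong there, all others agree on at most \<open>\<tau>\<close> of the window, and
  \<open>1/4\<close> is a safe understatement of their error. This term exposes points where
  \<open>f\<close> departs from the hypothesis that determines them.\<close>

definition V :: "real \<Rightarrow> real" where
  "V x = (if x \<in> {\<delta>..1 - \<delta>}
          then max (max 0 (1 - best x - \<eta>)) (if \<exists>h\<in>heavy. agree h x > 1 - \<tau> \<and> h x \<noteq> f x then 1/4 else 0)
          else 0)"

lemma finite_heavy: "finite heavy"
proof (rule ccontr)
  assume "infinite heavy"
  then obtain A where A: "A \<subseteq> heavy" "finite A" "card A = nat \<lceil>1 / \<delta>\<rceil> + 1"
    using infinite_arbitrarily_large by blast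
  have "real (card A) * \<delta> \<le> 1"
  proof (rule card_heavy_ae_disjoint_le[where S="\<lambda>h. {x. h x = f x}"])
    have AH: "h \<in> H" "\<delta> \<le> measure lborel ({x. h x = f x} \<inter> {0<..<1})" if "h \<in> A" for h
      using subsetD[OF A(1) that] by (auto simp: heavy_def)
    show "finite A" by (rule A)
    show "{x. h x = f x} \<in> sets borel" "\<delta> \<le> measure lborel ({x. h x = f x} \<inter> {0<..<1})" if "h \<in> A" for h
      using AH[OF that] agree_sets by auto
    show "{x. h x = f x} \<inter> {x. h' x = f x} \<in> null_sets lborel" if "h \<in> A" "h' \<in> A" "h \<noteq> h'" for h h'
      using that AH by (intro agree_null)
  qed
  then have "real (card A) \<le> 1 / \<delta>" using \<delta> by (simp add: field_simps)
  moreover have "real (card A) > 1 / \<delta>" using A(3) by (simp add: add.commute) linarith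
  ultimately show False by simp
qed

lemma heavy_sub: "h \<in> heavy \<Longrightarrow> h \<in> H" by (simp add: heavy_def)

lemma agree_sum: "h \<in> H \<Longrightarrow> h' \<in> H \<Longrightarrow> h \<noteq> h' \<Longrightarrow> agree h x + agree h' x \<le> 1"
  unfolding agree_def using agree_sets agree_null \<delta> by (intro window_frac_disjoint) auto

lemma agree_Lipschitz: "h \<in> H \<Longrightarrow> \<bar>agree h x - agree h y\<bar> \<le> \<bar>x - y\<bar> / (2 * \<delta>)"
  unfolding agree_def using agree_sets \<delta> by (intro window_frac_Lipschitz) auto

lemma continuous_agree: "h \<in> H \<Longrightarrow> continuous_on A (agree h)"
  using continuous_window_frac[of \<delta> "{x. h x = f x}" A] agree_sets \<delta> by (simp add: agree_def[abs_def])

lemma agree_measurable: "h \<in> H \<Longrightarrow> agree h \<in> borel_measurable borel"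
  using continuous_agree[of h UNIV] by (rule borel_measurable_continuous_onI)

lemma best_ge: "1/2 \<le> best x" "h \<in> heavy \<Longrightarrow> agree h x \<le> best x"
proof -
  have fin: "finite (insert (1/2) ((\<lambda>h. agree h x) ` heavy))" using finite_heavy by simp
  show "1/2 \<le> best x" "h \<in> heavy \<Longrightarrow> agree h x \<le> best x"
    unfolding best_def by (rule Max_ge[OF fin], simp)+
qed

lemma heavyI:
  assumes h: "h \<in> H" and x: "x \<in> {\<delta>..1 - \<delta>}" and a: "1/2 \<le> agree h x"
  shows "h \<in> heavy"
proof -
  have "\<delta> \<le> measure lborel ({x. h x = f x} \<inter> {x - \<delta><..<x + \<delta>})"
    using a \<delta> by (simp add: agree_def window_frac_def field_simps)
  also have "\<dots> \<le> measure lborel ({x. h x = f x} \<inter> {0<..<1})"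
  proof (rule measure_mono_fmeasurable)
    show "{x. h x = f x} \<inter> {0<..<1} \<in> fmeasurable lborel"
      by (rule fmeasurableI2[of "{0<..<1}"]) (use agree_sets[OF h] in \<open>auto simp: fmeasurable_def\<close>)
  qed (use x agree_sets[OF h] in auto)
  finally show ?thesis using h by (simp add: heavy_def)
qed

lemma agree_le_best:
  assumes "h \<in> H" "x \<in> {\<delta>..1 - \<delta>}"
  shows "agree h x \<le> best x"
  using heavyI[OF assms] best_ge(1)[of x] best_ge(2)[of h x] by fastforce

lemma V_measurable: "V \<in> borel_measurable borel"
proof -
  have [measurable]: "best \<in> borel_measurable borel"
  proof -
    have "best = (\<lambda>x. Max ((\<lambda>o'. case o' of None \<Rightarrow> 1/2 | Some h \<Rightarrow> agree h x) ` (insert None (Some ` heavy))))"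
      by (auto simp: best_def image_image)
    also have "\<dots> \<in> borel_measurable borel"
    proof (rule borel_measurable_Max)
      show "(\<lambda>x. case o' of None \<Rightarrow> 1/2 | Some h \<Rightarrow> agree h x) \<in> borel_measurable borel"
        if "o' \<in> insert None (Some ` heavy)" for o'
        using that agree_measurable heavy_sub by (auto split: option.splits)
    qed (use finite_heavy in auto)
    finally show ?thesis .
  qed
  have "{x. \<exists>h\<in>heavy. agree h x > 1 - \<tau> \<and> h x \<noteq> f x} = (\<Union>h\<in>heavy. {x. agree h x > 1 - \<tau>} - {x. h x = f x})"
    by auto
  also have "\<dots> \<in> sets borel"
  proof (rule sets.finite_UN[OF finite_heavy])
    fix h assume "h \<in> heavy"
    then have h: "h \<in> H" by (rule heavy_sub)
    have [measurable]: "agree h \<in> borel_measurable borel" using agree_measurable[OF h] .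
    have "{x. agree h x > 1 - \<tau>} \<in> sets borel" by measurable
    then show "{x. agree h x > 1 - \<tau>} - {x. h x = f x} \<in> sets borel" using agree_sets[OF h] by auto
  qed
  finally have [measurable]: "Measurable.pred borel (\<lambda>x. \<exists>h\<in>heavy. agree h x > 1 - \<tau> \<and> h x \<noteq> f x)"
    by (simp add: pred_def)
  show ?thesis unfolding V_def[abs_def] by measurable
qed

lemma V_bounds: "0 \<le> V x" "V x \<le> 1"
  using best_ge(1)[of x] \<eta> by (auto simp: V_def)

lemma V_le:
  assumes "V x > 0" "h \<in> H" "h x = f x"
  shows "V x + \<eta> \<le> 1 - agree h x"
proof -
  have x: "x \<in> {\<delta>..1 - \<delta>}" using assms(1) by (auto simp: V_def split: if_splits)
  show ?thesis
  proof (cases "\<exists>h'\<in>heavy. agree h' x > 1 - \<tau> \<and> h' x \<noteq> f x")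
    case True
    then obtain h' where h': "h' \<in> heavy" "agree h' x > 1 - \<tau>" "h' x \<noteq> f x" by auto
    then have "agree h x \<le> \<tau>" using agree_sum[of h h' x] assms heavy_sub by fastforce
    moreover have "V x = 1/4" using x True best_ge(2)[OF h'(1), of x] h'(2) \<tau> \<eta> by (auto simp: V_def)
    ultimately show ?thesis using \<tau> \<eta> by simp
  next
    case False
    then have "V x = max 0 (1 - best x - \<eta>)" using x by (auto simp: V_def)
    then show ?thesis using agree_le_best[OF assms(2) x] assms(1) by auto
  qed
qed

lemma V_ge:
  assumes "x \<in> {\<delta>..1 - \<delta>}"
  shows "V x \<ge> 1 - best x - \<eta>"
  using assms by (auto simp: V_def)

section \<open>The price of a change of label\<close>

lemma best_le_tent:
  assumes h: "h \<in> H" and c: "c \<in> {\<delta>..1 - \<delta>}" "agree h c = 1/2"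
  shows "best x \<le> 1/2 + \<bar>x - c\<bar> / (2 * \<delta>)"
proof -
  have "agree h' x \<le> 1/2 + \<bar>x - c\<bar> / (2 * \<delta>)" if h': "h' \<in> heavy" for h'
  proof -
    have "agree h' c \<le> 1/2" using agree_sum[OF h heavy_sub[OF h'], of c] c by (cases "h = h'") auto
    then show ?thesis using agree_Lipschitz[OF heavy_sub[OF h'], of x c] by linarith
  qed
  then show ?thesis unfolding best_def using finite_heavy \<delta> by auto
qed

text \<open>The tent \<open>1/2 - \<eta> - \<bar>x - c\<bar> / (2 * \<delta>)\<close>, restricted to
  distance \<open>\<delta> * (1 - 2 * \<tau>)\<close> from \<open>c\<close>, has integral
  \<open>cost + 4 * \<delta> * \<tau> * \<eta>\<close>; the nonnegative extra term is given
  away.\<close>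

definition cost :: real where "cost = \<delta> / 2 * (1 - 4 * \<tau>\<^sup>2 - 4 * \<eta>)"

lemma cost_pos: "cost > 0"
proof -
  have "\<tau>\<^sup>2 \<le> (1/16)\<^sup>2" using \<tau> \<eta> by (intro power_mono) auto
  then show ?thesis using \<delta> \<eta> \<tau> by (simp add: cost_def power2_eq_square)
qed

lemma V_integrable: "A \<in> sets borel \<Longrightarrow> integrable lborel (\<lambda>x. V x * indicator A x)"
proof -
  assume A: "A \<in> sets borel"
  note [measurable] = V_measurable A
  show ?thesis
  proof (rule Bochner_Integration.integrable_bound)
    show "integrable lborel (indicator {0..1::real} :: real \<Rightarrow> real)" by (intro integrable_real_indicator) auto
    show "AE x in lborel. norm (V x * indicator A x) \<le> norm (indicator {0..1::real} x :: real)"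
    proof (rule AE_I2)
      fix x
      have "V x = 0" if "x \<notin> {0..1}" using that \<delta> by (auto simp: V_def)
      then show "norm (V x * indicator A x) \<le> norm (indicator {0..1::real} x :: real)"
        using V_bounds[of x] by (auto simp: indicator_def)
    qed
  qed measurable
qed

text \<open>By the intermediate value theorem some \<open>c\<close> between the two points has \<open>agree h c = 1/2\<close>; there no
  hypothesis agrees with \<open>f\<close> on more than half of the window, and the Lipschitz bound spreads this out.\<close>

lemma transition_cost:
  assumes h: "h \<in> H" "h' \<in> H" "h \<noteq> h'" and ab: "a < b" "a \<in> {\<delta>..1 - \<delta>}" "b \<in> {\<delta>..1 - \<delta>}"
    and p: "agree h a > 1 - \<tau>" "agree h' b > 1 - \<tau>"
  shows "cost \<le> (\<integral>x. V x * indicator {a<..b} x \<partial>lborel)"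
proof -
  have "agree h b \<le> 1/2" using agree_sum[OF h, of b] p \<tau> by linarith
  moreover have "1/2 \<le> agree h a" using p \<tau> by linarith
  ultimately obtain c where c: "a \<le> c" "c \<le> b" "agree h c = 1/2"
    using IVT2'[of "agree h" b "1/2" a] continuous_agree[OF h(1)] ab(1) by auto
  have cI: "c \<in> {\<delta>..1 - \<delta>}" using c ab by auto
  \<comment> \<open>At this distance the bound
    \<open>1/2 + \<bar>x - c\<bar> / (2 * \<delta>)\<close> on \<open>best\<close> reaches
    \<open>1 - \<tau>\<close>. The determined points \<open>a\<close> and \<open>b\<close> are
    farther away, so the tent of radius \<open>\<rho>\<close> fits between them.\<close>
  define \<rho> where "\<rho> = \<delta> * (1 - 2 * \<tau>)"
  have \<rho>: "\<rho> > 0" using \<delta> \<tau> by (simp add: \<rho>_def)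
  have far: "\<rho> < \<bar>x - c\<bar>" if x: "best x > 1 - \<tau>" for x
  proof -
    have "1/2 - \<tau> < \<bar>x - c\<bar> / (2 * \<delta>)" using best_le_tent[OF h(1) cI c(3), of x] x by linarith
    then show ?thesis using \<delta> by (simp add: \<rho>_def field_simps)
  qed
  have "\<rho> < \<bar>a - c\<bar>" using p(1) agree_le_best[OF h(1) ab(2)] by (intro far) linarith
  moreover have "\<rho> < \<bar>b - c\<bar>" using p(2) agree_le_best[OF h(2) ab(3)] by (intro far) linarith
  ultimately have in_ab: "a < c - \<rho>" "c + \<rho> < b" using c by auto
  have "cost \<le> 2 * (1/2 - \<eta>) * \<rho> - 1 / (2 * \<delta>) * \<rho>\<^sup>2"
  proof -
    have "2 * (1/2 - \<eta>) * \<rho> - 1 / (2 * \<delta>) * \<rho>\<^sup>2 = \<delta> / 2 * (1 - 4 * \<tau>\<^sup>2 - 4 * \<eta>) + \<delta> * (4 * \<tau> * \<eta>)"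
      using \<delta> by (simp add: \<rho>_def field_simps power2_eq_square)
    then show ?thesis using \<delta> \<eta> by (simp add: cost_def)
  qed
  also have "\<dots> = (\<integral>x. (1/2 - \<eta> - 1 / (2 * \<delta>) * \<bar>x - c\<bar>) * indicator {c - \<rho>..c + \<rho>} x \<partial>lborel)"
    using \<rho> by (subst integral_tent) auto
  also have "\<dots> \<le> (\<integral>x. V x * indicator {a<..b} x \<partial>lborel)"
  proof (rule integral_mono)
    show "integrable lborel (\<lambda>x. (1/2 - \<eta> - 1 / (2 * \<delta>) * \<bar>x - c\<bar>) * indicator {c - \<rho>..c + \<rho>} x)"
      using \<rho> by (intro integral_tent) auto
    show "integrable lborel (\<lambda>x. V x * indicator {a<..b} x)" by (intro V_integrable) auto
    fix x
    show "(1/2 - \<eta> - 1 / (2 * \<delta>) * \<bar>x - c\<bar>) * indicator {c - \<rho>..c + \<rho>} x \<le> V x * indicator {a<..b} x"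
    proof (cases "x \<in> {c - \<rho>..c + \<rho>}")
      case True
      then have "x \<in> {a<..b}" "x \<in> {\<delta>..1 - \<delta>}" using in_ab ab by auto
      then show ?thesis using V_ge[of x] best_le_tent[OF h(1) cI c(3), of x] True by simp
    next
      case False
      then have "indicator {c - \<rho>..c + \<rho>} x = (0 :: real)" by (rule indicator_simps(2))
      then show ?thesis by (simp only: mult_zero_right) (simp add: V_bounds)
    qed
  qed
  finally show ?thesis .
qed

text \<open>Increasing determined points whose consecutive labels differ. Only the length and the
  last point with its label are recorded, which is all that an extension and the cost induction
  refer to.\<close>

inductive chain :: "nat \<Rightarrow> real \<Rightarrow> (real \<Rightarrow> 'y) \<Rightarrow> bool" where
  chain_1: "h \<in> H \<Longrightarrow> x \<in> {\<delta>..1 - \<delta>} \<Longrightarrow> agree h x > 1 - \<tau> \<Longrightarrow> chain 1 x h"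
| chain_Suc: "chain n x h \<Longrightarrow> x < y \<Longrightarrow> h' \<in> H \<Longrightarrow> y \<in> {\<delta>..1 - \<delta>} \<Longrightarrow> agree h' y > 1 - \<tau> \<Longrightarrow> h \<noteq> h' \<Longrightarrow> chain (Suc n) y h'"

lemma chainD: "chain n x h \<Longrightarrow> h \<in> H \<and> x \<in> {\<delta>..1 - \<delta>} \<and> agree h x > 1 - \<tau> \<and> n \<ge> 1"
  by (cases rule: chain.cases) auto

text \<open>The half-open intervals between consecutive points are disjoint, so the prices add up;
  \<open>n\<close> points make \<open>n - 1\<close> changes.\<close>

lemma chain_cost: "chain n x h \<Longrightarrow> (real n - 1) * cost \<le> (\<integral>t. V t * indicator {..x} t \<partial>lborel)"
proof (induction rule: chain.induct)
  case (chain_1 h x)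
  then show ?case using V_bounds by (simp add: integral_nonneg_AE)
next
  case (chain_Suc n x h y h')
  note ch = chainD[OF chain_Suc.hyps(1)]
  have "(real (Suc n) - 1) * cost = (real n - 1) * cost + cost" by (simp add: algebra_simps)
  also have "\<dots> \<le> (\<integral>t. V t * indicator {..x} t \<partial>lborel) + (\<integral>t. V t * indicator {x<..y} t \<partial>lborel)"
    using chain_Suc ch by (intro add_mono transition_cost[of h h']) auto
  also have "\<dots> = (\<integral>t. V t * indicator {..x} t + V t * indicator {x<..y} t \<partial>lborel)"
    by (subst Bochner_Integration.integral_add) (auto intro!: V_integrable)
  also have "\<dots> = (\<integral>t. V t * indicator {..y} t \<partial>lborel)"
    using chain_Suc.hyps(2) by (intro Bochner_Integration.integral_cong) (auto simp: indicator_def)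
  finally show ?case .
qed

section \<open>Rank levels of the determined points\<close>

definition \<mu> :: real where "\<mu> = (\<integral>x. V x \<partial>lborel)"

lemma mu_nonneg: "0 \<le> \<mu>" using V_bounds by (simp add: \<mu>_def integral_nonneg_AE)

lemma mu_uniform01: "(\<integral>x. V x \<partial>uniform01) = \<mu>"
proof -
  have "indicator {0<..<1} x * V x = V x" for x using \<delta> by (auto simp: V_def indicator_def)
  then show ?thesis using integral_uniform01[OF V_measurable] by (simp only: \<mu>_def)
qed

definition nmax :: nat where "nmax = nat \<lfloor>\<mu> / cost\<rfloor> + 1"

lemma nmax_le: "real nmax \<le> \<mu> / cost + 1"
  using mu_nonneg cost_pos by (simp add: nmax_def)

lemma chain_le_nmax: assumes "chain n x h" shows "n \<le> nmax"
proof -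
  have "(\<integral>t. V t * indicator {..x} t \<partial>lborel) \<le> \<mu>"
    unfolding \<mu>_def using V_integrable[of UNIV] V_bounds
    by (intro integral_mono V_integrable) (auto simp: indicator_def)
  then have "(real n - 1) * cost \<le> \<mu>" using chain_cost[OF assms] by linarith
  then have "real n - 1 \<le> \<mu> / cost" using cost_pos by (simp add: field_simps)
  then have "int n - 1 \<le> \<lfloor>\<mu> / cost\<rfloor>" by (simp add: le_floor_iff)
  then show ?thesis unfolding nmax_def by linarith
qed

text \<open>The length of a longest chain ending no later than \<open>x\<close>. It replaces an
  explicit list of breakpoints: it is monotone, bounded through the cost, and 0 before the first
  determined point.\<close>

definition rank :: "real \<Rightarrow> nat" where
  "rank x = Max (insert 0 {n. \<exists>y h. y \<le> x \<and> chain n y h})"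

lemma finite_chain_lengths: "finite (insert 0 {n. \<exists>y h. y \<le> x \<and> chain n y h})"
  by (rule finite_subset[of _ "{..nmax}"]) (auto dest: chain_le_nmax)

lemma rank_ge: "chain n y h \<Longrightarrow> y \<le> x \<Longrightarrow> n \<le> rank x"
  unfolding rank_def using finite_chain_lengths[of x] by (intro Max_ge) auto

lemma rank_le: "rank x \<le> nmax"
  unfolding rank_def using finite_chain_lengths[of x] chain_le_nmax by (subst Max_le_iff) auto

lemma rank_attained: "rank x > 0 \<Longrightarrow> \<exists>y h. y \<le> x \<and> chain (rank x) y h"
  using Max_in[OF finite_chain_lengths[of x]] by (auto simp: rank_def)

lemma mono_rank: "mono rank"
  unfolding rank_def
  by (intro monoI Max_mono finite_chain_lengths) (auto intro: order.trans)

text \<open>A longest chain up to the left point ends at some label \<open>h0\<close>. A determined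
  point of the same rank, not left of it and with another label, would extend this chain and so have
  larger rank. It cannot coincide with the end of the chain, because two hypotheses cannot both
  agree with \<open>f\<close> on more than half of a window.\<close>

lemma rank_label_unique:
  assumes x: "h \<in> H" "x \<in> {\<delta>..1 - \<delta>}" "agree h x > 1 - \<tau>"
    and y: "h' \<in> H" "y \<in> {\<delta>..1 - \<delta>}" "agree h' y > 1 - \<tau>" and r: "rank x = rank y"
  shows "h = h'"
proof -
  have *: "h = h'" if x: "h \<in> H" "x \<in> {\<delta>..1 - \<delta>}" "agree h x > 1 - \<tau>"
    and y: "h' \<in> H" "y \<in> {\<delta>..1 - \<delta>}" "agree h' y > 1 - \<tau>" and r: "rank x = rank y" and xy: "x \<le> y" for x y h h'
  proof -
    have "rank x \<ge> 1" using rank_ge[OF chain_1[OF x], of x] by simp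
    then obtain z h0 where z: "z \<le> x" "chain (rank x) z h0" using rank_attained[of x] by auto
    have eq: "h0 = k" if k: "k \<in> H" "w \<in> {\<delta>..1 - \<delta>}" "agree k w > 1 - \<tau>" "x \<le> w" "rank w = rank x" for k w
    proof (rule ccontr)
      assume ne: "h0 \<noteq> k"
      have "z \<noteq> w"
      proof
        assume "z = w"
        then show False using agree_sum[of h0 k w] chainD[OF z(2)] k ne \<tau> by auto
      qed
      then have "chain (Suc (rank x)) w k" using z k ne by (intro chain_Suc[OF z(2)]) auto
      then show False using rank_ge[of "Suc (rank x)" w k w] k(5) by simp
    qed
    show ?thesis using eq[OF x] eq[OF y] xy r by simp
  qed
  show ?thesis using *[OF x y r] *[OF y x r[symmetric]] by (cases "x \<le> y") auto
qed

text \<open>Three sources of error. Windows leave the unit interval for centres of mass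
  \<open>2 * \<delta>\<close>. Markov's inequality bounds the set where \<open>V\<close> reaches
  \<open>\<tau> - \<eta>\<close>; elsewhere in the interior some hypothesis determines the point and
  equals \<open>f\<close> there, since a mismatch would make \<open>V\<close> at least
  \<open>1/4\<close>. The last term bounds the mass of the levels dropped to get down to
  \<open>k\<close> pieces.\<close>

lemma rounding_close:
  assumes H: "H \<noteq> {}" and k: "k \<ge> 1"
  shows "\<exists>g\<in>piecewise k H. fdist uniform01 f g \<le> 2 * \<delta> + \<mu> / (\<tau> - \<eta>) + max 0 ((\<mu> / cost - (real k - 1)) / real k)"
proof -
  interpret U: prob_space uniform01 by (rule prob_space_uniform01)
  define det where "det h x \<longleftrightarrow> h \<in> H \<and> x \<in> {\<delta>..1 - \<delta>} \<and> agree h x > 1 - \<tau>" for h x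
  \<comment> \<open>Levels without a determined point, such as level 0, receive an arbitrary
    hypothesis, since \<open>piecewise_of_levels\<close> asks for a label everywhere.\<close>
  define lab where "lab j = (if \<exists>h x. det h x \<and> rank x = j then SOME h. \<exists>x. det h x \<and> rank x = j else SOME h. h \<in> H)" for j
  have lab_eq: "lab (rank x) = h" if "det h x" for h x
  proof -
    have "(SOME h'. \<exists>x'. det h' x' \<and> rank x' = rank x) = h"
      by (rule some_equality) (use that rank_label_unique in \<open>auto simp: det_def\<close>)
    then show ?thesis using that by (auto simp: lab_def)
  qed
  have lab_H: "lab j \<in> H" for j
  proof (cases "\<exists>h x. det h x \<and> rank x = j")
    case True
    then obtain h x where "det h x" "rank x = j" by auto
    then show ?thesis using lab_eq[of h x] by (auto simp: det_def)
  next
    case False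
    then show ?thesis using H by (auto simp: lab_def some_in_eq)
  qed
  have rank_meas: "{x. rank x \<in> B} \<in> sets borel" for B
  proof -
    have "(\<lambda>x. real (rank x)) \<in> borel_measurable borel"
      by (rule borel_measurable_mono) (use mono_rank in \<open>auto simp: mono_def\<close>)
    moreover have "real ` B \<in> sets borel"
      by (rule sets.countable[OF _ countable_image[OF countableI_type]]) simp
    ultimately have "(\<lambda>x. real (rank x)) -` (real ` B) \<inter> space borel \<in> sets borel"
      by (rule measurable_sets)
    moreover have "(\<lambda>x. real (rank x)) -` (real ` B) \<inter> space borel = {x. rank x \<in> B}" by auto
    ultimately show ?thesis by simp
  qed
  define w where "w j = measure uniform01 {x. rank x = j}" for j
  have w_sum: "sum w B = measure uniform01 {x. rank x \<in> B}" if "finite B" for B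
  proof -
    have "measure uniform01 (\<Union>j\<in>B. {x. rank x = j}) = sum w B"
      unfolding w_def using rank_meas[of "{_}"] that
      by (intro U.finite_measure_finite_Union) (auto simp: disjoint_family_on_def)
    moreover have "(\<Union>j\<in>B. {x. rank x = j}) = {x. rank x \<in> B}" by auto
    ultimately show ?thesis by simp
  qed
  \<comment> \<open>Keeping the \<open>k\<close> heaviest of \<open>nmax > k\<close> levels loses at
    most the fraction \<open>(nmax - k) / nmax\<close>, which is relaxed to the denominator
    \<open>k\<close>; \<open>nmax_le\<close> turns the numerator into
    \<open>\<mu> / cost - (k - 1)\<close>.\<close>
  have "\<exists>S\<subseteq>{1..nmax}. card S \<le> k \<and> sum w ({1..nmax} - S) \<le> max 0 ((\<mu> / cost - (real k - 1)) / real k)"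
  proof (cases "nmax \<le> k")
    case True
    then show ?thesis by (intro exI[of _ "{1..nmax}"]) auto
  next
    case False
    then have nk: "k \<le> card {1..nmax}" "0 < k" using k by auto
    obtain S where S: "S \<subseteq> {1..nmax}" "card S = k" "real k * sum w {1..nmax} \<le> real nmax * sum w S"
      using exists_heavy_subset[of "{1..nmax}" k w] nk by auto
    have w1: "sum w {1..nmax} \<le> 1" by (simp add: w_sum)
    have w0: "sum w ({1..nmax} - S) \<ge> 0" by (intro sum_nonneg) (simp add: w_def)
    have "sum w ({1..nmax} - S) = sum w {1..nmax} - sum w S" using S by (intro sum_diff) auto
    then have "real nmax * sum w ({1..nmax} - S) \<le> (real nmax - real k) * sum w {1..nmax}"
      using S(3) by (simp only: right_diff_distrib left_diff_distrib)
    also have "\<dots> \<le> (real nmax - real k) * 1" using w1 False by (intro mult_left_mono) auto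
    finally have "real nmax * sum w ({1..nmax} - S) \<le> real nmax - real k" by simp
    moreover have "real k * sum w ({1..nmax} - S) \<le> real nmax * sum w ({1..nmax} - S)"
      using False w0 by (intro mult_right_mono) auto
    ultimately have "real k * sum w ({1..nmax} - S) \<le> \<mu> / cost - (real k - 1)" using nmax_le by linarith
    then have "sum w ({1..nmax} - S) \<le> (\<mu> / cost - (real k - 1)) / real k" using nk(2) by (simp add: field_simps)
    then show ?thesis using S by (intro exI[of _ S]) auto
  qed
  then obtain S where S: "S \<subseteq> {1..nmax}" "card S \<le> k"
    "sum w ({1..nmax} - S) \<le> max 0 ((\<mu> / cost - (real k - 1)) / real k)" by auto
  have finS: "finite S" using S(1) finite_subset by blast
  obtain g F where g: "g \<in> piecewise k H" and F: "finite F"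
    and gF: "\<And>x. 0 < x \<Longrightarrow> x < 1 \<Longrightarrow> x \<notin> F \<Longrightarrow> rank x \<in> S \<Longrightarrow> g x = lab (rank x) x"
    using piecewise_of_levels[of rank S k lab H, OF mono_rank finS S(2) k lab_H] by blast
  define Y0 where "Y0 = - {\<delta>..1 - \<delta>}"
  define Y1 where "Y1 = {x. V x \<ge> \<tau> - \<eta>}"
  define Y2 where "Y2 = {x. rank x \<in> {1..nmax} - S}"
  note [measurable] = V_measurable
  have Ym: "Y0 \<in> sets borel" "Y1 \<in> sets borel" "Y2 \<in> sets borel" "F \<in> sets borel"
    using rank_meas[of "{1..nmax} - S"] F unfolding Y0_def Y1_def Y2_def
    by (simp_all add: finite_imp_closed borel_closed)
  have sub: "{x \<in> space uniform01. f x \<noteq> g x} \<subseteq> ((Y0 \<union> Y1) \<union> Y2) \<union> F"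
  proof (rule subsetI, rule ccontr)
    fix x assume fg: "x \<in> {x \<in> space uniform01. f x \<noteq> g x}" and nx: "x \<notin> ((Y0 \<union> Y1) \<union> Y2) \<union> F"
    then have x: "x \<in> {\<delta>..1 - \<delta>}" and V: "V x < \<tau> - \<eta>" by (auto simp: Y0_def Y1_def)
    have "best x > 1 - \<tau>" using V_ge[OF x] V by linarith
    moreover have "best x \<in> insert (1/2) ((\<lambda>h. agree h x) ` heavy)"
      unfolding best_def using finite_heavy by (intro Max_in) auto
    ultimately obtain h where h: "h \<in> heavy" "agree h x > 1 - \<tau>" using \<tau> by auto
    have "h x = f x"
    proof (rule ccontr)
      assume "h x \<noteq> f x"
      then have "\<exists>h\<in>heavy. agree h x > 1 - \<tau> \<and> h x \<noteq> f x" using h by blast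
      then have "V x = max (max 0 (1 - best x - \<eta>)) (1/4)" unfolding V_def using x by simp
      then have "V x \<ge> 1/4" by simp
      then show False using V \<tau> \<eta> by linarith
    qed
    moreover have d: "det h x" using h x heavy_sub by (simp add: det_def)
    moreover have "rank x \<ge> 1" using d rank_ge[OF chain_1, of h x x] by (auto simp: det_def)
    ultimately show False
      using nx rank_le[of x] gF[of x] lab_eq[OF d] x \<delta> fg by (auto simp: Y2_def)
  qed
  have "fdist uniform01 f g \<le> measure uniform01 (((Y0 \<union> Y1) \<union> Y2) \<union> F)"
    unfolding fdist_def using sub Ym by (intro U.finite_measure_mono) auto
  also have "\<dots> \<le> measure uniform01 Y0 + measure uniform01 Y1 + measure uniform01 Y2 + measure uniform01 F"
    using Ym by (intro order.trans[OF measure_Un_le] add_mono order.refl) auto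
  also have "measure uniform01 Y0 = 2 * \<delta>"
  proof -
    have "measure uniform01 {\<delta>..1 - \<delta>} = 1 - 2 * \<delta>"
    proof -
      have "{\<delta>..1 - \<delta>} \<inter> {0<..<1} = {\<delta>..1 - \<delta>}" using \<delta> by auto
      then show ?thesis using \<delta> by (subst measure_uniform01) auto
    qed
    then show ?thesis using U.prob_compl[of "{\<delta>..1 - \<delta>}"] by (simp add: Y0_def Compl_eq_Diff_UNIV)
  qed
  also have "measure uniform01 Y1 \<le> \<mu> / (\<tau> - \<eta>)"
  proof -
    have "integrable uniform01 V"
      using V_bounds by (intro U.integrable_const_bound[where B=1]) auto
    then have "measure uniform01 {x \<in> space uniform01. V x \<ge> \<tau> - \<eta>} \<le> (\<integral>x. V x \<partial>uniform01) / (\<tau> - \<eta>)"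
      using V_bounds \<eta> by (intro integral_Markov_inequality_measure[where A="{}"]) auto
    then show ?thesis by (simp add: Y1_def mu_uniform01)
  qed
  also have "measure uniform01 Y2 \<le> max 0 ((\<mu> / cost - (real k - 1)) / real k)"
    using S(3) by (simp add: Y2_def w_sum)
  also have "measure uniform01 F = 0"
  proof -
    have "F \<inter> {0<..<1} \<in> null_sets lborel" using F by (intro finite_imp_null_set_lborel) auto
    then show ?thesis unfolding measure_uniform01[OF Ym(4)] by (rule measure_eq_0_null_sets)
  qed
  finally show ?thesis using g by (intro bexI[of _ g]) auto
qed

end

section \<open>Noise sensitivity of near and far targets\<close>

lemma parameter_bounds:
  fixes \<epsilon> :: real
  assumes eps: "0 < \<epsilon>" "\<epsilon> < 1/2" and k: "real k \<ge> 80 / \<epsilon>"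
  shows "real k > 160" "80 \<le> real k * \<epsilon>" "0 < radius \<epsilon> k" "radius \<epsilon> k < 1/2"
    "real k * radius \<epsilon> k = \<epsilon>\<^sup>2 / 32" "2 * radius \<epsilon> k \<le> \<epsilon> / 1000"
proof -
  have "160 < 80 / \<epsilon>" using eps by (simp add: field_simps)
  then show k160: "real k > 160" using k by linarith
  show ke: "80 \<le> real k * \<epsilon>" using k eps by (simp add: field_simps)
  show pos: "0 < radius \<epsilon> k" using eps k160 by (simp add: radius_def)
  show "real k * radius \<epsilon> k = \<epsilon>\<^sup>2 / 32" using k160 by (simp add: radius_def)
  have "\<epsilon>\<^sup>2 \<le> \<epsilon> * (1/2)" using eps by (simp add: power2_eq_square)
  then have "\<epsilon>\<^sup>2 / (32 * real k) \<le> (\<epsilon> * (1/2)) / (32 * 160)"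
    using k160 eps by (intro frac_le) auto
  then show "2 * radius \<epsilon> k \<le> \<epsilon> / 1000" using eps by (simp add: radius_def)
  then show "radius \<epsilon> k < 1/2" using eps by linarith
qed

text \<open>Contraposition of \<open>rounding_close\<close> with
  \<open>\<tau> = \<epsilon> / 8\<close> and \<open>\<eta> = \<epsilon> / 128\<close>: a smaller
  mean would give a distance of at most
  \<open>\<epsilon> / 1000 + 3 / 20 * \<epsilon> + \<epsilon> / 2\<close>. The margin
  \<open>\<epsilon> / 4\<close>, twice that of the acceptance threshold, leaves room for
  sampling.\<close>

lemma far_target_sensitivity:
  fixes H :: "(real \<Rightarrow> 'y) set"
  assumes H: "H \<noteq> {}" and Sm: "\<And>h. h \<in> H \<Longrightarrow> {x. h x = f x} \<in> sets borel" and zc: "zero_measure_crossings H"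
    and eps: "0 < \<epsilon>" "\<epsilon> < 1/2" and k: "real k \<ge> 80 / \<epsilon>" and \<delta>: "\<delta> = radius \<epsilon> k"
    and far: "dist_class uniform01 f (piecewise k H) \<ge> \<epsilon>"
  shows "\<exists>V\<in>borel_measurable borel. (\<forall>x. 0 \<le> V x \<and> V x \<le> 1) \<and>
     (\<forall>x. V x > 0 \<longrightarrow> x \<in> {\<delta>..1 - \<delta>} \<and> (\<forall>h\<in>H. h x = f x \<longrightarrow> V x + \<epsilon> / 128 \<le> 1 - window_frac \<delta> {x. h x = f x} x)) \<and>
     (real k - 1) * (\<delta> / 2) * (1 + \<epsilon> / 4) < (\<integral>x. V x \<partial>uniform01)"
proof -
  note par = parameter_bounds[OF eps k, folded \<delta>]
  interpret rounding H f \<delta> "\<epsilon> / 8" "\<epsilon> / 128"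
  proof
    show "{x. h x = f x} \<in> sets borel" if "h \<in> H" for h using Sm that .
    fix h h' assume h: "h \<in> H" "h' \<in> H" "h \<noteq> h'"
    have "{x. h x = h' x} \<in> null_sets lebesgue" using zc h unfolding zero_measure_crossings_def by blast
    then have "{x. h x = f x} \<inter> {x. h' x = f x} \<in> null_sets lebesgue"
      by (rule null_sets_subset) (use Sm h in auto)
    then show "{x. h x = f x} \<inter> {x. h' x = f x} \<in> null_sets lborel"
      using Sm[OF h(1)] Sm[OF h(2)] by (subst (asm) null_sets_completion_iff) auto
  qed (use par eps in auto)
  have "(real k - 1) * (\<delta> / 2) * (1 + \<epsilon> / 4) < \<mu>"
  proof (rule ccontr)
    assume "\<not> ?thesis"
    then have mu: "\<mu> \<le> (real k - 1) * (\<delta> / 2) * (1 + \<epsilon> / 4)" by simp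
    have k1: "k \<ge> 1" using par(1) by linarith
    obtain g where g: "g \<in> piecewise k H"
      "fdist uniform01 f g \<le> 2 * \<delta> + \<mu> / (\<epsilon> / 8 - \<epsilon> / 128) + max 0 ((\<mu> / cost - (real k - 1)) / real k)"
      using rounding_close[OF H k1] by blast
    have "\<epsilon> \<le> fdist uniform01 f g"
    proof -
      have "dist_class uniform01 f (piecewise k H) \<le> fdist uniform01 f g"
        unfolding dist_class_def using g(1)
        by (intro cINF_lower bdd_belowI[of _ 0]) (auto simp: fdist_def)
      then show ?thesis using far by simp
    qed
    moreover have "\<mu> / (\<epsilon> / 8 - \<epsilon> / 128) \<le> 3 / 20 * \<epsilon>"
    proof -
      have "\<mu> \<le> (real k * (\<delta> / 2)) * (9/8)"
        by (rule order.trans[OF mu]) (use par eps in \<open>intro mult_mono, auto\<close>)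
      also have "\<dots> = (real k * \<delta>) * (9/16)" by simp
      also have "\<dots> = 9/512 * \<epsilon>\<^sup>2" unfolding par(5) by simp
      finally show ?thesis using eps by (simp add: field_simps power2_eq_square)
    qed
    moreover have "max 0 ((\<mu> / cost - (real k - 1)) / real k) \<le> \<epsilon> / 2"
    proof -
      have "\<epsilon>\<^sup>2 \<le> \<epsilon> * (1/2)" using eps by (simp add: power2_eq_square)
      \<comment> \<open>The relative loss in \<open>cost\<close> is
        \<open>\<epsilon>\<^sup>2 / 16 + \<epsilon> / 32\<close>, and
        \<open>\<epsilon> < 1/2\<close> bounds the first term by \<open>\<epsilon> / 32\<close> as
        well.\<close>
      then have c: "1 - \<epsilon> / 16 \<le> 1 - 4 * (\<epsilon> / 8)\<^sup>2 - 4 * (\<epsilon> / 128)"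
        by (simp add: power_divide)
      have "1 + \<epsilon> / 4 \<le> (1 + \<epsilon> / 2) * (1 - \<epsilon> / 16)"
      proof -
        have "(1 + \<epsilon> / 2) * (1 - \<epsilon> / 16) = 1 + 7/16 * \<epsilon> - \<epsilon>\<^sup>2 / 32" by (simp add: power2_eq_square field_simps)
        then show ?thesis using \<open>\<epsilon>\<^sup>2 \<le> \<epsilon> * (1/2)\<close> eps by linarith
      qed
      also have "\<dots> \<le> (1 + \<epsilon> / 2) * (1 - 4 * (\<epsilon> / 8)\<^sup>2 - 4 * (\<epsilon> / 128))"
        using c eps by (intro mult_left_mono) auto
      finally have c2: "1 + \<epsilon> / 4 \<le> (1 + \<epsilon> / 2) * (1 - 4 * (\<epsilon> / 8)\<^sup>2 - 4 * (\<epsilon> / 128))" .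
      have "\<mu> \<le> (real k - 1) * (\<delta> / 2) * ((1 + \<epsilon> / 2) * (1 - 4 * (\<epsilon> / 8)\<^sup>2 - 4 * (\<epsilon> / 128)))"
        by (rule order.trans[OF mu]) (use c2 par in \<open>intro mult_left_mono, auto\<close>)
      also have "\<dots> = ((real k - 1) * (1 + \<epsilon> / 2)) * cost" by (simp add: cost_def mult_ac)
      finally have "\<mu> / cost \<le> (real k - 1) * (1 + \<epsilon> / 2)" using cost_pos by (simp add: pos_divide_le_eq)
      moreover have "(real k - 1) * (1 + \<epsilon> / 2) = (real k - 1) + (real k - 1) * (\<epsilon> / 2)"
        by (simp add: distrib_left)
      ultimately have "\<mu> / cost - (real k - 1) \<le> (real k - 1) * (\<epsilon> / 2)" by linarith
      also have "\<dots> \<le> real k * (\<epsilon> / 2)" using eps by (intro mult_right_mono) auto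
      finally have "(\<mu> / cost - (real k - 1)) / real k \<le> \<epsilon> / 2"
        using par(1) by (simp add: pos_divide_le_eq mult.commute)
      then show ?thesis by (rule max.boundedI[rotated]) (use eps in simp)
    qed
    ultimately show False using g(2) par(6) eps by linarith
  qed
  then show ?thesis
    using V_measurable V_bounds V_le mu_uniform01
    by (intro bexI[of _ V]) (auto simp: agree_def V_def split: if_splits)
qed

text \<open>\<open>U\<close> dominates the estimate. A breakpoint \<open>s j\<close> near
  \<open>x\<close> cuts off at most \<open>\<delta> - \<bar>x - s j\<bar>\<close> of the window, and
  these losses add even if a window contains many breakpoints; each such tent integrates to
  \<open>\<delta> / 2\<close>. The accuracy \<open>\<eta>\<close> is added on the supports of the
  tents only: away from them the window lies in one piece and the first alternative, exact
  agreement, applies. Outside \<open>{\<delta>..1 - \<delta>}\<close> the trivial bound 1 is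
  paid.\<close>

lemma near_target_sensitivity:
  fixes H :: "(real \<Rightarrow> 'y) set"
  assumes f: "f \<in> piecewise k H" and Sm: "\<And>h. h \<in> H \<Longrightarrow> {x. h x = f x} \<in> sets borel"
    and \<delta>: "0 < \<delta>" "\<delta> < 1/2" and \<eta>: "0 < \<eta>" and k: "k \<ge> 1"
  shows "\<exists>U\<in>borel_measurable borel. (\<forall>x. 0 \<le> U x \<and> U x \<le> 1) \<and>
     (\<forall>x. U x < 1 \<longrightarrow> x \<in> {\<delta>..1 - \<delta>} \<and> (\<exists>h\<in>H. h x = f x \<and>
        ((\<forall>y\<in>{x - \<delta><..<x + \<delta>}. h y = f y) \<or> 1 - window_frac \<delta> {x. h x = f x} x + \<eta> \<le> U x))) \<and>
     (\<integral>x. U x \<partial>uniform01) \<le> (real k - 1) * (\<delta> / 2 + 2 * \<delta> * \<eta>) + 2 * \<delta>"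
proof -
  interpret P: prob_space uniform01 by (rule prob_space_uniform01)
  obtain t h where t: "t 0 = -\<infinity>" "t k = \<infinity>" "\<And>i. i \<in> {1..<k} \<Longrightarrow> t i \<in> range ereal" "mono_on {0..k} t"
    and h: "\<And>i. i \<in> {1..k} \<Longrightarrow> h i \<in> H"
    and fh: "\<And>x i. i \<in> {1..k} \<Longrightarrow> t (i - 1) < ereal x \<Longrightarrow> ereal x \<le> t i \<Longrightarrow> f x = h i x"
    using f unfolding piecewise_def by blast
  define s where "s j = real_of_ereal (t j)" for j
  have ts: "t j = ereal (s j)" if "j \<in> {1..<k}" for j using t(3)[OF that] by (cases "t j") (auto simp: s_def)
  define tent where "tent j x = (1/2 + \<eta> - 1 / (2 * \<delta>) * \<bar>x - s j\<bar>) * indicator {s j - \<delta>..s j + \<delta>} x" for j x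
  define U where "U x = min 1 ((\<Sum>j\<in>{1..<k}. tent j x) + indicator (- {\<delta>..1 - \<delta>}) x)" for x
  have tent_ge: "tent j x = max 0 (\<delta> - \<bar>x - s j\<bar>) / (2 * \<delta>) + \<eta> * indicator {s j - \<delta>..s j + \<delta>} x" for j x
  proof (cases "x \<in> {s j - \<delta>..s j + \<delta>}")
    case True
    then have "max 0 (\<delta> - \<bar>x - s j\<bar>) = \<delta> - \<bar>x - s j\<bar>" by auto
    then show ?thesis using True \<delta> by (simp add: tent_def field_simps)
  next
    case False
    then have "max 0 (\<delta> - \<bar>x - s j\<bar>) = 0" by auto
    moreover have "indicator {s j - \<delta>..s j + \<delta>} x = (0 :: real)" using False by (rule indicator_simps(2))
    ultimately show ?thesis by (simp add: tent_def)
  qed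
  have tent_nonneg: "0 \<le> tent j x" for j x unfolding tent_ge using \<delta> \<eta> by simp
  have Um[measurable]: "U \<in> borel_measurable borel" unfolding U_def[abs_def] tent_def[abs_def] by measurable
  have U01: "0 \<le> U x \<and> U x \<le> 1" for x using tent_nonneg by (auto simp: U_def intro!: add_nonneg_nonneg sum_nonneg)
  have key: "x \<in> {\<delta>..1 - \<delta>} \<and> (\<exists>h\<in>H. h x = f x \<and>
        ((\<forall>y\<in>{x - \<delta><..<x + \<delta>}. h y = f y) \<or> 1 - window_frac \<delta> {x. h x = f x} x + \<eta> \<le> U x))" if Ux: "U x < 1" for x
  proof -
    have "(\<Sum>j\<in>{1..<k}. tent j x) \<ge> 0" by (intro sum_nonneg tent_nonneg)
    moreover have "indicator (- {\<delta>..1 - \<delta>}) x = (1 :: real)" if "x \<notin> {\<delta>..1 - \<delta>}"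
      using that by (intro indicator_simps(1)) simp
    ultimately have xI: "x \<in> {\<delta>..1 - \<delta>}" using Ux unfolding U_def by fastforce
    define i where "i = (LEAST i. ereal x \<le> t i)"
    have xi: "ereal x \<le> t i" unfolding i_def by (rule LeastI[of _ k]) (simp add: t)
    have ik: "i \<le> k" unfolding i_def by (rule Least_le) (simp add: t)
    have i0: "i \<noteq> 0" using xi t(1) by (auto intro: ccontr)
    have xi1: "t (i - 1) < ereal x" using not_less_Least[of "i - 1" "\<lambda>i. ereal x \<le> t i"] i0 by (auto simp: i_def[symmetric])
    have i: "i \<in> {1..k}" using ik i0 by auto
    have hi: "h i \<in> H" "h i x = f x" using h[OF i] fh[OF i xi1 xi] by auto
    \<comment> \<open>The part of the window that the breakpoint \<open>s j\<close> can separate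
      from \<open>x\<close>; a reversed, hence empty, interval when the breakpoint is too far
      away.\<close>
    define B where "B j = (if s j < x then {x - \<delta>..s j} else {s j..x + \<delta>})" for j
    have dis: "\<exists>j\<in>{1..<k}. y \<in> B j" if y: "y \<in> {x - \<delta><..<x + \<delta>}" "h i y \<noteq> f y" for y
    proof -
      have "\<not> (t (i - 1) < ereal y \<and> ereal y \<le> t i)" using fh[OF i] y(2) by metis
      then consider "ereal y \<le> t (i - 1)" | "t i < ereal y" by force
      then show ?thesis
      proof cases
        case 1
        then have "i - 1 \<noteq> 0" using t(1) by (auto intro: ccontr)
        then have j: "i - 1 \<in> {1..<k}" using ik by auto
        then have "s (i - 1) < x" "y \<le> s (i - 1)" using 1 xi1 ts[OF j] by auto
        then show ?thesis using y by (intro bexI[OF _ j]) (auto simp: B_def)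
      next
        case 2
        then have "i \<noteq> k" using t(2) by auto
        then have j: "i \<in> {1..<k}" using i by auto
        then have "x \<le> s i" "s i < y" using 2 xi ts[OF j] by auto
        then show ?thesis using y by (intro bexI[OF _ j]) (auto simp: B_def)
      qed
    qed
    show ?thesis
    proof (cases "\<forall>y\<in>{x - \<delta><..<x + \<delta>}. h i y = f y")
      case True
      then show ?thesis using hi xI by blast
    next
      case False
      then obtain y j0 where y: "y \<in> {x - \<delta><..<x + \<delta>}" "j0 \<in> {1..<k}" "y \<in> B j0" using dis by blast
      then have j0: "x \<in> {s j0 - \<delta>..s j0 + \<delta>}" by (auto simp: B_def split: if_splits)
      let ?w = "{x - \<delta><..<x + \<delta>}" and ?A = "{x. h i x = f x}"
      have Bm: "B j \<in> fmeasurable lborel" "measure lborel (B j) = max 0 (\<delta> - \<bar>x - s j\<bar>)" for j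
        by (auto simp: B_def fmeasurable_def measure_def emeasure_lborel_Icc_eq)
      have Aw: "?A \<inter> ?w \<in> fmeasurable lborel"
        by (rule fmeasurableI2[of ?w]) (use Sm[OF hi(1)] \<delta> in \<open>auto simp: fmeasurable_def\<close>)
      have "2 * \<delta> = measure lborel ?w" using \<delta> by simp
      also have "\<dots> \<le> measure lborel ((?A \<inter> ?w) \<union> (\<Union>j\<in>{1..<k}. B j))"
      proof (rule measure_mono_fmeasurable)
        show "?w \<subseteq> (?A \<inter> ?w) \<union> (\<Union>j\<in>{1..<k}. B j)" using dis by blast
        show "(?A \<inter> ?w) \<union> (\<Union>j\<in>{1..<k}. B j) \<in> fmeasurable lborel"
          using Aw Bm(1) by (intro fmeasurable.Un fmeasurable.finite_UN) auto
      qed simp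
      also have "\<dots> \<le> measure lborel (?A \<inter> ?w) + measure lborel (\<Union>j\<in>{1..<k}. B j)"
        using Aw Bm by (intro measure_Un_le sets.finite_UN) (auto simp: fmeasurable_def)
      also have "measure lborel (\<Union>j\<in>{1..<k}. B j) \<le> (\<Sum>j\<in>{1..<k}. measure lborel (B j))"
        using Bm by (intro measure_UNION_le) (auto simp: fmeasurable_def)
      finally have "2 * \<delta> \<le> measure lborel (?A \<inter> ?w) + (\<Sum>j\<in>{1..<k}. max 0 (\<delta> - \<bar>x - s j\<bar>))"
        by (simp add: Bm)
      then have "2 * \<delta> / (2 * \<delta>) \<le> (measure lborel (?A \<inter> ?w) + (\<Sum>j\<in>{1..<k}. max 0 (\<delta> - \<bar>x - s j\<bar>))) / (2 * \<delta>)"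
        using \<delta> by (intro divide_right_mono) auto
      then have "1 - window_frac \<delta> ?A x \<le> (\<Sum>j\<in>{1..<k}. max 0 (\<delta> - \<bar>x - s j\<bar>) / (2 * \<delta>))"
        using \<delta> by (simp add: window_frac_def add_divide_distrib sum_divide_distrib)
      moreover have "(\<Sum>j\<in>{1..<k}. \<eta> * indicator {s j - \<delta>..s j + \<delta>} x) \<ge> \<eta>"
      proof -
        have "\<eta> = (\<Sum>j\<in>{j0}. \<eta> * indicator {s j - \<delta>..s j + \<delta>} x)" using j0 by simp
        also have "\<dots> \<le> (\<Sum>j\<in>{1..<k}. \<eta> * indicator {s j - \<delta>..s j + \<delta>} x)"
          using y(2) \<eta> by (intro sum_mono2) auto
        finally show ?thesis .
      qed
      ultimately have "1 - window_frac \<delta> ?A x + \<eta> \<le> (\<Sum>j\<in>{1..<k}. tent j x)"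
        by (simp add: tent_ge sum.distrib)
      also have "\<dots> = U x" using Ux xI by (auto simp: U_def)
      finally show ?thesis using hi xI by blast
    qed
  qed
  have "(\<integral>x. U x \<partial>uniform01) \<le> (\<integral>x. (\<Sum>j\<in>{1..<k}. tent j x) + indicator (- {\<delta>..1 - \<delta>}) x \<partial>uniform01)"
    and "(\<integral>x. (\<Sum>j\<in>{1..<k}. tent j x) + indicator (- {\<delta>..1 - \<delta>}) x \<partial>uniform01) \<le> (real k - 1) * (\<delta> / 2 + 2 * \<delta> * \<eta>) + 2 * \<delta>"
  proof -
    have tm[measurable]: "tent j \<in> borel_measurable borel" for j unfolding tent_def[abs_def] by measurable
    have ti: "integrable uniform01 (tent j)" for j
    proof (rule P.integrable_const_bound[where B="1/2 + \<eta>"])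
      show "AE x in uniform01. norm (tent j x) \<le> 1/2 + \<eta>"
      proof (rule AE_I2)
        fix x
        have "tent j x \<le> 1/2 + \<eta>" using \<delta> \<eta> by (auto simp: tent_def indicator_def)
        then show "norm (tent j x) \<le> 1/2 + \<eta>" using tent_nonneg[of j x] by simp
      qed
    qed simp
    have tj: "(\<integral>x. tent j x \<partial>uniform01) \<le> \<delta> / 2 + 2 * \<delta> * \<eta>" for j
    proof -
      have il: "integrable lborel (tent j)" "(\<integral>x. tent j x \<partial>lborel) = 2 * (1/2 + \<eta>) * \<delta> - 1 / (2 * \<delta>) * \<delta>\<^sup>2"
        unfolding tent_def[abs_def] using \<delta> by (intro integral_tent less_imp_le; simp)+
      have "(\<integral>x. tent j x \<partial>uniform01) = (\<integral>x. indicator {0<..<1} x * tent j x \<partial>lborel)"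
        by (rule integral_uniform01) simp
      also have "\<dots> \<le> (\<integral>x. tent j x \<partial>lborel)"
      proof (rule integral_mono[OF _ il(1)])
        show "integrable lborel (\<lambda>x. indicator {0<..<1} x * tent j x)"
          by (rule Bochner_Integration.integrable_bound[OF il(1)]) (auto simp: indicator_def)
        show "indicator {0<..<1} x * tent j x \<le> tent j x" for x using tent_nonneg by (auto simp: indicator_def)
      qed
      also have "\<dots> = \<delta> / 2 + 2 * \<delta> * \<eta>" unfolding il(2) using \<delta> by (simp add: field_simps power2_eq_square)
      finally show ?thesis .
    qed
    have ii: "integrable uniform01 (indicator (- {\<delta>..1 - \<delta>}) :: real \<Rightarrow> real)"
      by (intro integrable_real_indicator) (auto simp: P.emeasure_eq_measure)
    have ind: "(\<integral>x. indicator (- {\<delta>..1 - \<delta>}) x \<partial>uniform01) = 2 * \<delta>"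
    proof -
      have "{\<delta>..1 - \<delta>} \<inter> {0<..<1} = {\<delta>..1 - \<delta>}" using \<delta> by auto
      then have "measure uniform01 {\<delta>..1 - \<delta>} = 1 - 2 * \<delta>" using \<delta> by (subst measure_uniform01) auto
      then show ?thesis using P.prob_compl[of "{\<delta>..1 - \<delta>}"] by (simp add: Compl_eq_Diff_UNIV)
    qed
    have Ui: "integrable uniform01 U"
      using U01 by (intro P.integrable_const_bound[where B=1]) auto
    show "(\<integral>x. U x \<partial>uniform01) \<le> (\<integral>x. (\<Sum>j\<in>{1..<k}. tent j x) + indicator (- {\<delta>..1 - \<delta>}) x \<partial>uniform01)"
      using Ui ii ti by (intro integral_mono) (auto simp: U_def)
    have "(\<integral>x. (\<Sum>j\<in>{1..<k}. tent j x) + indicator (- {\<delta>..1 - \<delta>}) x \<partial>uniform01)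
       = (\<Sum>j\<in>{1..<k}. (\<integral>x. tent j x \<partial>uniform01)) + 2 * \<delta>"
      using ti by (subst Bochner_Integration.integral_add[OF Bochner_Integration.integrable_sum ii])
        (simp_all only: ind Bochner_Integration.integral_sum)
    also have "\<dots> \<le> (\<Sum>j\<in>{1..<k}. \<delta> / 2 + 2 * \<delta> * \<eta>) + 2 * \<delta>" by (intro add_mono sum_mono tj order.refl)
    also have "\<dots> = (real k - 1) * (\<delta> / 2 + 2 * \<delta> * \<eta>) + 2 * \<delta>" using k by (simp add: of_nat_diff)
    finally show "(\<integral>x. (\<Sum>j\<in>{1..<k}. tent j x) + indicator (- {\<delta>..1 - \<delta>}) x \<partial>uniform01) \<le> (real k - 1) * (\<delta> / 2 + 2 * \<delta> * \<eta>) + 2 * \<delta>" .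
  qed
  then show ?thesis using U01 key Um by (intro bexI[of _ U]) auto
qed

section \<open>The procedure on a fixed sample\<close>

lemma run_query_all: "run (query_all ns lab D) labs = D (\<lambda>n. if n \<in> set ns then labs n else lab n)"
proof (induction ns arbitrary: lab)
  case (Cons n ns)
  have "(\<lambda>a. if a \<in> set ns then labs a else (lab(n := labs n)) a) = (\<lambda>a. if a \<in> set (n # ns) then labs a else lab a)"
    by auto
  then show ?case using Cons by simp
qed simp

lemma query_bounded_query_all: "set ns \<subseteq> I \<Longrightarrow> length ns \<le> q \<Longrightarrow> query_bounded (query_all ns lab D) I q"
proof (induction ns arbitrary: lab q)
  case (Cons n ns)
  then show ?case by (cases q) auto
qed simp

text \<open>The counting clause pins the recursion down: up to the \<open>j\<close>-th neighbour
  exactly \<open>j\<close> hits have occurred. For \<open>j = 0\<close> the index is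
  \<open>m\<close>, which is no hit among the later points, hence the guarded last clause.\<close>

lemma neighbour_exists:
  assumes "j \<le> card {t \<in> {m + 1..s}. x t \<in> {x i - \<delta><..<x i + \<delta>}}"
  shows "\<exists>t. neighbour m s \<delta> x i j = Some t \<and> card {u \<in> {m + 1..s}. u \<le> t \<and> x u \<in> {x i - \<delta><..<x i + \<delta>}} = j \<and>
     m \<le> t \<and> (j > 0 \<longrightarrow> t \<in> {m + 1..s} \<and> x t \<in> {x i - \<delta><..<x i + \<delta>})"
  using assms
proof (induction j)
  case 0
  have e: "{u \<in> {m + 1..s}. u \<le> m \<and> x u \<in> {x i - \<delta><..<x i + \<delta>}} = {}" by auto
  show ?case by (intro exI[of _ m]) (simp only: e neighbour.simps card.empty less_irrefl simp_thms le_refl)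
next
  case (Suc j)
  let ?hit = "\<lambda>u. u \<in> {m + 1..s} \<and> x u \<in> {x i - \<delta><..<x i + \<delta>}"
  let ?below = "\<lambda>t. {u \<in> {m + 1..s}. u \<le> t \<and> x u \<in> {x i - \<delta><..<x i + \<delta>}}"
  obtain t where t: "neighbour m s \<delta> x i j = Some t" "card (?below t) = j" "m \<le> t" using Suc by auto
  define T where "T = {u \<in> {t + 1..s}. x u \<in> {x i - \<delta><..<x i + \<delta>}}"
  have finT: "finite T" by (simp add: T_def)
  have "T \<noteq> {}"
  proof
    assume "T = {}"
    then have "{u \<in> {m + 1..s}. x u \<in> {x i - \<delta><..<x i + \<delta>}} \<subseteq> ?below t" by (auto simp: T_def not_less_eq_eq)
    then have "card {u \<in> {m + 1..s}. x u \<in> {x i - \<delta><..<x i + \<delta>}} \<le> card (?below t)" by (intro card_mono) auto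
    then show False using Suc.prems t(2) by simp
  qed
  then have Min: "Min T \<in> T" and Min_le: "\<And>u. u \<in> T \<Longrightarrow> Min T \<le> u" using finT by auto
  have "?below (Min T) = insert (Min T) (?below t)"
  proof (intro set_eqI iffI)
    fix u assume u: "u \<in> ?below (Min T)"
    show "u \<in> insert (Min T) (?below t)"
    proof (cases "u \<le> t")
      case False
      then have "u \<in> T" using u by (simp add: T_def)
      then show ?thesis using Min_le u by fastforce
    qed (use u in simp)
  next
    fix u assume "u \<in> insert (Min T) (?below t)"
    then show "u \<in> ?below (Min T)" using Min t(3) unfolding T_def by (elim insertE) simp_all
  qed
  moreover have "Min T \<notin> ?below t" using Min by (auto simp: T_def)
  ultimately have "card (?below (Min T)) = Suc j" using t(2) by simp
  moreover have "neighbour m s \<delta> x i (Suc j) = Some (Min T)"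
    using t(1) \<open>T \<noteq> {}\<close> by (simp add: T_def Let_def)
  moreover have "m \<le> Min T" "?hit (Min T)" using Min t(3) by (auto simp: T_def)
  ultimately show ?case by (intro exI[of _ "Min T"] conjI impI) auto
qed

text \<open>Translates the recursive stopping times into the \<open>first_hits\<close> formulation,
  for which \<open>measure_first_hits_le\<close> provides the conditional i.i.d. behaviour.\<close>

lemma neighbours_first_hits:
  assumes l: "0 < l" "l \<le> card {t \<in> {m + 1..s}. x t \<in> {x i - \<delta><..<x i + \<delta>}}"
  defines "t \<equiv> \<lambda>j. the (neighbour m s \<delta> x i j)"
  shows "\<forall>j\<in>{1..l}. neighbour m s \<delta> x i j \<noteq> None" "inj_on t {1..l}" "t ` {1..l} \<subseteq> {m + 1..s}"
    "first_hits {x i - \<delta><..<x i + \<delta>} {m + 1..s} (t ` {1..l}) x"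
proof -
  let ?W = "{x i - \<delta><..<x i + \<delta>}" and ?J = "{m + 1..s}"
  define below where "below n = {u \<in> ?J. u \<le> n \<and> x u \<in> ?W}" for n
  have fb: "finite (below n)" for n by (simp add: below_def)
  have ex: "neighbour m s \<delta> x i j = Some (t j)" "card (below (t j)) = j" "t j \<in> ?J" "x (t j) \<in> ?W" if j: "j \<in> {1..l}" for j
  proof -
    have "j \<le> card {t \<in> ?J. x t \<in> ?W}" using j l(2) by simp
    from neighbour_exists[OF this] obtain n where n: "neighbour m s \<delta> x i j = Some n" "card (below n) = j"
      "n \<in> ?J" "x n \<in> ?W" using j unfolding below_def by auto
    moreover have "t j = n" using n(1) by (simp add: t_def)
    ultimately show "neighbour m s \<delta> x i j = Some (t j)" "card (below (t j)) = j" "t j \<in> ?J" "x (t j) \<in> ?W" by auto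
  qed
  show "\<forall>j\<in>{1..l}. neighbour m s \<delta> x i j \<noteq> None" using ex(1) by simp
  show inj: "inj_on t {1..l}" by (rule inj_onI) (metis ex(2))
  show "t ` {1..l} \<subseteq> ?J" using ex(3) by blast
  have le: "t j \<le> t l" if j: "j \<in> {1..l}" for j
  proof (rule ccontr)
    assume "\<not> t j \<le> t l"
    then have "insert (t j) (below (t l)) \<subseteq> below (t j)" "t j \<notin> below (t l)"
      using ex(3,4)[OF j] by (auto simp: below_def)
    then have "Suc (card (below (t l))) \<le> card (below (t j))"
      using card_mono[OF fb, of "insert (t j) (below (t l))" "t j"] fb by simp
    then show False using ex(2)[OF j] ex(2)[of l] j l(1) by simp
  qed
  have "t ` {1..l} = below (t l)"
  proof (rule card_subset_eq[OF fb])
    show "t ` {1..l} \<subseteq> below (t l)" using ex(3,4) le by (auto simp: below_def)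
    show "card (t ` {1..l}) = card (below (t l))" using inj ex(2)[of l] l(1) by (simp add: card_image)
  qed
  moreover have "Max (below (t l)) = t l"
    using ex(3,4)[of l] l(1) by (intro Max_eqI fb) (auto simp: below_def)
  ultimately show "first_hits ?W ?J (t ` {1..l}) x"
    unfolding first_hits_def by (auto simp: below_def)
qed

lemma NS_hat_at_value:
  assumes l: "0 < l" and inj: "inj_on (t i) {1..l}" and lab: "\<And>j. j \<in> {1..l} \<Longrightarrow> lab (t i j) = f (x (t i j))"
  shows "1 / real l * (\<Sum>j=1..l. of_bool (h (x (t i j)) \<noteq> lab (t i j))) = 1 - emp_freq (t i ` {1..l}) {y. h y = f y} x"
proof -
  have "(\<Sum>j=1..l. of_bool (h (x (t i j)) \<noteq> lab (t i j)) :: real) = (\<Sum>j=1..l. 1 - of_bool (h (x (t i j)) = f (x (t i j))))"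
    using lab by (intro sum.cong) auto
  also have "\<dots> = real l - (\<Sum>j=1..l. of_bool (h (x (t i j)) = f (x (t i j))))" by (simp add: sum_subtractf)
  also have "(\<Sum>j=1..l. of_bool (h (x (t i j)) = f (x (t i j))) :: real) = (\<Sum>u\<in>t i ` {1..l}. of_bool (h (x u) = f (x u)))"
    by (subst sum.reindex[OF inj]) (simp only: comp_def)
  also have "\<dots> = real (card {u \<in> t i ` {1..l}. x u \<in> {y. h y = f y}})"
    by (simp add: of_bool_def sum.If_cases Int_def)
  finally have "(\<Sum>j=1..l. of_bool (h (x (t i j)) \<noteq> lab (t i j)) :: real)
     = real l - real (card {u \<in> t i ` {1..l}. x u \<in> {y. h y = f y}})" .
  moreover have "card (t i ` {1..l}) = l" using inj by (simp add: card_image)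
  ultimately show ?thesis using l by (simp add: emp_freq_def diff_divide_distrib)
qed

lemma finite_NS_values:
  "finite ((\<lambda>h. 1 / real l * (\<Sum>j=1..l. of_bool (h (x (t i j)) \<noteq> lab (t i j)))) ` A)"
proof (rule finite_subset)
  show "(\<lambda>h. 1 / real l * (\<Sum>j=1..l. of_bool (h (x (t i j)) \<noteq> lab (t i j)))) ` A \<subseteq> (\<lambda>n. 1 / real l * real n) ` {0..l}"
  proof (rule image_subsetI)
    fix h
    have "(\<Sum>j=1..l. of_bool (h (x (t i j)) \<noteq> lab (t i j)) :: real) = real (card {j \<in> {1..l}. h (x (t i j)) \<noteq> lab (t i j)})"
      by (simp add: of_bool_def sum.If_cases Int_def)
    moreover have "card {j \<in> {1..l}. h (x (t i j)) \<noteq> lab (t i j)} \<le> l"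
    proof -
      have "card {j \<in> {1..l}. h (x (t i j)) \<noteq> lab (t i j)} \<le> card {1..l}" by (intro card_mono) auto
      then show ?thesis by simp
    qed
    ultimately show "1 / real l * (\<Sum>j=1..l. of_bool (h (x (t i j)) \<noteq> lab (t i j))) \<in> (\<lambda>n. 1 / real l * real n) ` {0..l}"
      by (intro image_eqI[of _ _ "card {j \<in> {1..l}. h (x (t i j)) \<noteq> lab (t i j)}"]) auto
  qed
qed simp

lemma NS_hat_at_le:
  assumes l: "0 < l" and inj: "inj_on (t i) {1..l}" and lab: "\<And>j. j \<in> {1..l} \<Longrightarrow> lab (t i j) = f (x (t i j))"
    and labi: "lab i = f (x i)" and h: "h \<in> H" "h (x i) = f (x i)"
  shows "NS_hat_at H l t x lab i \<le> 1 - emp_freq (t i ` {1..l}) {y. h y = f y} x"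
proof -
  have hc: "h \<in> consistent H (x i) (lab i)" using h labi by (simp add: consistent_def)
  then have ne: "consistent H (x i) (lab i) \<noteq> {}" by blast
  have "NS_hat_at H l t x lab i \<le> 1 / real l * (\<Sum>j=1..l. of_bool (h (x (t i j)) \<noteq> lab (t i j)))"
    unfolding NS_hat_at_def if_not_P[OF ne] by (intro Min_le finite_NS_values imageI hc)
  then show ?thesis using NS_hat_at_value[where t=t and i=i and lab=lab and f=f and x=x, OF l inj lab] by simp
qed

text \<open>The bound \<open>v \<le> 1\<close> handles the default value 1 of a label that no
  hypothesis attains.\<close>

lemma NS_hat_at_ge:
  assumes l: "0 < l" and inj: "inj_on (t i) {1..l}" and lab: "\<And>j. j \<in> {1..l} \<Longrightarrow> lab (t i j) = f (x (t i j))"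
    and labi: "lab i = f (x i)" and v: "v \<le> 1"
    and h: "\<And>h. h \<in> H \<Longrightarrow> h (x i) = f (x i) \<Longrightarrow> v \<le> 1 - emp_freq (t i ` {1..l}) {y. h y = f y} x"
  shows "v \<le> NS_hat_at H l t x lab i"
proof (cases "consistent H (x i) (lab i) = {}")
  case True
  then show ?thesis using v by (simp add: NS_hat_at_def)
next
  case False
  have "v \<le> 1 / real l * (\<Sum>j=1..l. of_bool (h (x (t i j)) \<noteq> lab (t i j)))" if "h \<in> consistent H (x i) (lab i)" for h
    using assms(6)[of h] that labi NS_hat_at_value[where t=t and i=i and lab=lab and f=f and x=x and h=h, OF l inj lab]
    by (simp add: consistent_def)
  then show ?thesis unfolding NS_hat_at_def if_not_P[OF False]
    by (intro Min.boundedI finite_NS_values) (use False in \<open>blast+\<close>)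
qed

lemma emp_freq_bounds: "finite T \<Longrightarrow> 0 \<le> emp_freq T g x \<and> emp_freq T g x \<le> 1"
proof -
  assume "finite T"
  then have "card {t \<in> T. x t \<in> g} \<le> card T" by (intro card_mono) auto
  then show ?thesis by (cases "card T = 0") (auto simp: emp_freq_def)
qed

lemma NS_hat_at_le_1:
  assumes l: "0 < l" and inj: "inj_on (t i) {1..l}" and lab: "\<And>j. j \<in> {1..l} \<Longrightarrow> lab (t i j) = f (x (t i j))"
    and labi: "lab i = f (x i)"
  shows "NS_hat_at H l t x lab i \<le> 1"
proof (cases "consistent H (x i) (lab i) = {}")
  case False
  then obtain h where h: "h \<in> H" "h (x i) = f (x i)" using labi by (auto simp: consistent_def)
  have "NS_hat_at H l t x lab i \<le> 1 - emp_freq (t i ` {1..l}) {y. h y = f y} x"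
    by (rule NS_hat_at_le[where t=t and i=i and lab=lab and f=f and x=x, OF l inj lab labi h])
  then show ?thesis using emp_freq_bounds[of "t i ` {1..l}" "{y. h y = f y}" x] by simp
qed (simp add: NS_hat_at_def)

lemma run_NS_procedure:
  assumes m: "m > 0" and ex: "\<forall>i\<in>{1..m}. \<forall>j\<in>{1..l}. neighbour m s \<delta> x i j \<noteq> None"
  defines "t \<equiv> \<lambda>i j. the (neighbour m s \<delta> x i j)"
  shows "\<exists>lab. (\<forall>i\<in>{1..m}. lab i = f (x i) \<and> (\<forall>j\<in>{1..l}. lab (t i j) = f (x (t i j)))) \<and>
     (run (NS_procedure H k \<epsilon> m l \<delta> s fallback \<omega> x) (\<lambda>n. f (x n)) \<longleftrightarrow>
       (\<Sum>i=1..m. NS_hat_at H l t x lab i) \<le> real m * ((real k - 1) * (\<delta> / 2) * (1 + \<epsilon> / 8)))"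
proof -
  define ns where "ns = concat (map (\<lambda>i. i # map (t i) [1..<l + 1]) [1..<m + 1])"
  let ?lab = "\<lambda>n. if n \<in> set ns then f (x n) else undefined"
  have "set ns = (\<Union>i\<in>{1..m}. insert i (t i ` {1..l}))"
    by (simp add: ns_def atLeastLessThanSuc_atLeastAtMost del: upt_Suc)
  then have mem: "i \<in> set ns" "j \<in> {1..l} \<Longrightarrow> t i j \<in> set ns" if "i \<in> {1..m}" for i j using that by blast+
  have "run (NS_procedure H k \<epsilon> m l \<delta> s fallback \<omega> x) (\<lambda>n. f (x n)) \<longleftrightarrow>
      NS_hat H m l t x ?lab \<le> (real k - 1) * (\<delta> / 2) * (1 + \<epsilon> / 8)"
    unfolding NS_procedure_def if_P[OF ex] Let_def run_query_all t_def ns_def ..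
  also have "\<dots> \<longleftrightarrow> (\<Sum>i=1..m. NS_hat_at H l t x ?lab i) \<le> real m * ((real k - 1) * (\<delta> / 2) * (1 + \<epsilon> / 8))"
    using m unfolding NS_hat_def by (simp add: pos_divide_le_eq mult.commute)
  finally show ?thesis using mem by (intro exI[of _ ?lab] conjI ballI) simp_all
qed

lemma query_bounded_NS_procedure:
  assumes fb: "query_bounded (fallback \<omega> x) {1..s} (m * (l + 1))" and ms: "m \<le> s"
  shows "query_bounded (NS_procedure H k \<epsilon> m l \<delta> s fallback \<omega> x) {1..s} (m * (l + 1))"
proof (cases "\<forall>i\<in>{1..m}. \<forall>j\<in>{1..l}. neighbour m s \<delta> x i j \<noteq> None")
  case True
  let ?t = "\<lambda>i j. the (neighbour m s \<delta> x i j)"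
  define ns where "ns = concat (map (\<lambda>i. i # map (?t i) [1..<l + 1]) [1..<m + 1])"
  have nb: "n \<in> {1..s}" if nbh: "neighbour m s \<delta> x i j = Some n" "j > 0" for i j n
  proof -
    obtain j' where j': "j = Suc j'" using nbh(2) gr0_implies_Suc by blast
    obtain t' where "neighbour m s \<delta> x i j' = Some t'" using nbh j' by (auto split: option.splits)
    then have n: "n = Min {t \<in> {t' + 1..s}. x t \<in> {x i - \<delta><..<x i + \<delta>}}" "{t \<in> {t' + 1..s}. x t \<in> {x i - \<delta><..<x i + \<delta>}} \<noteq> {}"
      using nbh j' by (auto simp: Let_def split: if_splits)
    then have "n \<in> {t \<in> {t' + 1..s}. x t \<in> {x i - \<delta><..<x i + \<delta>}}" unfolding n(1) by (intro Min_in) auto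
    then show ?thesis by simp
  qed
  have "length ns = m * (l + 1)" by (simp add: ns_def length_concat comp_def sum_list_triv)
  moreover have "set ns \<subseteq> {1..s}"
  proof
    fix n assume "n \<in> set ns"
    moreover have "set ns = (\<Union>i\<in>{1..m}. insert i (?t i ` {1..l}))"
      by (simp add: ns_def atLeastLessThanSuc_atLeastAtMost del: upt_Suc)
    ultimately obtain i where i: "i \<in> {1..m}" "n = i \<or> (\<exists>j\<in>{1..l}. n = ?t i j)" by blast
    have "?t i j \<in> {1..s}" if j: "j \<in> {1..l}" for j
    proof -
      obtain n where "neighbour m s \<delta> x i j = Some n" using True i(1) j by blast
      then show ?thesis using nb[of i j n] j by simp
    qed
    then show "n \<in> {1..s}" using i ms by auto
  qed
  ultimately show ?thesis unfolding NS_procedure_def if_P[OF True] Let_def ns_def[symmetric]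
    by (intro query_bounded_query_all) auto
next
  case False
  show ?thesis unfolding NS_procedure_def if_not_P[OF False] by (rule fb)
qed

section \<open>Good samples\<close>

text \<open>Agreement sets are the traces of the graphs of \<open>H\<close> on the graph of
  \<open>f\<close>, and \<open>x \<mapsto> (x, f x)\<close> is injective, so a shattered set of
  points lifts to an equally large shattered set of pairs.\<close>

lemma vc_agreement_sets:
  assumes gd: "graph_dim H = enat d" and A: "finite A" "shatters ((\<lambda>h. {x. h x = f x}) ` H) A"
  shows "card A \<le> d"
proof -
  let ?A = "(\<lambda>x. (x, f x)) ` A" and ?C = "(\<lambda>h. {(x, h x) |x. True}) ` H"
  have "shatters ?C ?A" unfolding shatters_def
  proof (intro allI impI)
    fix B assume B: "B \<subseteq> ?A"
    have "{x \<in> A. (x, f x) \<in> B} \<subseteq> A" by simp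
    from A(2)[unfolded shatters_def, rule_format, OF this]
    obtain S where S: "S \<in> (\<lambda>h. {x. h x = f x}) ` H" "S \<inter> A = {x \<in> A. (x, f x) \<in> B}" by (elim bexE)
    from S(1) obtain h where h: "h \<in> H" "S = {x. h x = f x}" by (elim imageE)
    have "{(x, h x) |x. True} \<inter> ?A = B"
    proof (intro set_eqI iffI)
      fix p assume "p \<in> {(x, h x) |x. True} \<inter> ?A"
      then obtain x where x: "x \<in> A" "p = (x, f x)" "h x = f x" by auto
      then have "x \<in> S \<inter> A" by (simp add: h(2))
      then show "p \<in> B" unfolding S(2) x(2) by simp
    next
      fix p assume p: "p \<in> B"
      then obtain x where x: "x \<in> A" "p = (x, f x)" using B by auto
      then have "x \<in> S \<inter> A" unfolding S(2) using p by simp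
      then have "h x = f x" by (simp add: h(2))
      then show "p \<in> {(x, h x) |x. True} \<inter> ?A" using x by auto
    qed
    then show "\<exists>S\<in>?C. S \<inter> ?A = B" using h(1) by (intro bexI[of _ "{(x, h x) |x. True}"] imageI)
  qed
  then have "enat (card ?A) \<le> vc_dim ?C"
    unfolding vc_dim_def using A(1) by (intro SUP_upper) auto
  moreover have "card ?A = card A" by (intro card_image) (auto simp: inj_on_def)
  ultimately show ?thesis using gd by (simp add: graph_dim_def)
qed

text \<open>Windows around points near an end lose at most half of their mass. Hit counts can
  therefore be controlled at every centre, with mass \<open>\<delta>\<close>, while frequencies are
  normalized by \<open>2 * \<delta>\<close> in the interior.\<close>

lemma window_uniform01:
  assumes "0 < \<delta>" "\<delta> < 1/2"
  shows "y \<in> {\<delta>..1 - \<delta>} \<Longrightarrow> measure uniform01 {y - \<delta><..<y + \<delta>} = 2 * \<delta>"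
    and "y \<in> {\<delta>..1 - \<delta>} \<Longrightarrow> g \<in> sets borel \<Longrightarrow>
      measure uniform01 ({y - \<delta><..<y + \<delta>} \<inter> g) / measure uniform01 {y - \<delta><..<y + \<delta>} = window_frac \<delta> g y"
    and "y \<in> {0<..<1} \<Longrightarrow> \<delta> \<le> measure uniform01 {y - \<delta><..<y + \<delta>}"
proof -
  let ?w = "{y - \<delta><..<y + \<delta>}"
  show *: "measure uniform01 ?w = 2 * \<delta>" if "y \<in> {\<delta>..1 - \<delta>}"
  proof -
    have "measure uniform01 ?w = measure lborel (?w \<inter> {0<..<1})" by (rule measure_uniform01) simp
    also have "?w \<inter> {0<..<1} = ?w" using that by auto
    also have "measure lborel ?w = 2 * \<delta>" using assms by simp
    finally show ?thesis .
  qed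
  show "measure uniform01 (?w \<inter> g) / measure uniform01 ?w = window_frac \<delta> g y" if y: "y \<in> {\<delta>..1 - \<delta>}" and g: "g \<in> sets borel"
  proof -
    have "?w \<inter> g \<inter> {0<..<1} = g \<inter> ?w" using y by auto
    then have "measure uniform01 (?w \<inter> g) = measure lborel (g \<inter> ?w)" using g by (subst measure_uniform01) auto
    then show ?thesis unfolding *[OF y] window_frac_def by simp
  qed
  show "\<delta> \<le> measure uniform01 ?w" if y: "y \<in> {0<..<1}"
  proof -
    have "?w \<inter> {0<..<1} = {max 0 (y - \<delta>)<..<min 1 (y + \<delta>)}" by auto
    then have "measure uniform01 ?w = measure lborel {max 0 (y - \<delta>)<..<min 1 (y + \<delta>)}"
      by (subst measure_uniform01) auto
    also have "\<dots> = min 1 (y + \<delta>) - max 0 (y - \<delta>)" using y assms by (intro measure_lborel_Ioo) auto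
    finally show ?thesis using y assms by auto
  qed
qed

text \<open>Two things can fail at a centre: too few hits (\<open>\<Phi>1\<close>) or a large
  deviation on the first \<open>l\<close> hits (\<open>\<Phi>2\<close>). Each has total probability
  at most \<open>1/12\<close> by a union bound over the centres, which all share one pool of later
  points and so are treated one at a time. Frequencies are compared with \<open>window_frac\<close>
  only for centres whose window lies inside the unit interval.\<close>

lemma good_event:
  fixes H :: "(real \<Rightarrow> 'y) set" and f :: "real \<Rightarrow> 'y"
  assumes gd: "graph_dim H = enat d" and Sm: "\<And>h. h \<in> H \<Longrightarrow> {x. h x = f x} \<in> sets borel"
    and meas: "\<And>(n::nat) S. S \<subseteq> {..<n} \<Longrightarrow> {x \<in> space (iid {..<n} uniform01). \<exists>h\<in>H. \<forall>i<n. h (x i) = f (x i) \<longleftrightarrow> i \<in> S}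
          \<in> sets (completion (iid {..<n} uniform01))"
    and \<delta>: "0 < \<delta>" "\<delta> < 1/2" and l: "0 < l" and ms: "m \<le> s" and \<eta>: "0 < \<eta>" "8 \<le> real l * \<eta>\<^sup>2"
    and x0: "0 < x0" "x0 \<le> 1"
    and hits: "real l \<le> real (s - m) * \<delta> / 2" "real m * exp (- (real (s - m) * \<delta> / 8)) \<le> 1/12"
    and unif: "real m * (2 * sym_bound d l (\<eta> / 2 * real l) x0) \<le> 1/12"
  shows "\<exists>E\<in>sets (iid {1..s} uniform01). measure (iid {1..s} uniform01) E \<ge> 5/6 \<and>
     (\<forall>x\<in>E. \<forall>i\<in>{1..m}. l \<le> card {t \<in> {m + 1..s}. x t \<in> {x i - \<delta><..<x i + \<delta>}} \<and>
        (x i \<in> {\<delta>..1 - \<delta>} \<longrightarrow> (\<forall>T. T \<subseteq> {m + 1..s} \<longrightarrow> card T = l \<longrightarrow> first_hits {x i - \<delta><..<x i + \<delta>} {m + 1..s} T x \<longrightarrow>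
           (\<forall>h\<in>H. \<bar>emp_freq T {x. h x = f x} x - window_frac \<delta> {x. h x = f x} (x i)\<bar> \<le> \<eta>))))"
proof -
  let ?P = "uniform01" and ?J = "{m + 1..s}"
  define W where "W y = {y - \<delta><..<y + \<delta>}" for y :: real
  define G where "G = (\<lambda>h. {x. h x = f x}) ` H"
  define \<beta> where "\<beta> = 2 * sym_bound d l (\<eta> / 2 * real l) x0"
  let ?M = "iid {1..s} ?P" and ?MJ = "iid ?J ?P"
  have P: "prob_space ?P" by (rule prob_space_uniform01)
  interpret P: prob_space ?P by (rule P)
  interpret M: prob_space ?M by (intro prob_space_PiM P)
  interpret MJ: prob_space ?MJ by (intro prob_space_PiM P)
  have sP[measurable_cong]: "sets ?P = sets borel" by simp
  have \<beta>0: "0 \<le> \<beta>" by (simp add: \<beta>_def sym_bound_def)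
  have Wm[measurable]: "W y \<in> sets borel" for y by (simp add: W_def)
  have \<Omega>: "{(y, t). t \<in> W y} \<in> sets (borel \<Otimes>\<^sub>M borel)"
  proof -
    have "{(y, t). t \<in> W y} = {p \<in> space (borel \<Otimes>\<^sub>M borel). fst p - \<delta> < snd p \<and> snd p < fst p + \<delta>}"
      by (auto simp: W_def space_pair_measure)
    also have "\<dots> \<in> sets (borel \<Otimes>\<^sub>M borel)" by measurable
    finally show ?thesis .
  qed
  have vc: "card A \<le> d" if "finite A" "shatters G A" for A
    using vc_agreement_sets[OF gd that[unfolded G_def]] .
  have measG: "{x \<in> space (iid {..<n} ?P). \<exists>g\<in>G. \<forall>i<n. x i \<in> g \<longleftrightarrow> i \<in> S} \<in> sets (completion (iid {..<n} ?P))"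
    if "S \<subseteq> {..<n}" for S and n :: nat
    using meas[OF that] by (simp add: G_def)
  have GB: "G \<subseteq> sets borel" using Sm by (auto simp: G_def)
  obtain C where C[measurable]: "C \<in> sets (borel \<Otimes>\<^sub>M iid {..<l} ?P)"
    and C1: "\<And>y z g. measure ?P (W y) > 0 \<Longrightarrow> z \<in> cube {..<l} (W y) \<Longrightarrow> g \<in> G \<Longrightarrow>
        \<bar>emp_freq {..<l} g z - measure ?P (W y \<inter> g) / measure ?P (W y)\<bar> > \<eta> \<Longrightarrow> (y, z) \<in> C"
    and C2: "\<And>y. measure ?P (W y) > 0 \<Longrightarrow>
       measure (iid {..<l} ?P) ({z \<in> space (iid {..<l} ?P). (y, z) \<in> C} \<inter> cube {..<l} (W y)) \<le> \<beta> * measure ?P (W y) ^ l"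
    using uniform_convergence_cover[OF P sP \<Omega> GB vc measG l \<eta> x0] unfolding \<beta>_def by blast
  define \<T> where "\<T> = {T. T \<subseteq> ?J \<and> card T = l}"
  have fin\<T>: "finite \<T>" by (rule finite_subset[of _ "Pow ?J"]) (auto simp: \<T>_def)
  have fT: "finite T" "T \<subseteq> ?J" "card T = l" if "T \<in> \<T>" for T using that finite_subset by (auto simp: \<T>_def)
  have "\<exists>b. bij_betw b {..<l} T" if "T \<in> \<T>" for T
    using ex_bij_betw_nat_finite[OF fT(1)[OF that]] fT(3)[OF that] by (simp add: lessThan_atLeast0)
  then obtain b where b: "\<And>T. T \<in> \<T> \<Longrightarrow> bij_betw (b T) {..<l} T" by metis
  have bT: "b T j \<in> T" if "T \<in> \<T>" "j < l" for T j using bij_betwE[OF b[OF that(1)]] that(2) by auto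
  \<comment> \<open>Renumbers \<open>T\<close> as \<open>{..<l}\<close>, so that the one cover
    \<open>C\<close> serves every \<open>T\<close>. The bijection \<open>b T\<close> is arbitrary
    because frequencies ignore the order.\<close>
  define re where "re T x = (\<lambda>j\<in>{..<l}. x (b T j))" for T and x :: "nat \<Rightarrow> real"
  have re_meas: "re T \<in> iid K ?P \<rightarrow>\<^sub>M iid {..<l} ?P" if T: "T \<in> \<T>" "T \<subseteq> K" for T K
    unfolding re_def[abs_def] using bT[OF T(1)] T(2)
    by (intro measurable_restrict measurable_component_singleton) auto
  have re_distr: "distr (iid T ?P) (iid {..<l} ?P) (re T) = iid {..<l} ?P" if T: "T \<in> \<T>" for T
    unfolding re_def[abs_def] using b[OF T] P by (intro distr_PiM_reindex) (auto simp: bij_betw_def)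
  have re_freq: "emp_freq {..<l} g (re T x) = emp_freq T g x" if T: "T \<in> \<T>" for T g x
  proof -
    have "bij_betw (b T) {j \<in> {..<l}. re T x j \<in> g} {t \<in> T. x t \<in> g}"
      using b[OF T] by (auto simp: bij_betw_def inj_on_def re_def image_iff)
    then have "card {j \<in> {..<l}. re T x j \<in> g} = card {t \<in> T. x t \<in> g}" by (rule bij_betw_same_card)
    then show ?thesis using fT[OF T] by (simp add: emp_freq_def)
  qed
  have reW: "re T x \<in> cube {..<l} (W y) \<longleftrightarrow> (\<forall>t\<in>T. x t \<in> W y)" if T: "T \<in> \<T>" for T x y
  proof -
    have "b T ` {..<l} = T" using b[OF T] by (simp add: bij_betw_def)
    moreover have "(\<forall>t\<in>b T ` {..<l}. x t \<in> W y) \<longleftrightarrow> re T x \<in> cube {..<l} (W y)"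
      by (auto simp: re_def PiE_iff)
    ultimately show ?thesis by simp
  qed
  define \<Phi>1 where "\<Phi>1 = {q \<in> space (?P \<Otimes>\<^sub>M ?MJ). card {t \<in> ?J. snd q t \<in> W (fst q)} < l}"
  define \<Phi>2 where "\<Phi>2 = (\<Union>T\<in>\<T>. {q \<in> space (?P \<Otimes>\<^sub>M ?MJ). fst q \<in> {\<delta>..1 - \<delta>} \<and> first_hits (W (fst q)) ?J T (snd q) \<and> (fst q, re T (snd q)) \<in> C})"
  have hit_meas: "Measurable.pred (?P \<Otimes>\<^sub>M ?MJ) (\<lambda>q. snd q t \<in> W (fst q))" if "t \<in> ?J" for t
  proof -
    have "(\<lambda>q. snd q t) \<in> ?P \<Otimes>\<^sub>M ?MJ \<rightarrow>\<^sub>M ?P"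
      by (rule measurable_compose[OF measurable_snd measurable_component_singleton[OF that]])
    then have [measurable]: "(\<lambda>q. snd q t) \<in> ?P \<Otimes>\<^sub>M ?MJ \<rightarrow>\<^sub>M borel"
      by (subst (asm) measurable_cong_sets[OF refl sP])
    show ?thesis unfolding W_def greaterThanLessThan_iff by measurable
  qed
  have \<Phi>1m: "\<Phi>1 \<in> sets (?P \<Otimes>\<^sub>M ?MJ)"
  proof -
    have "real (card {t \<in> ?J. snd q t \<in> W (fst q)}) = (\<Sum>t\<in>?J. if snd q t \<in> W (fst q) then 1 else 0)" for q :: "real \<times> (nat \<Rightarrow> real)"
      by (simp add: sum.If_cases Int_def)
    then have "\<Phi>1 = {q \<in> space (?P \<Otimes>\<^sub>M ?MJ). (\<Sum>t\<in>?J. if snd q t \<in> W (fst q) then 1 else 0) < real l}"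
      unfolding \<Phi>1_def by (metis (no_types, lifting) of_nat_less_iff)
    moreover have [measurable]: "(\<lambda>q. \<Sum>t\<in>?J. if snd q t \<in> W (fst q) then 1 else 0 :: real) \<in> borel_measurable (?P \<Otimes>\<^sub>M ?MJ)"
      using hit_meas by (intro borel_measurable_sum measurable_If) (auto simp: pred_def)
    have "{q \<in> space (?P \<Otimes>\<^sub>M ?MJ). (\<Sum>t\<in>?J. if snd q t \<in> W (fst q) then 1 else 0) < real l} \<in> sets (?P \<Otimes>\<^sub>M ?MJ)"
      by measurable
    ultimately show ?thesis by (simp only:)
  qed
  have \<Phi>2m: "\<Phi>2 \<in> sets (?P \<Otimes>\<^sub>M ?MJ)"
    unfolding \<Phi>2_def
  proof (rule sets.finite_UN[OF fin\<T>])
    fix T assume T: "T \<in> \<T>"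
    note [measurable] = re_meas[OF T fT(2)[OF T]]
    have "Measurable.pred (?P \<Otimes>\<^sub>M ?MJ) (\<lambda>q. first_hits (W (fst q)) ?J T (snd q))"
      unfolding first_hits_def using fT[OF T] hit_meas
      by (intro pred_intros_logic pred_intros_finite) auto
    then show "{q \<in> space (?P \<Otimes>\<^sub>M ?MJ). fst q \<in> {\<delta>..1 - \<delta>} \<and> first_hits (W (fst q)) ?J T (snd q) \<and> (fst q, re T (snd q)) \<in> C} \<in> sets (?P \<Otimes>\<^sub>M ?MJ)"
      by measurable
  qed
  have b1: "AE y in ?P. measure ?MJ {x \<in> space ?MJ. (y, x) \<in> \<Phi>1} \<le> exp (- (real (s - m) * \<delta> / 8))"
  proof -
    have "AE y in ?P. y \<in> {0<..<1}" by (rule AE_uniform_measureI) auto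
    then show ?thesis
    proof eventually_elim
      fix y :: real assume y: "y \<in> {0<..<1}"
      have "{x \<in> space ?MJ. (y, x) \<in> \<Phi>1} = {x \<in> space ?MJ. card {t \<in> ?J. x t \<in> W y} < l}"
        by (auto simp: \<Phi>1_def space_pair_measure)
      then show "measure ?MJ {x \<in> space ?MJ. (y, x) \<in> \<Phi>1} \<le> exp (- (real (s - m) * \<delta> / 8))"
        using few_hits_bound[OF P, of "W y" \<delta> ?J l] window_uniform01(3)[OF \<delta> y] \<delta> hits(1) by (simp add: W_def)
    qed
  qed
  have b2: "measure ?MJ {x \<in> space ?MJ. (y, x) \<in> \<Phi>2} \<le> \<beta>" for y
  proof (cases "y \<in> {\<delta>..1 - \<delta>}")
    case True
    have w: "measure ?P (W y) > 0" using window_uniform01(1)[OF \<delta> True] \<delta> by (simp add: W_def)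
    define D where "D T = {x \<in> space (iid T ?P). (y, re T x) \<in> C}" for T
    let ?Cy = "{z \<in> space (iid {..<l} ?P). (y, z) \<in> C}"
    have Cym: "?Cy \<in> sets (iid {..<l} ?P)" by measurable
    have "{x \<in> space ?MJ. (y, x) \<in> \<Phi>2} = (\<Union>T\<in>{T. T \<subseteq> ?J \<and> card T = l}. {x \<in> space ?MJ. first_hits (W y) ?J T x \<and> restrict x T \<in> D T})"
    proof -
      have "(y, re T x) \<in> C \<longleftrightarrow> restrict x T \<in> D T" if "T \<in> \<T>" for T x
        using bT[OF that] by (auto simp: D_def re_def space_PiM restrict_def cong: if_cong)
      then show ?thesis unfolding \<T>_def[symmetric] using True by (auto simp: \<Phi>2_def space_pair_measure)
    qed
    also have "measure ?MJ \<dots> \<le> \<beta>"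
    proof (rule measure_first_hits_le[OF P _ _ _ _ \<beta>0])
      fix T assume "T \<subseteq> ?J" "card T = l"
      then have T: "T \<in> \<T>" by (simp add: \<T>_def)
      note [measurable] = re_meas[OF T order.refl]
      show "D T \<in> sets (iid T ?P)" unfolding D_def by measurable
      interpret T: prob_space "iid T ?P" by (intro prob_space_PiM P)
      interpret PT: product_prob_space "\<lambda>_. ?P" T by unfold_locales
      have E: "cube {..<l} (W y) \<in> sets (iid {..<l} ?P)" by (intro sets_PiM_I_finite) auto
      have "D T \<inter> cube T (W y) = re T -` (?Cy \<inter> cube {..<l} (W y)) \<inter> space (iid T ?P)"
      proof -
        have "x \<in> cube T (W y) \<longleftrightarrow> re T x \<in> cube {..<l} (W y)" if "x \<in> space (iid T ?P)" for x
          unfolding reW[OF T] using that by (auto simp: space_PiM PiE_iff)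
        moreover have "re T x \<in> space (iid {..<l} ?P)" if "x \<in> space (iid T ?P)" for x
          using measurable_space[OF re_meas[OF T order.refl] that] .
        ultimately show ?thesis unfolding D_def by blast
      qed
      then have "measure (iid T ?P) (D T \<inter> cube T (W y)) = measure (distr (iid T ?P) (iid {..<l} ?P) (re T)) (?Cy \<inter> cube {..<l} (W y))"
        using Cym E by (simp add: measure_distr)
      also have "\<dots> \<le> \<beta> * measure ?P (W y) ^ l" unfolding re_distr[OF T] by (rule C2[OF w])
      also have "measure ?P (W y) ^ l = measure (iid T ?P) (cube T (W y))"
      proof -
        have "emeasure (iid T ?P) (cube T (W y)) = (\<Prod>i\<in>T. emeasure ?P (W y))"
          using fT[OF T] by (intro PT.emeasure_PiM) auto
        then show ?thesis using fT[OF T] by (simp add: T.emeasure_eq_measure P.emeasure_eq_measure ennreal_power)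
      qed
      finally show "measure (iid T ?P) (D T \<inter> cube T (W y)) \<le> \<beta> * measure (iid T ?P) (cube T (W y))" .
    qed auto
    finally show ?thesis .
  next
    case False
    then have empty: "{x \<in> space ?MJ. (y, x) \<in> \<Phi>2} = {}" by (auto simp: \<Phi>2_def)
    show ?thesis unfolding empty using \<beta>0 by simp
  qed
  define B where "B \<Phi> i = {x \<in> space ?M. (x i, restrict x ?J) \<in> \<Phi>}" for \<Phi> i
  have Bm: "B \<Phi> i \<in> sets ?M" if "\<Phi> \<in> sets (?P \<Otimes>\<^sub>M ?MJ)" "i \<in> {1..m}" for \<Phi> i
  proof -
    have [measurable]: "(\<lambda>x. restrict x ?J) \<in> ?M \<rightarrow>\<^sub>M ?MJ" by (rule measurable_restrict_subset) auto
    have [measurable]: "(\<lambda>x. x i) \<in> ?M \<rightarrow>\<^sub>M ?P" using that ms by (intro measurable_component_singleton) auto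
    show ?thesis unfolding B_def using that(1) by measurable
  qed
  have mB1: "measure ?M (B \<Phi>1 i) \<le> exp (- (real (s - m) * \<delta> / 8))" if "i \<in> {1..m}" for i
    unfolding B_def using that ms by (intro measure_PiM_centre_le[OF P _ _ _ _ \<Phi>1m b1]) auto
  have mB2: "measure ?M (B \<Phi>2 i) \<le> \<beta>" if "i \<in> {1..m}" for i
    unfolding B_def using that ms b2 \<beta>0 by (intro measure_PiM_centre_le[OF P _ _ _ _ \<Phi>2m]) auto
  define Bad where "Bad = (\<Union>i\<in>{1..m}. B \<Phi>1 i) \<union> (\<Union>i\<in>{1..m}. B \<Phi>2 i)"
  have Badm: "Bad \<in> sets ?M" unfolding Bad_def using Bm \<Phi>1m \<Phi>2m by (intro sets.Un sets.finite_UN) auto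
  have un: "measure ?M (\<Union>i\<in>{1..m}. B \<Phi> i) \<le> 1/12"
    if "\<Phi> \<in> sets (?P \<Otimes>\<^sub>M ?MJ)" "\<And>i. i \<in> {1..m} \<Longrightarrow> measure ?M (B \<Phi> i) \<le> a" "real m * a \<le> 1/12" for \<Phi> a
  proof -
    have "measure ?M (\<Union>i\<in>{1..m}. B \<Phi> i) \<le> (\<Sum>i\<in>{1..m}. measure ?M (B \<Phi> i))"
      using Bm that(1) by (intro M.finite_measure_subadditive_finite) auto
    also have "\<dots> \<le> (\<Sum>i\<in>{1..m}. a)" by (intro sum_mono that(2))
    finally show ?thesis using that(3) by simp
  qed
  have "measure ?M Bad \<le> measure ?M (\<Union>i\<in>{1..m}. B \<Phi>1 i) + measure ?M (\<Union>i\<in>{1..m}. B \<Phi>2 i)"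
    unfolding Bad_def using Bm \<Phi>1m \<Phi>2m by (intro measure_Un_le sets.finite_UN) auto
  also have "\<dots> \<le> 1/12 + 1/12"
    using hits(2) unif by (intro add_mono un[OF \<Phi>1m mB1] un[OF \<Phi>2m mB2]) (auto simp: \<beta>_def)
  finally have "measure ?M (space ?M - Bad) \<ge> 5/6" using M.prob_compl[OF Badm] by simp
  moreover have "l \<le> card {t \<in> ?J. x t \<in> W (x i)}" if x: "x \<in> space ?M - Bad" and i: "i \<in> {1..m}" for x i
  proof (rule ccontr)
    assume "\<not> l \<le> card {t \<in> ?J. x t \<in> W (x i)}"
    moreover have "{t \<in> ?J. restrict x ?J t \<in> W (x i)} = {t \<in> ?J. x t \<in> W (x i)}" by auto
    moreover have "(x i, restrict x ?J) \<in> space (?P \<Otimes>\<^sub>M ?MJ)" using x by (auto simp: space_pair_measure space_PiM)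
    ultimately have "(x i, restrict x ?J) \<in> \<Phi>1" by (simp add: \<Phi>1_def)
    then show False using x i by (auto simp: Bad_def B_def)
  qed
  moreover have "\<bar>emp_freq T {x. h x = f x} x - window_frac \<delta> {x. h x = f x} (x i)\<bar> \<le> \<eta>"
    if x: "x \<in> space ?M - Bad" and i: "i \<in> {1..m}" and xi: "x i \<in> {\<delta>..1 - \<delta>}"
     and T: "T \<subseteq> ?J" "card T = l" "first_hits (W (x i)) ?J T x" and h: "h \<in> H" for x i T h
  proof (rule ccontr)
    assume nb: "\<not> ?thesis"
    have T': "T \<in> \<T>" using T by (simp add: \<T>_def)
    let ?g = "{x. h x = f x}"
    have w: "measure ?P (W (x i)) > 0" using window_uniform01(1)[OF \<delta> xi] \<delta> by (simp add: W_def)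
    have fr: "measure ?P (W (x i) \<inter> ?g) / measure ?P (W (x i)) = window_frac \<delta> ?g (x i)"
      using window_uniform01(2)[OF \<delta> xi Sm[OF h]] by (simp add: W_def)
    have "re T x \<in> cube {..<l} (W (x i))" using T(3) by (simp add: reW[OF T'] first_hits_def)
    moreover have "?g \<in> G" using h by (auto simp: G_def)
    moreover have "\<bar>emp_freq {..<l} ?g (re T x) - measure ?P (W (x i) \<inter> ?g) / measure ?P (W (x i))\<bar> > \<eta>"
      unfolding re_freq[OF T'] fr using nb by simp
    ultimately have "(x i, re T x) \<in> C" by (rule C1[OF w])
    moreover have "re T (restrict x ?J) = re T x"
      unfolding re_def by (intro restrict_ext restrict_apply') (use bT[OF T'] T(1) in blast)
    moreover have "first_hits (W (x i)) ?J T (restrict x ?J)" using T by (auto simp: first_hits_def)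
    moreover have "(x i, restrict x ?J) \<in> space (?P \<Otimes>\<^sub>M ?MJ)" using x by (auto simp: space_pair_measure space_PiM)
    ultimately have "(x i, restrict x ?J) \<in> \<Phi>2" using xi T' unfolding \<Phi>2_def by (intro UN_I[OF T']) simp
    then show False using x i by (auto simp: Bad_def B_def)
  qed
  ultimately show ?thesis unfolding W_def using Badm by (intro bexI[of _ "space ?M - Bad"]) blast+
qed

section \<open>The tester\<close>

lemma centre_average_deviation:
  fixes g :: "real \<Rightarrow> real"
  assumes g[measurable]: "g \<in> borel_measurable borel" and bd: "\<And>x. 0 \<le> g x \<and> g x \<le> 1" and a: "a > 0"
    and v: "(\<integral>x. g x \<partial>uniform01) \<le> v" and ms: "m \<le> s"
  shows "measure (iid {1..s} uniform01) {x \<in> space (iid {1..s} uniform01).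
           \<bar>(\<Sum>i=1..m. g (x i)) - real m * (\<integral>x. g x \<partial>uniform01)\<bar> \<ge> a} \<le> real m * v / a\<^sup>2"
    and "{x \<in> space (iid {1..s} uniform01). \<bar>(\<Sum>i=1..m. g (x i)) - real m * (\<integral>x. g x \<partial>uniform01)\<bar> \<ge> a}
           \<in> sets (iid {1..s} uniform01)"
proof -
  let ?P = uniform01 and ?M = "iid {1..s} uniform01" and ?Mm = "iid {1..m} uniform01"
  have P: "prob_space ?P" by (rule prob_space_uniform01)
  interpret P: prob_space ?P by (rule P)
  interpret PP: product_prob_space "\<lambda>_. ?P" "{1..s}" by unfold_locales
  have gP: "g \<in> borel_measurable ?P" by simp
  let ?X = "\<lambda>M. {x \<in> space M. \<bar>(\<Sum>i=1..m. g (x i)) - real m * (\<integral>x. g x \<partial>?P)\<bar> \<ge> a}"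
  have sub: "{1..m} \<subseteq> {1..s}" using ms by auto
  have r: "(\<lambda>x. restrict x {1..m}) \<in> ?M \<rightarrow>\<^sub>M ?Mm" using sub by (rule measurable_restrict_subset)
  have Xm: "?X ?Mm \<in> sets ?Mm"
  proof -
    have "(\<lambda>x. \<Sum>i=1..m. g (x i)) \<in> borel_measurable ?Mm"
      by (intro borel_measurable_sum measurable_compose[where g=g, OF _ gP] measurable_component_singleton)
    then show ?thesis by measurable
  qed
  have eq: "?X ?M = (\<lambda>x. restrict x {1..m}) -` ?X ?Mm \<inter> space ?M"
    using measurable_space[OF r] by (auto simp: space_PiM)
  show "?X ?M \<in> sets ?M" unfolding eq using r Xm by (rule measurable_sets)
  have "measure ?M (?X ?M) = measure (distr ?M ?Mm (\<lambda>x. restrict x {1..m})) (?X ?Mm)"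
    unfolding eq using r Xm by (rule measure_distr[symmetric])
  also have "distr ?M ?Mm (\<lambda>x. restrict x {1..m}) = ?Mm" using PP.distr_restrict[OF sub] by simp
  also have "measure ?Mm (?X ?Mm) \<le> real (card {1..m}) * v / a\<^sup>2"
    using PiM_deviation_bound[OF P, of "{1..m}" g a v] bd a v by simp
  finally show "measure ?M (?X ?M) \<le> real m * v / a\<^sup>2" by simp
qed

text \<open>Let \<open>\<eta> = \<epsilon> / 128\<close> and
  \<open>L = ln (1024 / \<epsilon>)\<close>. The factor 524288 makes
  \<open>real l * \<eta>\<^sup>2 / 16\<close> at least \<open>8 * (real d * L)\<close>; the growth
  term takes back at most \<open>2 * (real d * L)\<close>, because
  \<open>32 / \<eta>\<^sup>2 \<le> (1024 / \<epsilon>)\<^sup>2\<close>. What is left,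
  \<open>exp (- 6 * L)\<close>, is the sixth power of \<open>\<epsilon> / 1024\<close> and beats the
  union bound over the centres, whose number is of order \<open>1 / \<epsilon> ^ 4\<close>.\<close>

lemma parameter_inequalities:
  fixes \<epsilon> :: real
  assumes eps: "0 < \<epsilon>" "\<epsilon> < 1/2" and k: "real k \<ge> 80 / \<epsilon>" and d: "d > 0"
  defines "m \<equiv> num_centres 4194304 \<epsilon>" and "l \<equiv> num_neighbours 524288 1024 d \<epsilon>" and "\<delta> \<equiv> radius \<epsilon> k"
  defines "s \<equiv> sample_size m l \<delta>"
  shows "0 < m" "0 < l" "m \<le> s" "4194304 / \<epsilon> ^ 4 \<le> real m" "8 \<le> real l * (\<epsilon> / 128)\<^sup>2"
    "real l \<le> real (s - m) * \<delta> / 2" "real m * exp (- (real (s - m) * \<delta> / 8)) \<le> 1/12"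
    "real m * (2 * sym_bound d l (\<epsilon> / 128 / 2 * real l) ((\<epsilon> / 128)\<^sup>2 / 32)) \<le> 1/12"
proof -
  have \<delta>: "0 < \<delta>" using parameter_bounds(3)[OF eps k] by (simp add: \<delta>_def)
  have e4: "0 < \<epsilon> ^ 4" "\<epsilon> ^ 4 \<le> 1" using eps by (auto simp: power_le_one)
  show m_ge: "4194304 / \<epsilon> ^ 4 \<le> real m" unfolding m_def num_centres_def by linarith
  have "0 < 4194304 / \<epsilon> ^ 4" using e4 by simp
  then have m_pos: "0 < real m" using m_ge by linarith
  then show "0 < m" by simp
  have "1 \<le> 4194304 / \<epsilon> ^ 4" using e4 by (simp add: field_simps)
  moreover have "real m \<le> 4194304 / \<epsilon> ^ 4 + 1"
    unfolding m_def num_centres_def using e4 by (simp add: of_nat_nat)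
  ultimately have m_le: "real m \<le> 8388608 / \<epsilon> ^ 4" by simp
  define L where "L = ln (1024 / \<epsilon>)"
  have L1: "1 \<le> L"
  proof -
    have "exp 1 \<le> (3::real)" by (rule exp_le)
    also have "3 \<le> 1024 / \<epsilon>" using eps by (simp add: field_simps)
    finally show ?thesis unfolding L_def using eps by (subst ln_ge_iff) auto
  qed
  have l_ge: "524288 * real d / \<epsilon> ^ 4 * L \<le> real l" unfolding l_def num_neighbours_def L_def by linarith
  have dL: "1 \<le> real d * L" using d L1 mult_mono[of 1 "real d" 1 L] by simp
  have le2: "8 * (real d * L) \<le> real l * (\<epsilon> / 128)\<^sup>2 / 16"
  proof -
    have "8 * (real d * L) = 2 * (real d * L) * 4" by simp
    also have "\<dots> \<le> 2 * (real d * L) * (1 / \<epsilon>\<^sup>2)"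
    proof (intro mult_left_mono)
      have "\<epsilon>\<^sup>2 \<le> (1/2)\<^sup>2" using eps by (intro power_mono) auto
      then show "4 \<le> 1 / \<epsilon>\<^sup>2" using eps by (simp add: field_simps power2_eq_square)
    qed (use dL in simp)
    also have "\<dots> = (524288 * real d / \<epsilon> ^ 4 * L) * (\<epsilon> / 128)\<^sup>2 / 16"
      using eps by (simp add: field_simps power2_eq_square power4_eq_xxxx)
    also have "\<dots> \<le> real l * (\<epsilon> / 128)\<^sup>2 / 16" using l_ge by (intro divide_right_mono mult_right_mono) auto
    finally show ?thesis .
  qed
  then show "8 \<le> real l * (\<epsilon> / 128)\<^sup>2" using dL by linarith
  then show l0: "0 < l" by (cases "l = 0") auto
  have n: "s - m = nat \<lceil>max (2 * real l / \<delta>) (8 / \<delta> * ln (12 * real m))\<rceil>" by (simp add: s_def sample_size_def)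
  show "m \<le> s" by (simp add: s_def sample_size_def)
  have n_ge: "max (2 * real l / \<delta>) (8 / \<delta> * ln (12 * real m)) \<le> real (s - m)" unfolding n by linarith
  then have "2 * real l / \<delta> \<le> real (s - m)" "8 / \<delta> * ln (12 * real m) \<le> real (s - m)" by auto
  then have n1: "real l \<le> real (s - m) * \<delta> / 2" and n2: "ln (12 * real m) \<le> real (s - m) * \<delta> / 8"
    using \<delta> by (auto simp: field_simps)
  show "real l \<le> real (s - m) * \<delta> / 2" by (rule n1)
  have "exp (- (real (s - m) * \<delta> / 8)) \<le> exp (- ln (12 * real m))" using n2 by simp
  also have "\<dots> = 1 / (12 * real m)" using m_pos by (simp add: exp_minus inverse_eq_divide)
  finally have "real m * exp (- (real (s - m) * \<delta> / 8)) \<le> real m * (1 / (12 * real m))" by (intro mult_left_mono) auto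
  then show "real m * exp (- (real (s - m) * \<delta> / 8)) \<le> 1/12" using m_pos by simp
  let ?\<eta> = "\<epsilon> / 128"
  \<comment> \<open>The choice \<open>x = \<eta>\<^sup>2 / 32\<close> spends half of the tail
    exponent \<open>real l * \<eta>\<^sup>2 / 8\<close> on the linear growth term.\<close>
  have "sym_bound d l (?\<eta> / 2 * real l) (?\<eta>\<^sup>2 / 32) = 2 * exp (real d * ln (32 / ?\<eta>\<^sup>2) - real l * ?\<eta>\<^sup>2 / 16)"
  proof -
    have "- (?\<eta> / 2 * real l)\<^sup>2 / (2 * real l) + (?\<eta>\<^sup>2 / 32 * real (2 * l) + real d * ln (1 / (?\<eta>\<^sup>2 / 32)))
        = real d * ln (32 / ?\<eta>\<^sup>2) - real l * ?\<eta>\<^sup>2 / 16"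
      using l0 by (simp add: field_simps power2_eq_square)
    then show ?thesis unfolding sym_bound_def by (simp only: mult.assoc exp_add[symmetric])
  qed
  also have "\<dots> \<le> 2 * exp (- 6 * L)"
  proof -
    have "ln (32 / ?\<eta>\<^sup>2) \<le> ln ((1024 / \<epsilon>)\<^sup>2)"
      using eps by (subst ln_le_cancel_iff) (auto simp: field_simps power2_eq_square)
    also have "\<dots> = 2 * L" using eps by (simp add: L_def ln_realpow)
    finally have "real d * ln (32 / ?\<eta>\<^sup>2) \<le> real d * (2 * L)" by (intro mult_left_mono) auto
    moreover have "L \<le> real d * L" using d L1 mult_right_mono[of 1 "real d" L] by simp
    ultimately have "real d * ln (32 / ?\<eta>\<^sup>2) - real l * ?\<eta>\<^sup>2 / 16 \<le> - 6 * L" using le2 by linarith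
    then show ?thesis by simp
  qed
  also have "exp (- 6 * L) = (\<epsilon> / 1024) ^ 6"
  proof -
    have "exp (- 6 * L) = exp (- L) ^ 6" by (simp add: exp_of_nat_mult[of 6 "- L", simplified])
    also have "exp (- L) = \<epsilon> / 1024" using eps by (simp add: L_def exp_minus)
    finally show ?thesis .
  qed
  finally have sb: "2 * sym_bound d l (?\<eta> / 2 * real l) (?\<eta>\<^sup>2 / 32) \<le> 4 * (\<epsilon> / 1024) ^ 6" by simp
  have "real m * (2 * sym_bound d l (?\<eta> / 2 * real l) (?\<eta>\<^sup>2 / 32)) \<le> (8388608 / \<epsilon> ^ 4) * (4 * (\<epsilon> / 1024) ^ 6)"
    by (intro mult_mono m_le sb) (use e4 in \<open>simp_all add: sym_bound_def\<close>)
  also have "\<dots> = (8388608 * 4 / 1024 ^ 6) * \<epsilon>\<^sup>2" using eps by (simp add: field_simps eval_nat_numeral)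
  also have "\<dots> \<le> (8388608 * 4 / 1024 ^ 6) * 1" using eps by (intro mult_left_mono power_le_one) auto
  also have "\<dots> \<le> 1/12" by simp
  finally show "real m * (2 * sym_bound d l (\<epsilon> / 128 / 2 * real l) ((\<epsilon> / 128)\<^sup>2 / 32)) \<le> 1/12" .
qed

text \<open>The deterministic half of the argument. The clause with exact agreement carries no
  \<open>\<eta>\<close>; it keeps centres far from all breakpoints free of error on the accepting
  side. The existential \<open>ns\<close> hides the partial labelling built by the query
  strategy.\<close>

lemma good_sample_estimates:
  assumes l: "0 < l" and m: "0 < m" and
    good: "\<forall>i\<in>{1..m}. l \<le> card {t \<in> {m + 1..s}. x t \<in> {x i - \<delta><..<x i + \<delta>}} \<and>
        (x i \<in> {\<delta>..1 - \<delta>} \<longrightarrow> (\<forall>T. T \<subseteq> {m + 1..s} \<longrightarrow> card T = l \<longrightarrow> first_hits {x i - \<delta><..<x i + \<delta>} {m + 1..s} T x \<longrightarrow>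
           (\<forall>h\<in>H. \<bar>emp_freq T {x. h x = f x} x - window_frac \<delta> {x. h x = f x} (x i)\<bar> \<le> \<eta>)))"
  shows "\<exists>ns. (run (NS_procedure H k \<epsilon> m l \<delta> s fallback \<omega> x) (\<lambda>n. f (x n)) \<longleftrightarrow>
       (\<Sum>i=1..m. ns i) \<le> real m * ((real k - 1) * (\<delta> / 2) * (1 + \<epsilon> / 8))) \<and>
     (\<forall>i\<in>{1..m}. 0 \<le> ns i \<and> ns i \<le> 1 \<and>
       (\<forall>h\<in>H. x i \<in> {\<delta>..1 - \<delta>} \<longrightarrow> h (x i) = f (x i) \<longrightarrow> ns i \<le> 1 - window_frac \<delta> {x. h x = f x} (x i) + \<eta>) \<and>
       (\<forall>h\<in>H. h (x i) = f (x i) \<longrightarrow> (\<forall>y\<in>{x i - \<delta><..<x i + \<delta>}. h y = f y) \<longrightarrow> ns i \<le> 0) \<and>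
       (\<forall>v\<le>1. x i \<in> {\<delta>..1 - \<delta>} \<longrightarrow>
         (\<forall>h\<in>H. h (x i) = f (x i) \<longrightarrow> v + \<eta> \<le> 1 - window_frac \<delta> {x. h x = f x} (x i)) \<longrightarrow> v \<le> ns i))"
proof -
  define t where "t i j = the (neighbour m s \<delta> x i j)" for i j
  define T where "T i = t i ` {1..l}" for i
  have nb: "\<forall>j\<in>{1..l}. neighbour m s \<delta> x i j \<noteq> None" "inj_on (t i) {1..l}" "T i \<subseteq> {m + 1..s}"
      "first_hits {x i - \<delta><..<x i + \<delta>} {m + 1..s} (T i) x" if i: "i \<in> {1..m}" for i
    using neighbours_first_hits[OF l, of m s x i \<delta>] good i unfolding t_def[abs_def] T_def by blast+
  have cT: "card (T i) = l" "finite (T i)" if "i \<in> {1..m}" for i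
    using nb(2)[OF that] by (auto simp: T_def card_image)
  have ex: "\<forall>i\<in>{1..m}. \<forall>j\<in>{1..l}. neighbour m s \<delta> x i j \<noteq> None" using nb(1) by blast
  obtain lab where lab: "\<And>i. i \<in> {1..m} \<Longrightarrow> lab i = f (x i)" "\<And>i j. i \<in> {1..m} \<Longrightarrow> j \<in> {1..l} \<Longrightarrow> lab (t i j) = f (x (t i j))"
    and run: "run (NS_procedure H k \<epsilon> m l \<delta> s fallback \<omega> x) (\<lambda>n. f (x n)) \<longleftrightarrow>
       (\<Sum>i=1..m. NS_hat_at H l t x lab i) \<le> real m * ((real k - 1) * (\<delta> / 2) * (1 + \<epsilon> / 8))"
    using run_NS_procedure[OF m ex, of f H k \<epsilon> fallback \<omega>] unfolding t_def[abs_def] by blast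
  have dev: "\<bar>emp_freq (T i) {x. h x = f x} x - window_frac \<delta> {x. h x = f x} (x i)\<bar> \<le> \<eta>"
    if "i \<in> {1..m}" "x i \<in> {\<delta>..1 - \<delta>}" "h \<in> H" for i h
    using good that nb[OF that(1)] cT[OF that(1)] by blast
  have le: "NS_hat_at H l t x lab i \<le> 1 - emp_freq (T i) {x. h x = f x} x"
    if "i \<in> {1..m}" "h \<in> H" "h (x i) = f (x i)" for i h
    unfolding T_def using nb(2) lab that l by (intro NS_hat_at_le) auto
  show ?thesis
  proof (intro exI[of _ "NS_hat_at H l t x lab"] conjI ballI allI impI)
    show "run (NS_procedure H k \<epsilon> m l \<delta> s fallback \<omega> x) (\<lambda>n. f (x n)) \<longleftrightarrow>
       (\<Sum>i=1..m. NS_hat_at H l t x lab i) \<le> real m * ((real k - 1) * (\<delta> / 2) * (1 + \<epsilon> / 8))" by (rule run)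
    show "NS_hat_at H l t x lab i \<le> 1" if "i \<in> {1..m}" for i
      using nb(2) lab that l by (intro NS_hat_at_le_1[where f=f]) auto
    show "NS_hat_at H l t x lab i \<le> 1 - window_frac \<delta> {x. h x = f x} (x i) + \<eta>"
      if "i \<in> {1..m}" "h \<in> H" "x i \<in> {\<delta>..1 - \<delta>}" "h (x i) = f (x i)" for i h
      using le[OF that(1,2,4)] dev[OF that(1,3,2)] by linarith
    show "NS_hat_at H l t x lab i \<le> 0"
      if i: "i \<in> {1..m}" "h \<in> H" "h (x i) = f (x i)" and ag: "\<forall>y\<in>{x i - \<delta><..<x i + \<delta>}. h y = f y" for i h
    proof -
      have "{t \<in> T i. x t \<in> {x. h x = f x}} = T i" using nb(4)[OF i(1)] ag by (auto simp: first_hits_def)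
      then have "emp_freq (T i) {x. h x = f x} x = 1" using cT[OF i(1)] l unfolding emp_freq_def by simp
      then show ?thesis using le[OF i] by simp
    qed
    show "v \<le> NS_hat_at H l t x lab i"
      if i: "i \<in> {1..m}" "v \<le> 1" "x i \<in> {\<delta>..1 - \<delta>}"
        and v: "\<forall>h\<in>H. h (x i) = f (x i) \<longrightarrow> v + \<eta> \<le> 1 - window_frac \<delta> {x. h x = f x} (x i)" for i v
    proof (rule NS_hat_at_ge[where f=f])
      fix h assume h: "h \<in> H" "h (x i) = f (x i)"
      show "v \<le> 1 - emp_freq (t i ` {1..l}) {y. h y = f y} x"
        using bspec[OF v h(1)] h(2) dev[OF i(1,3) h(1)] unfolding T_def by linarith
    qed (use nb(2) lab i l in auto)
    show "0 \<le> NS_hat_at H l t x lab i" if i: "i \<in> {1..m}" for i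
    proof (rule NS_hat_at_ge[where f=f])
      fix h
      show "0 \<le> 1 - emp_freq (t i ` {1..l}) {y. h y = f y} x"
        using emp_freq_bounds[OF cT(2)[OF i], of "{y. h y = f y}" x] unfolding T_def by simp
    qed (use nb(2) lab i l in auto)
  qed
qed

text \<open>With \<open>K = (real k - 1) * (\<delta> / 2)\<close> the threshold is
  \<open>K * (1 + \<epsilon> / 8)\<close>. A target in the class has mean of \<open>U\<close> at
  most \<open>K * (1 + 3 / 32 * \<epsilon>)\<close>, a far one has mean of \<open>V\<close> above
  \<open>K * (1 + \<epsilon> / 4)\<close>, and Chebyshev's inequality for the centres bridges both
  gaps. Outside the good event nothing is claimed, so the fallback may behave arbitrarily.\<close>

lemma NS_procedure_is_tester:
  fixes Y :: "'y measure" and H :: "(real \<Rightarrow> 'y) set" and R :: "'w measure"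
  assumes H: "H \<noteq> {}" and mwb: "measurably_well_behaved Y H" and zc: "zero_measure_crossings H"
    and gd: "graph_dim H = enat d" "d > 0" and eps: "0 < \<epsilon>" "\<epsilon> < 1/2" and k: "real k \<ge> 80 / \<epsilon>"
  defines "m \<equiv> num_centres 4194304 \<epsilon>" and "l \<equiv> num_neighbours 524288 1024 d \<epsilon>" and "\<delta> \<equiv> radius \<epsilon> k"
  defines "s \<equiv> sample_size m l \<delta>"
  assumes R: "prob_space R"
    and fb: "\<And>\<omega> x. \<omega> \<in> space R \<Longrightarrow> x \<in> space (iid {1..s} uniform01) \<Longrightarrow> query_bounded (fallback \<omega> x) {1..s} (m * (l + 1))"
  shows "is_tester uniform01 Y (piecewise k H) s (m * (l + 1)) \<epsilon> R (NS_procedure H k \<epsilon> m l \<delta> s fallback)"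
proof -
  let ?M = "iid {1..s} uniform01"
  note num = parameter_inequalities[OF eps k gd(2), folded m_def l_def \<delta>_def, folded s_def]
  note par = parameter_bounds[OF eps k, folded \<delta>_def]
  interpret R: prob_space R by fact
  interpret M: prob_space ?M by (intro prob_space_PiM prob_space_uniform01)
  define K where "K = (real k - 1) * (\<delta> / 2)"
  have K0: "K > 0" using par by (simp add: K_def)
  \<comment> \<open>\<open>K\<close> is
    \<open>real k * \<delta> / 2 = \<epsilon>\<^sup>2 / 64\<close> less half of
    \<open>\<delta>\<close>; since \<open>real k > 160\<close>, the subtraction only turns 64 into
    65.\<close>
  have K_ge: "\<epsilon>\<^sup>2 / 65 \<le> K"
  proof -
    have "K = real k * \<delta> / 2 - \<delta> / 2" by (simp add: K_def left_diff_distrib)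
    moreover have "160 * \<delta> \<le> real k * \<delta>" using par by (intro mult_right_mono) auto
    ultimately show ?thesis using par(5) zero_le_power2[of \<epsilon>] by linarith
  qed
  \<comment> \<open>64527 is \<open>4194304 / 65\<close> rounded down.\<close>
  have mK: "64527 \<le> real m * K * \<epsilon>\<^sup>2"
  proof -
    have "64527 \<le> (4194304 / \<epsilon> ^ 4) * (\<epsilon>\<^sup>2 / 65) * \<epsilon>\<^sup>2" using eps by (simp add: power2_eq_square power4_eq_xxxx)
    also have "\<dots> \<le> real m * K * \<epsilon>\<^sup>2" using num(4) K_ge eps K0 by (intro mult_mono) auto
    finally show ?thesis .
  qed
  have d2: "2 * \<delta> \<le> K * \<epsilon> / 16"
  proof -
    have "79 * \<delta> \<le> ((real k - 1) * \<epsilon>) * \<delta>" using par eps by (intro mult_right_mono) (auto simp: algebra_simps)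
    then show ?thesis using par(3) by (simp add: K_def algebra_simps)
  qed
  \<comment> \<open>The margin is \<open>5/6 - 1/12 > 2/3\<close>. The witness
    \<open>space R \<times> (E - D)\<close> is measurable whatever the fallback does.\<close>
  have accept: "prob_at_least (R \<Otimes>\<^sub>M ?M) (2/3) {z \<in> space (R \<Otimes>\<^sub>M ?M). Q z}"
    if E: "E \<in> sets ?M" "measure ?M E \<ge> 5/6" and D: "D \<in> sets ?M" "measure ?M D \<le> 1/12"
      and Q: "\<And>\<omega> x. \<omega> \<in> space R \<Longrightarrow> x \<in> E - D \<Longrightarrow> Q (\<omega>, x)" for E D Q
  proof -
    have "measure ?M E \<le> measure ?M ((E - D) \<union> D)" using E D by (intro M.finite_measure_mono) auto
    also have "\<dots> \<le> measure ?M (E - D) + measure ?M D" using E D by (intro measure_Un_le) auto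
    finally have "2/3 \<le> measure ?M (E - D)" using E D by linarith
    moreover have "measure (R \<Otimes>\<^sub>M ?M) (space R \<times> (E - D)) = measure ?M (E - D)"
      using M.emeasure_pair_measure_Times[OF sets.top sets.Diff[OF E(1) D(1)], of R]
      unfolding measure_def by (simp add: R.emeasure_space_1)
    moreover have "space R \<times> (E - D) \<in> sets (R \<Otimes>\<^sub>M ?M)" using E D by auto
    moreover have "space R \<times> (E - D) \<subseteq> {z \<in> space (R \<Otimes>\<^sub>M ?M). Q z}"
      using Q sets.sets_into_space[OF E(1)] by (auto simp: space_pair_measure)
    ultimately show ?thesis unfolding prob_at_least_def by (intro bexI[of _ "space R \<times> (E - D)"]) auto
  qed
  show ?thesis unfolding is_tester_def Let_def
  proof (intro conjI ballI impI)
    show "prob_space R" by fact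
    show "query_bounded (NS_procedure H k \<epsilon> m l \<delta> s fallback \<omega> x) {1..s} (m * (l + 1))"
      if "\<omega> \<in> space R" "x \<in> space ?M" for \<omega> x
      using fb[OF that] num(3) by (rule query_bounded_NS_procedure)
  next
    fix f assume "f \<in> uniform01 \<rightarrow>\<^sub>M Y"
    then have f: "f \<in> borel \<rightarrow>\<^sub>M Y" by (simp cong: measurable_cong_sets)
    have Sm: "\<And>h. h \<in> H \<Longrightarrow> {x. h x = f x} \<in> sets borel"
      and meas: "\<And>(n::nat) S. S \<subseteq> {..<n} \<Longrightarrow> {x \<in> space (iid {..<n} uniform01). \<exists>h\<in>H. \<forall>i<n. h (x i) = f (x i) \<longleftrightarrow> i \<in> S}
          \<in> sets (completion (iid {..<n} uniform01))"
      using mwb f unfolding measurably_well_behaved_def by blast+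
    have x0: "0 < (\<epsilon> / 128)\<^sup>2 / 32" "(\<epsilon> / 128)\<^sup>2 / 32 \<le> 1"
    proof -
      have "(\<epsilon> / 128)\<^sup>2 \<le> 1" using eps by (intro power_le_one) auto
      then show "(\<epsilon> / 128)\<^sup>2 / 32 \<le> 1" by simp
    qed (use eps in simp)
    have \<eta>: "0 < \<epsilon> / 128" using eps by simp
    obtain E where E: "E \<in> sets ?M" "measure ?M E \<ge> 5/6" and
      good: "\<And>x. x \<in> E \<Longrightarrow> \<forall>i\<in>{1..m}. l \<le> card {t \<in> {m + 1..s}. x t \<in> {x i - \<delta><..<x i + \<delta>}} \<and>
        (x i \<in> {\<delta>..1 - \<delta>} \<longrightarrow> (\<forall>T. T \<subseteq> {m + 1..s} \<longrightarrow> card T = l \<longrightarrow> first_hits {x i - \<delta><..<x i + \<delta>} {m + 1..s} T x \<longrightarrow>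
           (\<forall>h\<in>H. \<bar>emp_freq T {x. h x = f x} x - window_frac \<delta> {x. h x = f x} (x i)\<bar> \<le> \<epsilon> / 128)))"
      using good_event[OF gd(1) Sm meas par(3,4) num(2,3) \<eta> num(5) x0 num(6,7,8)] by blast
    let ?run = "\<lambda>z. case z of (\<omega>, x) \<Rightarrow> run (NS_procedure H k \<epsilon> m l \<delta> s fallback \<omega> x) (\<lambda>i. f (x i))"
    {
      assume "f \<in> piecewise k H"
      then obtain U where U: "U \<in> borel_measurable borel" "\<And>x. 0 \<le> U x \<and> U x \<le> 1"
        and Ux: "\<And>x. U x < 1 \<Longrightarrow> x \<in> {\<delta>..1 - \<delta>} \<and> (\<exists>h\<in>H. h x = f x \<and>
          ((\<forall>y\<in>{x - \<delta><..<x + \<delta>}. h y = f y) \<or> 1 - window_frac \<delta> {x. h x = f x} x + \<epsilon> / 128 \<le> U x))"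
        and Ui: "(\<integral>x. U x \<partial>uniform01) \<le> (real k - 1) * (\<delta> / 2 + 2 * \<delta> * (\<epsilon> / 128)) + 2 * \<delta>"
        using near_target_sensitivity[of f k H \<delta> "\<epsilon> / 128", OF _ Sm par(3,4) \<eta>] par(1) by fastforce
      let ?\<mu> = "\<integral>x. U x \<partial>uniform01"
      have "(real k - 1) * (\<delta> / 2 + 2 * \<delta> * (\<epsilon> / 128)) = K * (1 + \<epsilon> / 32)" by (simp add: K_def algebra_simps)
      then have \<mu>: "?\<mu> + K * \<epsilon> / 32 \<le> K * (1 + \<epsilon> / 8)" using Ui d2 by (simp add: algebra_simps)
      have \<mu>2: "?\<mu> \<le> 2 * K"
      proof -
        have "K * (1 + \<epsilon> / 8) \<le> K * 2" using K0 eps by (intro mult_left_mono) auto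
        moreover have "0 < K * \<epsilon> / 32" using K0 eps by simp
        ultimately show ?thesis using \<mu> by linarith
      qed
      \<comment> \<open>Of the margin \<open>\<epsilon> / 8\<close> in the threshold,
        \<open>\<epsilon> / 32\<close> is spent on the accuracy and \<open>\<epsilon> / 16\<close>
        on the ends of the interval; this is the rest.\<close>
      define a where "a = real m * (K * \<epsilon> / 32)"
      have a: "a > 0" using num(1) K0 eps by (simp add: a_def)
      define D where "D = {x \<in> space ?M. \<bar>(\<Sum>i=1..m. U (x i)) - real m * ?\<mu>\<bar> \<ge> a}"
      have D: "D \<in> sets ?M" "measure ?M D \<le> real m * (2 * K) / a\<^sup>2"
        unfolding D_def using centre_average_deviation[OF U a \<mu>2 num(3)] by auto
      have "real m * (2 * K) / a\<^sup>2 = 2048 / (real m * K * \<epsilon>\<^sup>2)"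
        using num(1) K0 eps by (simp add: a_def field_simps power2_eq_square)
      also have "\<dots> \<le> 2048 / 64527" using mK by (intro divide_left_mono) auto
      finally have D12: "measure ?M D \<le> 1/12" using D(2) by simp
      show "prob_at_least (R \<Otimes>\<^sub>M ?M) (2/3) {z \<in> space (R \<Otimes>\<^sub>M ?M). ?run z}"
      proof (rule accept[OF E D(1) D12])
        fix \<omega> x assume x: "x \<in> E - D"
        have "x \<in> E" using x by simp
        from good_sample_estimates[OF num(2,1) good[OF this], of k \<epsilon> fallback \<omega>]
        obtain ns where run: "run (NS_procedure H k \<epsilon> m l \<delta> s fallback \<omega> x) (\<lambda>n. f (x n)) \<longleftrightarrow>
             (\<Sum>i=1..m. ns i) \<le> real m * ((real k - 1) * (\<delta> / 2) * (1 + \<epsilon> / 8))"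
          and ns: "\<forall>i\<in>{1..m}. 0 \<le> ns i \<and> ns i \<le> 1 \<and>
           (\<forall>h\<in>H. x i \<in> {\<delta>..1 - \<delta>} \<longrightarrow> h (x i) = f (x i) \<longrightarrow> ns i \<le> 1 - window_frac \<delta> {x. h x = f x} (x i) + \<epsilon> / 128) \<and>
           (\<forall>h\<in>H. h (x i) = f (x i) \<longrightarrow> (\<forall>y\<in>{x i - \<delta><..<x i + \<delta>}. h y = f y) \<longrightarrow> ns i \<le> 0) \<and>
           (\<forall>v\<le>1. x i \<in> {\<delta>..1 - \<delta>} \<longrightarrow>
             (\<forall>h\<in>H. h (x i) = f (x i) \<longrightarrow> v + \<epsilon> / 128 \<le> 1 - window_frac \<delta> {x. h x = f x} (x i)) \<longrightarrow> v \<le> ns i)"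
          by (elim exE conjE)
        have "ns i \<le> U (x i)" if i: "i \<in> {1..m}" for i
        proof (cases "U (x i) < 1")
          case True
          from Ux[OF this] obtain h where xi: "x i \<in> {\<delta>..1 - \<delta>}" and h: "h \<in> H" "h (x i) = f (x i)"
            and c: "(\<forall>y\<in>{x i - \<delta><..<x i + \<delta>}. h y = f y) \<or> 1 - window_frac \<delta> {x. h x = f x} (x i) + \<epsilon> / 128 \<le> U (x i)" by blast
          from c show ?thesis
          proof
            assume "\<forall>y\<in>{x i - \<delta><..<x i + \<delta>}. h y = f y"
            then have "ns i \<le> 0" using ns i h by blast
            then show ?thesis using U(2)[of "x i"] by linarith
          next
            assume "1 - window_frac \<delta> {x. h x = f x} (x i) + \<epsilon> / 128 \<le> U (x i)"
            moreover have "ns i \<le> 1 - window_frac \<delta> {x. h x = f x} (x i) + \<epsilon> / 128" using ns i xi h by blast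
            ultimately show ?thesis by linarith
          qed
        next
          case False
          moreover have "ns i \<le> 1" using ns i by blast
          ultimately show ?thesis by linarith
        qed
        then have "(\<Sum>i=1..m. ns i) \<le> (\<Sum>i=1..m. U (x i))" by (rule sum_mono)
        also have "\<dots> \<le> real m * ?\<mu> + a"
          using x sets.sets_into_space[OF E(1)] by (auto simp: D_def not_le abs_less_iff)
        also have "\<dots> = real m * (?\<mu> + K * \<epsilon> / 32)" by (simp add: a_def algebra_simps)
        also have "\<dots> \<le> real m * (K * (1 + \<epsilon> / 8))" using \<mu> by (intro mult_left_mono) auto
        finally show "?run (\<omega>, x)" using run by (simp add: K_def)
      qed
    next
      assume far: "\<epsilon> \<le> dist_class uniform01 f (piecewise k H)"
      obtain V where V: "V \<in> borel_measurable borel" "\<And>x. 0 \<le> V x \<and> V x \<le> 1"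
        and Vx: "\<And>x. V x > 0 \<Longrightarrow> x \<in> {\<delta>..1 - \<delta>} \<and> (\<forall>h\<in>H. h x = f x \<longrightarrow> V x + \<epsilon> / 128 \<le> 1 - window_frac \<delta> {x. h x = f x} x)"
        and Vi: "(real k - 1) * (\<delta> / 2) * (1 + \<epsilon> / 4) < (\<integral>x. V x \<partial>uniform01)"
        using far_target_sensitivity[OF H Sm zc eps k \<delta>_def[THEN meta_eq_to_obj_eq] far] by blast
      define \<mu> where "\<mu> = (\<integral>x. V x \<partial>uniform01)"
      have \<mu>K: "K * (1 + \<epsilon> / 4) < \<mu>" using Vi by (simp add: \<mu>_def K_def)
      have "K * 1 \<le> K * (1 + \<epsilon> / 4)" using K0 eps by (intro mult_left_mono) auto
      then have \<mu>0: "K \<le> \<mu>" "0 < \<mu>" using \<mu>K K0 by linarith+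
      define a where "a = real m * (\<mu> - K * (1 + \<epsilon> / 8))"
      \<comment> \<open>The mean may far exceed \<open>K\<close>, so the gap is taken relative to
        \<open>\<mu>\<close>; the failure probability is then at most
        \<open>256 / (real m * \<mu> * \<epsilon>\<^sup>2)\<close>, which decreases in
        \<open>\<mu>\<close>.\<close>
      have gap: "\<mu> * \<epsilon> / 16 \<le> \<mu> - K * (1 + \<epsilon> / 8)"
      proof -
        have "\<epsilon>\<^sup>2 \<le> \<epsilon> * (1/2)" using eps by (simp add: power2_eq_square)
        moreover have "(1 + \<epsilon> / 4) * (1 - \<epsilon> / 16) = 1 + 3/16 * \<epsilon> - \<epsilon>\<^sup>2 / 64" by (simp add: power2_eq_square field_simps)
        ultimately have "1 + \<epsilon> / 8 \<le> (1 + \<epsilon> / 4) * (1 - \<epsilon> / 16)" using eps by linarith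
        then have "K * (1 + \<epsilon> / 8) \<le> K * ((1 + \<epsilon> / 4) * (1 - \<epsilon> / 16))" using K0 by (intro mult_left_mono) auto
        also have "\<dots> = (K * (1 + \<epsilon> / 4)) * (1 - \<epsilon> / 16)" by simp
        also have "\<dots> \<le> \<mu> * (1 - \<epsilon> / 16)" using \<mu>K eps by (intro mult_right_mono) auto
        finally show ?thesis by (simp add: algebra_simps)
      qed
      have a_ge: "real m * (\<mu> * \<epsilon> / 16) \<le> a" unfolding a_def using gap by (intro mult_left_mono) auto
      have a_pos: "0 < real m * (\<mu> * \<epsilon> / 16)" using num(1) \<mu>0 eps by simp
      then have a: "a > 0" using a_ge by linarith
      define D where "D = {x \<in> space ?M. \<bar>(\<Sum>i=1..m. V (x i)) - real m * \<mu>\<bar> \<ge> a}"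
      have D: "D \<in> sets ?M" "measure ?M D \<le> real m * \<mu> / a\<^sup>2"
        unfolding D_def \<mu>_def using centre_average_deviation[OF V a order.refl num(3)] by auto
      have "real m * \<mu> / a\<^sup>2 \<le> real m * \<mu> / (real m * (\<mu> * \<epsilon> / 16))\<^sup>2"
        using a_ge a_pos a \<mu>0 num(1) by (intro divide_left_mono power_mono mult_pos_pos) auto
      also have "\<dots> = 256 / (real m * \<mu> * \<epsilon>\<^sup>2)" using num(1) \<mu>0 eps by (simp add: field_simps power2_eq_square)
      also have "\<dots> \<le> 256 / 64527"
      proof (rule divide_left_mono)
        have "real m * K * \<epsilon>\<^sup>2 \<le> real m * \<mu> * \<epsilon>\<^sup>2" using \<mu>0 by (intro mult_right_mono mult_left_mono) auto
        then show "64527 \<le> real m * \<mu> * \<epsilon>\<^sup>2" using mK by linarith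
        then show "0 < real m * \<mu> * \<epsilon>\<^sup>2 * 64527" by simp
      qed simp
      finally have D12: "measure ?M D \<le> 1/12" using D(2) by simp
      show "prob_at_least (R \<Otimes>\<^sub>M ?M) (2/3) {z \<in> space (R \<Otimes>\<^sub>M ?M). \<not> ?run z}"
      proof (rule accept[OF E D(1) D12])
        fix \<omega> x assume x: "x \<in> E - D"
        have "x \<in> E" using x by simp
        from good_sample_estimates[OF num(2,1) good[OF this], of k \<epsilon> fallback \<omega>]
        obtain ns where run: "run (NS_procedure H k \<epsilon> m l \<delta> s fallback \<omega> x) (\<lambda>n. f (x n)) \<longleftrightarrow>
             (\<Sum>i=1..m. ns i) \<le> real m * ((real k - 1) * (\<delta> / 2) * (1 + \<epsilon> / 8))"
          and ns: "\<forall>i\<in>{1..m}. 0 \<le> ns i \<and> ns i \<le> 1 \<and>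
           (\<forall>h\<in>H. x i \<in> {\<delta>..1 - \<delta>} \<longrightarrow> h (x i) = f (x i) \<longrightarrow> ns i \<le> 1 - window_frac \<delta> {x. h x = f x} (x i) + \<epsilon> / 128) \<and>
           (\<forall>h\<in>H. h (x i) = f (x i) \<longrightarrow> (\<forall>y\<in>{x i - \<delta><..<x i + \<delta>}. h y = f y) \<longrightarrow> ns i \<le> 0) \<and>
           (\<forall>v\<le>1. x i \<in> {\<delta>..1 - \<delta>} \<longrightarrow>
             (\<forall>h\<in>H. h (x i) = f (x i) \<longrightarrow> v + \<epsilon> / 128 \<le> 1 - window_frac \<delta> {x. h x = f x} (x i)) \<longrightarrow> v \<le> ns i)"
          by (elim exE conjE)
        have "V (x i) \<le> ns i" if i: "i \<in> {1..m}" for i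
        proof (cases "V (x i) > 0")
          case True
          then show ?thesis using Vx[OF True] V(2)[of "x i"] ns i by blast
        next
          case False
          moreover have "0 \<le> ns i" using ns i by blast
          ultimately show ?thesis by linarith
        qed
        then have "(\<Sum>i=1..m. V (x i)) \<le> (\<Sum>i=1..m. ns i)" by (rule sum_mono)
        moreover have "real m * \<mu> - a < (\<Sum>i=1..m. V (x i))"
          using x sets.sets_into_space[OF E(1)] by (auto simp: D_def not_le abs_less_iff)
        moreover have "real m * \<mu> - a = real m * (K * (1 + \<epsilon> / 8))" by (simp add: a_def algebra_simps)
        ultimately show "\<not> ?run (\<omega>, x)" using run by (simp add: K_def)
      qed
    }
  qed
qed

theorem theorem3:
  shows "\<exists>c c' c'' :: real. c \<ge> 1 \<and> c' \<ge> 1 \<and> c'' \<ge> 1 \<and>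
    (\<forall>(Y :: 'y measure) (H :: (real \<Rightarrow> 'y) set) (d :: nat) (\<epsilon> :: real) (k :: nat).
       space Y \<noteq> {} \<and> H \<noteq> {} \<and> H \<subseteq> borel \<rightarrow>\<^sub>M Y \<and> measurably_well_behaved Y H \<and>
       zero_measure_crossings H \<and> graph_dim H = enat d \<and> d > 0 \<and>
       0 < \<epsilon> \<and> \<epsilon> < 1 / 2 \<and> real k \<ge> 80 / \<epsilon> \<longrightarrow>
       (let m = num_centres c \<epsilon>;
            l = num_neighbours c' c'' d \<epsilon>;
            \<delta> = radius \<epsilon> k;
            s = sample_size m l \<delta>;
            q = m * (l + 1)
        in \<forall>(R :: 'w measure) fallback.
             prob_space R \<and>
             (\<forall>\<omega>\<in>space R. \<forall>x\<in>space (PiM {1..s} (\<lambda>_. uniform01)).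
                query_bounded (fallback \<omega> x) {1..s} q) \<longrightarrow>
             is_tester uniform01 Y (piecewise k H) s q \<epsilon> R
               (NS_procedure H k \<epsilon> m l \<delta> s fallback)))"
  unfolding Let_def
proof (rule exI[of _ 4194304], rule exI[of _ 524288], rule exI[of _ 1024], intro conjI allI impI)
  fix Y :: "'y measure" and H d \<epsilon> k and R :: "'w measure"
    and fallback :: "'w \<Rightarrow> (nat \<Rightarrow> real) \<Rightarrow> 'y strategy"
  assume *: "space Y \<noteq> {} \<and> H \<noteq> {} \<and> H \<subseteq> borel \<rightarrow>\<^sub>M Y \<and> measurably_well_behaved Y H \<and>
       zero_measure_crossings H \<and> graph_dim H = enat d \<and> d > 0 \<and> 0 < \<epsilon> \<and> \<epsilon> < 1 / 2 \<and> real k \<ge> 80 / \<epsilon>"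
  let ?m = "num_centres 4194304 \<epsilon>" and ?l = "num_neighbours 524288 1024 d \<epsilon>" and ?\<delta> = "radius \<epsilon> k"
  let ?s = "sample_size ?m ?l ?\<delta>"
  assume **: "prob_space R \<and> (\<forall>\<omega>\<in>space R. \<forall>x\<in>space (PiM {1..?s} (\<lambda>_. uniform01)).
      query_bounded (fallback \<omega> x) {1..?s} (?m * (?l + 1)))"
  show "is_tester uniform01 Y (piecewise k H) ?s (?m * (?l + 1)) \<epsilon> R (NS_procedure H k \<epsilon> ?m ?l ?\<delta> ?s fallback)"
    by (rule NS_procedure_is_tester) (use * ** in blast)+
qed auto

end
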